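(* Let $\mathcal T$ be the multi-valued operator that maps every pair $(\phi,\psi)$ of continuous paths $\phi,\psi:[0,1]\to[0,1]^2$ satisfying $$\phi(0)=(0,0),\quad \phi(1)=(1,1),\quad \psi(0)=(0,1),\quad \psi(1)=(1,0)$$ to some pair $(S_\phi,S_\psi)$ of closed intervals such that $\phi(S_\phi)=\psi(S_\psi)$. Then $\mathcal T$ is computable.
   Context: Closed intervals are by definition non-empty. Computability is meant in the sense of Type-2 Theory of Effectivity (TTE): computations are performed by Type-2 Turing machines on names with respect to representations, and a multi-valued operator is computable if some computable function on names maps every name of every input to a name of some admissible output. Continuous functions $[0,1]\to\mathbb R^2$ are represented by the canonical (standard) representation of continuous functions. Closed intervals are represented by the outer representation: a name of a closed interval $S$ is a sequence $I_0\supseteq I_1\supseteq I_2\supseteq\cdots$ of closed intervals with rational endpoints such that $S=\bigcap_n I_n$. *)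

theory Defs
  imports "HOL-Analysis.Analysis" "HOL-Library.Nat_Bijection"
begin

section \<open>Type-2 Turing machines\<close>

text \<open>
  Names are infinite sequences over the alphabet \<^typ>\<open>bool\<close>. A machine has a one-way
  read-only input tape holding a name, a one-way write-only output tape and finitely many
  two-way infinite work tapes. The control states are \<open>0, \<dots>, num_states M - 1\<close> (initial
  state \<open>0\<close>) and the work tape symbols are \<open>0, \<dots>, num_symbols M - 1\<close> (blank \<open>0\<close>).

  The transition function receives the control state, the scanned input symbol and the list
  of scanned work tape symbols. It answers \<open>None\<close> (halt) or \<open>Some\<close> of: the next state, for
  each work tape the symbol to write and the head movement, whether the input head advances,
  and the symbol to append to the output, if any.
\<close>

type_synonym name = "nat \<Rightarrow> bool"

datatype move = Move_Left | Stay | Move_Right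

record machine =
  num_states :: nat
  num_symbols :: nat
  num_tapes :: nat
  trans :: "nat \<Rightarrow> bool \<Rightarrow> nat list \<Rightarrow> (nat \<times> (nat \<times> move) list \<times> bool \<times> bool option) option"

text \<open>
  Only the finitely many arguments quantified over here are ever passed to the transition
  function in a run, so that a machine is a finite object.
\<close>

definition type2_machine :: "machine \<Rightarrow> bool" where
  "type2_machine M \<longleftrightarrow> num_states M > 0 \<and> num_symbols M > 0 \<and>
     (\<forall>q b ws q' acts adv out.
        q < num_states M \<longrightarrow> length ws = num_tapes M \<longrightarrow> set ws \<subseteq> {..<num_symbols M} \<longrightarrow>
        trans M q b ws = Some (q', acts, adv, out) \<longrightarrow>
        q' < num_states M \<and> length acts = num_tapes M \<and> fst ` set acts \<subseteq> {..<num_symbols M})"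

text \<open>A work tape is given by its head position and its content.\<close>

type_synonym tape = "int \<times> (int \<Rightarrow> nat)"

fun scanned :: "tape \<Rightarrow> nat" where
  "scanned (h, t) = t h"

fun move_offset :: "move \<Rightarrow> int" where
  "move_offset Move_Left = -1"
| "move_offset Stay = 0"
| "move_offset Move_Right = 1"

fun act :: "nat \<times> move \<Rightarrow> tape \<Rightarrow> tape" where
  "act (a, m) (h, t) = (h + move_offset m, t(h := a))"

record config =
  state :: nat
  in_pos :: nat
  work :: "tape list"
  written :: "bool list"

definition initial_config :: "machine \<Rightarrow> config" where
  "initial_config M =
     \<lparr>state = 0, in_pos = 0, work = replicate (num_tapes M) (0, \<lambda>_. 0), written = []\<rparr>"

definition step :: "machine \<Rightarrow> name \<Rightarrow> config \<Rightarrow> config" where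
  "step M p c =
     (case trans M (state c) (p (in_pos c)) (map scanned (work c)) of
        None \<Rightarrow> c
      | Some (q, acts, adv, out) \<Rightarrow>
          \<lparr>state = q,
           in_pos = (if adv then Suc (in_pos c) else in_pos c),
           work = map2 act acts (work c),
           written = written c @ (case out of None \<Rightarrow> [] | Some b \<Rightarrow> [b])\<rparr>)"

definition run :: "machine \<Rightarrow> name \<Rightarrow> nat \<Rightarrow> config" where
  "run M p t = (step M p ^^ t) (initial_config M)"

text \<open>On input \<open>p\<close>, the machine computes forever and writes the infinite sequence \<open>q\<close>.\<close>

definition outputs :: "machine \<Rightarrow> name \<Rightarrow> name \<Rightarrow> bool" where
  "outputs M p q \<longleftrightarrow>
     (\<forall>i. \<exists>t. i < length (written (run M p t)) \<and> written (run M p t) ! i = q i)"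

definition computable_fun :: "(name \<Rightarrow> name option) \<Rightarrow> bool" where
  "computable_fun F \<longleftrightarrow>
     (\<exists>M. type2_machine M \<and> (\<forall>p q. F p = Some q \<longleftrightarrow> outputs M p q))"


section \<open>Representations and computable multi-valued operators\<close>

text \<open>\<open>\<delta> p x\<close> means that \<open>p\<close> is a name of \<open>x\<close>.\<close>

type_synonym 'a representation = "name \<Rightarrow> 'a \<Rightarrow> bool"

definition pair_rep ::
    "'a representation \<Rightarrow> 'b representation \<Rightarrow> ('a \<times> 'b) representation" where
  "pair_rep \<delta> \<delta>' p xy \<longleftrightarrow>
     \<delta> (\<lambda>n. p (2 * n)) (fst xy) \<and> \<delta>' (\<lambda>n. p (2 * n + 1)) (snd xy)"

text \<open>
  The domain \<open>D\<close> is explicit and is not read off as \<open>{x. T x \<noteq> {}}\<close>: computability includes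
  that every \<open>x \<in> D\<close> has an admissible output.
\<close>

definition computable_operator ::
    "'a representation \<Rightarrow> 'b representation \<Rightarrow> 'a set \<Rightarrow> ('a \<Rightarrow> 'b set) \<Rightarrow> bool" where
  "computable_operator \<delta> \<delta>' D T \<longleftrightarrow>
     (\<exists>F. computable_fun F \<and>
        (\<forall>x\<in>D. \<forall>p. \<delta> p x \<longrightarrow> (\<exists>q y. F p = Some q \<and> \<delta>' q y \<and> y \<in> T x)))"


section \<open>Names of continuous functions and of closed intervals\<close>

text \<open>
  \<open>p\<close> is the infinite word consisting of \<open>s 0\<close> ones, a zero, \<open>s 1\<close> ones, a zero, and so on.
\<close>

definition encodes :: "name \<Rightarrow> (nat \<Rightarrow> nat) \<Rightarrow> bool" where
  "encodes p s \<longleftrightarrow>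
     (\<forall>n. let w = concat (map (\<lambda>i. replicate (s i) True @ [False]) [0..<n])
          in map p [0..<length w] = w)"

definition rat_of_code :: "nat \<Rightarrow> real" where
  "rat_of_code n = (let (a, b) = prod_decode n in real_of_int (int_decode a) / real (Suc b))"

definition lower :: "nat \<Rightarrow> real" where
  "lower n = rat_of_code (fst (prod_decode n))"

definition upper :: "nat \<Rightarrow> real" where
  "upper n = rat_of_code (snd (prod_decode n))"

text \<open>
  The standard representation of \<open>C([0,1], \<real>\<^sup>2)\<close> with respect to the usual effective subbase of
  the compact-open topology: a name of \<open>f\<close> lists all codes of pairs of a closed rational
  interval \<open>I \<subseteq> [0,1]\<close> and an open rational rectangle \<open>J\<close> such that \<open>f(I) \<subseteq> J\<close>.
  A function on \<open>[0,1]\<close> is given by a total function whose values outside \<open>[0,1]\<close> are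
  irrelevant.
\<close>

definition subbasic_codes :: "(real \<Rightarrow> real \<times> real) \<Rightarrow> nat set" where
  "subbasic_codes f =
     {prod_encode (i, prod_encode (j, k)) | i j k.
        0 \<le> lower i \<and> lower i \<le> upper i \<and> upper i \<le> 1 \<and>
        f ` {lower i..upper i} \<subseteq> {lower j<..<upper j} \<times> {lower k<..<upper k}}"

definition path_rep :: "(real \<Rightarrow> real \<times> real) representation" where
  "path_rep p f \<longleftrightarrow>
     continuous_on {0..1} f \<and> (\<exists>s. encodes p s \<and> range s = subbasic_codes f)"

definition closed_interval :: "real set \<Rightarrow> bool" where
  "closed_interval S \<longleftrightarrow> (\<exists>a b. a \<le> b \<and> S = {a..b})"

definition outer_rep :: "real set representation" where
  "outer_rep p S \<longleftrightarrow>
     closed_interval S \<and>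
     (\<exists>s. encodes p s \<and> (\<forall>n. lower (s n) \<le> upper (s n)) \<and>
          (\<forall>n. {lower (s (Suc n))..upper (s (Suc n))} \<subseteq> {lower (s n)..upper (s n)}) \<and>
          S = (\<Inter>n. {lower (s n)..upper (s n)}))"


section \<open>The operator of intersecting subpaths\<close>

definition crossing_paths :: "((real \<Rightarrow> real \<times> real) \<times> (real \<Rightarrow> real \<times> real)) set" where
  "crossing_paths =
     {(\<phi>, \<psi>). path \<phi> \<and> path_image \<phi> \<subseteq> {0..1} \<times> {0..1} \<and>
              path \<psi> \<and> path_image \<psi> \<subseteq> {0..1} \<times> {0..1} \<and>
              \<phi> 0 = (0, 0) \<and> \<phi> 1 = (1, 1) \<and> \<psi> 0 = (0, 1) \<and> \<psi> 1 = (1, 0)}"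

definition intersection_op ::
    "(real \<Rightarrow> real \<times> real) \<times> (real \<Rightarrow> real \<times> real) \<Rightarrow> (real set \<times> real set) set" where
  "intersection_op = (\<lambda>(\<phi>, \<psi>).
     {(S, S'). closed_interval S \<and> S \<subseteq> {0..1} \<and> closed_interval S' \<and> S' \<subseteq> {0..1} \<and>
               \<phi> ` S = \<psi> ` S'})"

end

theory Submission
  imports Defs
begin

text \<open>
  Extend both paths horizontally to \<open>[-1, 2]\<close> and put \<open>F (s, t) = \<phi> s - \<psi> t\<close>. On the boundary of
  \<open>[-1, 2]\<^sup>2\<close> the map \<open>F\<close> has no zero and odd winding number. If \<open>F\<close> has odd winding number along
  the boundary of a rectangle, then it has a zero inside; and if the rectangle is cut along a line on
  which \<open>F\<close> has no zero, then one of the two halves inherits the property. Both facts are read off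
  from continuous square roots of \<open>F\<close>, which exist along a boundary iff the winding number is even.
  Both the absence of zeros on a line and the oddness are witnessed by finitely many boxes from the
  names of the paths.

  Every rational cut is examined again and again. As soon as the names show that the cut does not
  meet a zero, a certificate of oddness is awaited for one of the two halves, which becomes the new
  rectangle. Let \<open>I \<times> J\<close> be the intersection of these rectangles. For a rational \<open>s\<close> inside
  \<open>I\<close> the cut at \<open>s\<close> was never made, hence \<open>\<phi> s \<in> \<psi> ` J\<close>; by density \<open>\<phi> ` I \<subseteq> \<psi> ` J\<close>, where a
  zero of \<open>F\<close> in \<open>I \<times> J\<close> settles the case of a single point. The converse inclusion is symmetric,
  and the extensions do not meet, so \<open>I\<close> and \<open>J\<close> lie in \<open>[0, 1]\<close>.

  Each round is primitive recursive in the part of the input read so far, and primitive recursive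
  functions are computed by counter programs, which are simulated by a machine with one tape per
  counter.
\<close>

section \<open>Counter programs\<close>

text \<open>That the paths are apart along a cut is confirmed by finitely many boxes, but a failure
  of it is never recognised. Waiting for one particular cut could thus last forever, and this is why
  intervals instead of points are produced: an unconfirmed cut is no defect of the result, since it
  puts a point of one path on the other.

  The unit square is no suitable start. One path may pass through an end point of the other, and
  then \<open>F\<close> vanishes on the boundary of the square. The horizontal collars move the
  boundary to a place where the relative position of the paths is known beforehand.

  Parity replaces the winding number because halving needs no more: square roots on two halves glue
  to a square root on the whole, so a half of an odd rectangle is odd again. Confirming a cut and
  choosing a half are kept apart because they differ in status. The first may never succeed and must
  be interleaved with all other cuts; once it has succeeded, an odd half exists and its certificate
  is bound to appear, so the run can safely do nothing but wait.\<close>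

datatype com = Skip | Inc nat | Dec nat | Read nat | Write nat
  | Seq com com | If nat com com | While nat com

text \<open>
  The next command, the moves of the counters, whether an input bit is consumed and the bit
  written; \<open>b\<close> is the current input bit and \<open>z r\<close> tells whether counter \<open>r\<close> is zero.
\<close>

fun next_com :: "com \<Rightarrow> bool \<Rightarrow> (nat \<Rightarrow> bool) \<Rightarrow> (com \<times> (nat \<Rightarrow> move) \<times> bool \<times> bool option) option"
where
  "next_com Skip b z = None"
| "next_com (Inc r) b z = Some (Skip, (\<lambda>_. Stay)(r := Move_Right), False, None)"
| "next_com (Dec r) b z =
     Some (Skip, (\<lambda>_. Stay)(r := if z r then Stay else Move_Left), False, None)"
| "next_com (Read r) b z =
     Some (Skip, (\<lambda>_. Stay)(r := if b then Move_Right else Stay), True, None)"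
| "next_com (Write r) b z = Some (Skip, \<lambda>_. Stay, False, Some (\<not> z r))"
| "next_com (Seq c d) b z =
     (case next_com c b z of None \<Rightarrow> Some (d, \<lambda>_. Stay, False, None)
      | Some (c', m, adv, out) \<Rightarrow> Some (Seq c' d, m, adv, out))"
| "next_com (If r c d) b z = Some (if z r then d else c, \<lambda>_. Stay, False, None)"
| "next_com (While r c) b z =
     Some (if z r then Skip else Seq c (While r c), \<lambda>_. Stay, False, None)"

text \<open>The components are the counter values, the number of input bits consumed and the output
  written so far.\<close>

type_synonym store = "(nat \<Rightarrow> nat) \<times> nat \<times> bool list"

text \<open>A small-step semantics gives an observable output to programs that never end, and one
  step here becomes one step of the machine.\<close>

inductive com_step :: "name \<Rightarrow> com \<times> store \<Rightarrow> com \<times> store \<Rightarrow> bool" for p where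
  "next_com c (p i) (\<lambda>r. \<sigma> r = 0) = Some (c', m, adv, out) \<Longrightarrow>
   com_step p (c, \<sigma>, i, os)
     (c', \<lambda>r. nat (int (\<sigma> r) + move_offset (m r)), if adv then Suc i else i,
      os @ (case out of None \<Rightarrow> [] | Some b \<Rightarrow> [b]))"

abbreviation com_steps :: "name \<Rightarrow> com \<times> store \<Rightarrow> com \<times> store \<Rightarrow> bool" where
  "com_steps p \<equiv> (com_step p)\<^sup>*\<^sup>*"

definition exec :: "name \<Rightarrow> com \<Rightarrow> store \<Rightarrow> store \<Rightarrow> bool" where
  "exec p c s s' \<longleftrightarrow> com_steps p (c, s) (Skip, s')"

lemma exec_Skip: "exec p Skip s s"
  by (simp add: exec_def)

lemma exec_Inc: "exec p (Inc r) (\<sigma>, i, os) (\<sigma>(r := Suc (\<sigma> r)), i, os)"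
proof -
  have "com_step p (Inc r, \<sigma>, i, os)
      (Skip, \<lambda>r'. nat (int (\<sigma> r') + move_offset (((\<lambda>_. Stay)(r := Move_Right)) r')),
       if False then Suc i else i, os @ (case None of None \<Rightarrow> [] | Some b \<Rightarrow> [b]))"
    by (rule com_step.intros) (simp add: fun_upd_def)
  moreover have "(\<lambda>r'. nat (int (\<sigma> r') + move_offset (((\<lambda>_. Stay)(r := Move_Right)) r')))
      = \<sigma>(r := Suc (\<sigma> r))"
    by (auto simp: fun_eq_iff nat_add_distrib)
  ultimately show ?thesis
    by (auto simp: exec_def)
qed

lemma exec_Dec: "exec p (Dec r) (\<sigma>, i, os) (\<sigma>(r := \<sigma> r - 1), i, os)"
proof -
  let ?m = "(\<lambda>_. Stay)(r := if \<sigma> r = 0 then Stay else Move_Left)"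
  have "com_step p (Dec r, \<sigma>, i, os)
      (Skip, \<lambda>r'. nat (int (\<sigma> r') + move_offset (?m r')),
       if False then Suc i else i, os @ (case None of None \<Rightarrow> [] | Some b \<Rightarrow> [b]))"
    by (rule com_step.intros) (simp add: fun_upd_def)
  moreover have "(\<lambda>r'. nat (int (\<sigma> r') + move_offset (?m r'))) = \<sigma>(r := \<sigma> r - 1)"
    by (auto simp: fun_eq_iff nat_diff_distrib')
  ultimately show ?thesis
    by (auto simp: exec_def)
qed

lemma exec_Read:
  "exec p (Read r) (\<sigma>, i, os) (\<sigma>(r := \<sigma> r + of_bool (p i)), Suc i, os)"
proof -
  let ?m = "(\<lambda>_. Stay)(r := if p i then Move_Right else Stay)"
  have "com_step p (Read r, \<sigma>, i, os)
      (Skip, \<lambda>r'. nat (int (\<sigma> r') + move_offset (?m r')),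
       if True then Suc i else i, os @ (case None of None \<Rightarrow> [] | Some b \<Rightarrow> [b]))"
    by (rule com_step.intros) (simp add: fun_upd_def)
  moreover have "(\<lambda>r'. nat (int (\<sigma> r') + move_offset (?m r'))) = \<sigma>(r := \<sigma> r + of_bool (p i))"
    by (auto simp: fun_eq_iff)
  ultimately show ?thesis
    by (auto simp: exec_def)
qed

lemma exec_Write: "exec p (Write r) (\<sigma>, i, os) (\<sigma>, i, os @ [\<sigma> r \<noteq> 0])"
proof -
  have "com_step p (Write r, \<sigma>, i, os)
      (Skip, \<lambda>r'. nat (int (\<sigma> r') + move_offset Stay),
       if False then Suc i else i,
       os @ (case Some (\<sigma> r \<noteq> 0) of None \<Rightarrow> [] | Some b \<Rightarrow> [b]))"
    by (rule com_step.intros) simp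
  then show ?thesis
    by (auto simp: exec_def)
qed

lemma silent_step:
  assumes "next_com c (p i) (\<lambda>r. \<sigma> r = 0) = Some (c', \<lambda>_. Stay, False, None)"
  shows "com_step p (c, \<sigma>, i, os) (c', \<sigma>, i, os)"
  using com_step.intros[of c p i \<sigma> c' "\<lambda>_. Stay" False None os] assms by simp

lemma com_steps_Seq:
  assumes "com_steps p (c, s) (c', s')"
  shows "com_steps p (Seq c d, s) (Seq c' d, s')"
  using assms
proof (induction rule: rtranclp_induct2)
  case (step c' s' c'' s'')
  have "com_step p (Seq c' d, s') (Seq c'' d, s'')"
    using step.hyps(2)
  proof cases
    case (1 i \<sigma> m adv out os)
    show ?thesis
      unfolding 1(1,2) by (rule com_step.intros) (simp add: 1(3))
  qed
  then show ?case
    using step.IH by (rule rtranclp.rtrancl_into_rtrancl[rotated])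
qed simp

lemma exec_Seq_steps:
  assumes "exec p c s s'"
  shows "com_steps p (Seq c d, s) (d, s')"
proof -
  obtain \<sigma> i os where s': "s' = (\<sigma>, i, os)" by (cases s')
  have "com_steps p (Seq c d, s) (Seq Skip d, s')"
    using assms by (simp add: exec_def com_steps_Seq)
  also have "com_step p (Seq Skip d, s') (d, s')"
    unfolding s' by (rule silent_step) simp
  finally show ?thesis .
qed

lemma exec_Seq: "exec p c s s' \<Longrightarrow> exec p d s' s'' \<Longrightarrow> exec p (Seq c d) s s''"
  using exec_Seq_steps unfolding exec_def by (rule rtranclp_trans)

lemma exec_If:
  assumes "exec p (if fst s r = 0 then d else c) s s'"
  shows "exec p (If r c d) s s'"
proof -
  obtain \<sigma> i os where s: "s = (\<sigma>, i, os)" by (cases s)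
  have "com_step p (If r c d, s) (if \<sigma> r = 0 then d else c, s)"
    unfolding s by (rule silent_step) simp
  then show ?thesis
    using assms s unfolding exec_def by (auto intro: converse_rtranclp_into_rtranclp)
qed

lemma While_steps:
  assumes "fst s r \<noteq> 0" "exec p c s s'"
  shows "com_steps p (While r c, s) (While r c, s')"
proof -
  obtain \<sigma> i os where s: "s = (\<sigma>, i, os)" by (cases s)
  have "com_step p (While r c, s) (Seq c (While r c), s)"
    unfolding s by (rule silent_step) (use assms s in simp)
  then show ?thesis
    using exec_Seq_steps[OF assms(2)] by (rule converse_rtranclp_into_rtranclp)
qed

lemma exec_While_zero:
  assumes "fst s r = 0"
  shows "exec p (While r c) s s"
proof -
  obtain \<sigma> i os where s: "s = (\<sigma>, i, os)" by (cases s)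
  have "com_step p (While r c, s) (Skip, s)"
    unfolding s by (rule silent_step) (use assms s in simp)
  then show ?thesis
    unfolding exec_def by blast
qed

text \<open>Loops are verified through a closed form \<open>s j\<close> of the store after
  \<open>j\<close> rounds.\<close>

lemma exec_While_iterate:
  assumes "\<And>j. j < n \<Longrightarrow> fst (s j) r \<noteq> 0 \<and> exec p c (s j) (s (Suc j))" "fst (s n) r = 0"
  shows "exec p (While r c) (s 0) (s n)"
proof -
  have "com_steps p (While r c, s 0) (While r c, s j)" if "j \<le> n" for j
    using that
  proof (induction j)
    case (Suc j)
    then show ?case
      using While_steps[of "s j" r p c "s (Suc j)"] assms(1)[of j] by (auto intro: rtranclp_trans)
  qed simp
  then show ?thesis
    using exec_While_zero[of "s n" r p c] assms(2) unfolding exec_def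
    by (meson order_refl rtranclp_trans)
qed

section \<open>Simulation of counter programs by a Type-2 machine\<close>

primrec counters :: "com \<Rightarrow> nat set" where
  "counters Skip = {}"
| "counters (Inc r) = {r}"
| "counters (Dec r) = {r}"
| "counters (Read r) = {r}"
| "counters (Write r) = {r}"
| "counters (Seq c d) = counters c \<union> counters d"
| "counters (If r c d) = {r} \<union> counters c \<union> counters d"
| "counters (While r c) = {r} \<union> counters c"

text \<open>An over-approximation of the residual programs of a run of \<open>c\<close>. Being
  finite, it can serve as the set of control states.\<close>

primrec reach :: "com \<Rightarrow> com set" where
  "reach Skip = {Skip}"
| "reach (Inc r) = {Inc r, Skip}"
| "reach (Dec r) = {Dec r, Skip}"
| "reach (Read r) = {Read r, Skip}"
| "reach (Write r) = {Write r, Skip}"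
| "reach (Seq c d) = (\<lambda>c'. Seq c' d) ` reach c \<union> reach d"
| "reach (If r c d) = {If r c d} \<union> reach c \<union> reach d"
| "reach (While r c) = {While r c, Skip} \<union> (\<lambda>c'. Seq c' (While r c)) ` reach c"

lemma finite_counters: "finite (counters c)"
  by (induction c) auto

lemma finite_reach: "finite (reach c)"
  by (induction c) auto

lemma reach_self: "c \<in> reach c"
  by (induction c) auto

lemma reach_next:
  "d \<in> reach c \<Longrightarrow> next_com d b z = Some (d', m, adv, out) \<Longrightarrow> d' \<in> reach c"
proof (induction c arbitrary: d d' m adv out)
  case (Seq c1 c2)
  show ?case
  proof (cases "d \<in> reach c2")
    case True
    then show ?thesis using Seq.IH(2) Seq.prems by auto
  next
    case False
    then obtain e where "e \<in> reach c1" "d = Seq e c2" using Seq.prems by auto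
    then show ?thesis
      using Seq.prems Seq.IH(1)[of e] reach_self[of c2]
      by (auto split: option.splits)
  qed
next
  case (While r c)
  then show ?case
    by (auto split: option.splits if_splits simp: reach_self)
qed (auto split: if_splits simp: reach_self)

lemma counters_reach: "d \<in> reach c \<Longrightarrow> counters d \<subseteq> counters c"
  by (induction c arbitrary: d) (auto; fastforce)+

text \<open>The machine has tapes only for the counters of the program, so the zero test of a
  command must not depend on any others.\<close>

lemma next_com_cong:
  "counters c \<subseteq> A \<Longrightarrow> (\<And>r. r \<in> A \<Longrightarrow> z r = z' r) \<Longrightarrow> next_com c b z = next_com c b z'"
  by (induction c) auto

text \<open>Head positions are integers and counter values natural numbers. The two stay equal
  because no head moves to the left of position 0, so that the truncation by \<open>nat\<close> in
  \<open>com_step\<close> never takes effect.\<close>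

lemma next_com_Move_Left:
  "next_com c b z = Some (c', m, adv, out) \<Longrightarrow> m r = Move_Left \<Longrightarrow> \<not> z r"
  by (induction c arbitrary: c' m adv out) (auto split: if_splits option.splits)

lemma written_run_mono: "t \<le> t' \<Longrightarrow> \<exists>w. written (run M p t') = written (run M p t) @ w"
proof (induction t' rule: dec_induct)
  case (step n)
  have "\<exists>w. written (step M p x) = written x @ w" for x
    by (auto simp: step_def split: option.splits)
  then show ?case
    using step by (simp add: run_def) (metis append_assoc)
qed simp

text \<open>Output is never erased, so two sequences written by the same run agree everywhere. The
  equivalence in \<open>computable_fun\<close> demands this.\<close>

lemma outputs_unique:
  assumes "outputs M p q" "outputs M p q'"
  shows "q = q'"
proof
  fix i
  obtain t t' where t: "i < length (written (run M p t))" "written (run M p t) ! i = q i"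
    "i < length (written (run M p t'))" "written (run M p t') ! i = q' i"
    using assms unfolding outputs_def by meson
  obtain w w' where "written (run M p (max t t')) = written (run M p t) @ w"
    "written (run M p (max t t')) = written (run M p t') @ w'"
    using written_run_mono by (metis max.cobounded1 max.cobounded2)
  then show "q i = q' i"
    using t by (metis nth_append_left)
qed

text \<open>
  Each counter is a work tape: its value is the head position, and position 0 carries the only
  symbol 1, so that the scanned symbol tells whether the counter is zero. State 0 writes these
  markers.
\<close>

definition counter_tape :: "nat \<Rightarrow> tape" where
  "counter_tape v = (int v, \<lambda>h. if h = 0 then 1 else 0)"

text \<open>The program need not halt: it suffices that every finite prefix of \<open>G p\<close> is
  at some moment exactly the output.\<close>

lemma computable_fun_com:
  assumes "\<And>p n. \<exists>c' \<sigma> i. com_steps p (c, \<lambda>_. 0, 0, []) (c', \<sigma>, i, map (G p) [0..<n])"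
  shows "computable_fun (\<lambda>p. Some (G p))"
proof -
  obtain f0 where "bij_betw f0 (reach c) {0..<card (reach c)}"
    using ex_bij_betw_finite_nat[OF finite_reach] by blast
  define n where "n = card (reach c)"
  \<comment> \<open>The shift by one keeps state 0 free for the initial step that writes the
    markers.\<close>
  define f where "f d = Suc (f0 d)" for d
  define g where "g = inv_into (reach c) f"
  have "bij_betw f (reach c) (Suc ` {0..<n})"
    using bij_betw_trans[OF \<open>bij_betw f0 _ _\<close>, of Suc "Suc ` {0..<n}"]
    by (simp add: n_def f_def[abs_def] comp_def bij_betw_def)
  then have bij: "bij_betw f (reach c) {1..n}"
    by (metis atLeastLessThanSuc_atLeastAtMost image_Suc_atLeastLessThan One_nat_def)
  have gf: "g (f d) = d" if "d \<in> reach c" for d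
    using that bij unfolding g_def bij_betw_def by simp
  have g_reach: "g q \<in> reach c" if "q \<in> {1..n}" for q
    using that bij unfolding g_def by (metis bij_betw_imp_surj_on inv_into_into)
  have f_range: "f d \<in> {1..n}" if "d \<in> reach c" for d
    using that bij by (rule bij_betwE[rule_format, rotated])
  obtain K where K: "counters c \<subseteq> {..<K}"
    using finite_counters by (metis finite_nat_iff_bounded)
  define tr where "tr q b ws = (if q = 0 then Some (f c, replicate K (1, Stay), False, None)
      else case next_com (g q) b (\<lambda>r. ws ! r = 1) of None \<Rightarrow> None
        | Some (c', m, adv, out) \<Rightarrow>
            Some (f c', map (\<lambda>r. (ws ! r, m r)) [0..<K], adv, out))" for q b and ws :: "nat list"
  define M where
    "M = \<lparr>num_states = Suc n, num_symbols = 2, num_tapes = K, trans = tr\<rparr>"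
  have "q' < num_states M \<and> length acts = num_tapes M \<and> fst ` set acts \<subseteq> {..<num_symbols M}"
    if q: "q < num_states M" and ws: "length ws = num_tapes M" "set ws \<subseteq> {..<num_symbols M}"
      and tr: "trans M q b ws = Some (q', acts, adv, out)" for q b ws q' acts adv out
  proof (cases "q = 0")
    case True
    then show ?thesis
      using tr f_range[OF reach_self] by (auto simp: M_def tr_def)
  next
    case False
    then obtain c' m where c': "next_com (g q) b (\<lambda>r. ws ! r = 1) = Some (c', m, adv, out)"
        "q' = f c'" "acts = map (\<lambda>r. (ws ! r, m r)) [0..<K]"
      using tr by (auto simp: M_def tr_def split: option.splits)
    have "c' \<in> reach c"
      using reach_next[OF g_reach c'(1)] q False by (auto simp: M_def)
    moreover have "ws ! r < 2" if "r < K" for r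
      using ws that nth_mem[of r ws] by (auto simp: M_def subset_iff)
    moreover have "f c' < Suc n"
      using f_range[OF \<open>c' \<in> reach c\<close>] by simp
    ultimately show ?thesis
      using c' by (auto simp: M_def)
  qed
  then have M: "type2_machine M"
    unfolding type2_machine_def by (simp add: M_def)
  define conf where "conf d s = (case s of (\<sigma>, i, os) \<Rightarrow>
      \<lparr>state = f d, in_pos = i, work = map (\<lambda>r. counter_tape (\<sigma> r)) [0..<K], written = os\<rparr>)"
    for d and s :: store
  have sim: "step M p (conf d s) = conf d' s' \<and> d' \<in> reach c"
    if "com_step p (d, s) (d', s')" "d \<in> reach c" for p d s d' s'
    using that(1)
  proof cases
    case (1 i \<sigma> m adv out os)
    let ?ws = "map scanned (map (\<lambda>r. counter_tape (\<sigma> r)) [0..<K])"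
    have dK: "counters d \<subseteq> {..<K}"
      using counters_reach[OF that(2)] K by blast
    have nxt: "next_com d (p i) (\<lambda>r. ?ws ! r = 1) = Some (d', m, adv, out)"
      using 1(3) next_com_cong[OF dK, of "\<lambda>r. ?ws ! r = 1" "\<lambda>r. \<sigma> r = 0"]
      by (auto simp: counter_tape_def)
    \<comment> \<open>The scanned symbol is written back, so only the head moves and the marker
      survives.\<close>
    have "act (scanned (counter_tape (\<sigma> r)), m r) (counter_tape (\<sigma> r))
        = counter_tape (nat (int (\<sigma> r) + move_offset (m r)))" if "r < K" for r
      using next_com_Move_Left[OF 1(3), of r] by (cases "m r") (auto simp: counter_tape_def)
    then have "map2 act (map (\<lambda>r. (?ws ! r, m r)) [0..<K])
          (map (\<lambda>r. counter_tape (\<sigma> r)) [0..<K])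
        = map (\<lambda>r. counter_tape (nat (int (\<sigma> r) + move_offset (m r)))) [0..<K]"
      by (intro nth_equalityI) auto
    moreover have "f d \<noteq> 0"
      by (simp add: f_def)
    ultimately show ?thesis
      using nxt gf[OF that(2)] reach_next[OF that(2) nxt]
      by (auto simp: step_def conf_def 1 M_def tr_def)
  qed
  have sims: "\<exists>t. run M p t = conf d s \<and> d \<in> reach c"
    if "com_steps p (c, \<lambda>_. 0, 0, []) (d, s)" for p d s
    using that
  proof (induction rule: rtranclp_induct2)
    case refl
    have "map2 act (replicate K (1, Stay)) (replicate K (0, \<lambda>_. 0))
        = map (\<lambda>r. counter_tape 0) [0..<K]"
      by (intro nth_equalityI) (auto simp: counter_tape_def)
    then have "run M p 1 = conf c (\<lambda>_. 0, 0, [])"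
      by (simp add: run_def step_def initial_config_def M_def tr_def conf_def)
    then show ?case
      using reach_self by blast
  next
    case (step d s d' s')
    then obtain t where "run M p t = conf d s" "d \<in> reach c" by blast
    then have "run M p (Suc t) = conf d' s'" "d' \<in> reach c"
      using sim[OF step.hyps(2)] by (auto simp: run_def)
    then show ?case by blast
  qed
  have out: "outputs M p (G p)" for p
    unfolding outputs_def
  proof
    fix i
    obtain c' \<sigma> j where "com_steps p (c, \<lambda>_. 0, 0, []) (c', \<sigma>, j, map (G p) [0..<Suc i])"
      using assms by blast
    then obtain t where "run M p t = conf c' (\<sigma>, j, map (G p) [0..<Suc i])"
      using sims by blast
    then have "written (run M p t) = map (G p) [0..<Suc i]"
      by (simp add: conf_def)
    then show "\<exists>t. i < length (written (run M p t)) \<and> written (run M p t) ! i = G p i"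
      by (intro exI[of _ t]) (simp del: upt_Suc)
  qed
  show ?thesis
    unfolding computable_fun_def
    using M out outputs_unique by (metis option.inject)
qed

section \<open>Primitive recursive functions on coded pairs, compiled to counter programs\<close>

abbreviation pair :: "nat \<Rightarrow> nat \<Rightarrow> nat" where
  "pair a b \<equiv> prod_encode (a, b)"

abbreviation pfst :: "nat \<Rightarrow> nat" where
  "pfst z \<equiv> fst (prod_decode z)"

abbreviation psnd :: "nat \<Rightarrow> nat" where
  "psnd z \<equiv> snd (prod_decode z)"

text \<open>Plain iteration instead of recursion keeps the compilation short; recursion with index
  and parameters is recovered in \<open>pr_rec\<close>.\<close>

inductive primrec_fun :: "(nat \<Rightarrow> nat) \<Rightarrow> bool" where
  pr_Suc0: "primrec_fun Suc"
| pr_zero0: "primrec_fun (\<lambda>_. 0)"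
| pr_fst0: "primrec_fun (\<lambda>z. pfst z)"
| pr_snd0: "primrec_fun (\<lambda>z. psnd z)"
| pr_comp: "primrec_fun f \<Longrightarrow> primrec_fun g \<Longrightarrow> primrec_fun (\<lambda>z. f (g z))"
| pr_pair0: "primrec_fun f \<Longrightarrow> primrec_fun g \<Longrightarrow> primrec_fun (\<lambda>z. pair (f z) (g z))"
| pr_iter0: "primrec_fun f \<Longrightarrow> primrec_fun (\<lambda>z. (f ^^ pfst z) (psnd z))"

text \<open>The successor step along the antidiagonals of the pairing function, which is one round
  of \<open>unpair_com\<close>.\<close>

lemma prod_decode_Suc:
  "prod_decode (Suc n) =
     (case prod_decode n of (a, b) \<Rightarrow> if b = 0 then (0, Suc a) else (Suc a, b - 1))"
proof -
  obtain a b where ab: "prod_decode n = (a, b)" by (cases "prod_decode n")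
  have "Suc (prod_encode (a, b)) =
      prod_encode (if b = 0 then (0, Suc a) else (Suc a, b - 1))"
    by (cases b) (auto simp: prod_encode_def)
  then have "Suc n = prod_encode (if b = 0 then (0, Suc a) else (Suc a, b - 1))"
    by (metis ab prod_decode_inverse)
  then show ?thesis
    by (simp add: ab)
qed

definition move_com :: "nat \<Rightarrow> nat \<Rightarrow> com" where
  "move_com a b = While a (Seq (Dec a) (Inc b))"

lemma exec_move:
  assumes "a \<noteq> b"
  shows "exec p (move_com a b) (\<sigma>, i, os) (\<sigma>(a := 0, b := \<sigma> b + \<sigma> a), i, os)"
proof -
  define s where "s j = (\<sigma>(a := \<sigma> a - j, b := \<sigma> b + j), i, os)" for j
  have "exec p (While a (Seq (Dec a) (Inc b))) (s 0) (s (\<sigma> a))"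
  proof (rule exec_While_iterate)
    fix j assume "j < \<sigma> a"
    let ?\<tau> = "(fst (s j))(a := fst (s j) a - 1)"
    have 1: "exec p (Dec a) (s j) (?\<tau>, i, os)"
      using exec_Dec[of p a "fst (s j)" i os] by (simp add: s_def)
    have "s (Suc j) = (?\<tau>(b := Suc (?\<tau> b)), i, os)"
      using assms by (auto simp: s_def fun_eq_iff)
    then have "exec p (Seq (Dec a) (Inc b)) (s j) (s (Suc j))"
      using exec_Seq[OF 1 exec_Inc[of p b ?\<tau> i os]] by simp
    then show "fst (s j) a \<noteq> 0 \<and> exec p (Seq (Dec a) (Inc b)) (s j) (s (Suc j))"
      using \<open>j < \<sigma> a\<close> assms by (simp add: s_def)
  qed (use assms in \<open>simp add: s_def\<close>)
  moreover have "s 0 = (\<sigma>, i, os)"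
    by (auto simp: s_def)
  ultimately show ?thesis
    by (simp add: s_def move_com_def)
qed

definition dup_com :: "nat \<Rightarrow> nat \<Rightarrow> nat \<Rightarrow> com" where
  "dup_com a b c = While a (Seq (Dec a) (Seq (Inc b) (Inc c)))"

lemma exec_dup:
  assumes "a \<noteq> b" "a \<noteq> c" "b \<noteq> c"
  shows "exec p (dup_com a b c) (\<sigma>, i, os)
           (\<sigma>(a := 0, b := \<sigma> b + \<sigma> a, c := \<sigma> c + \<sigma> a), i, os)"
proof -
  define s where "s j = (\<sigma>(a := \<sigma> a - j, b := \<sigma> b + j, c := \<sigma> c + j), i, os)" for j
  have "exec p (While a (Seq (Dec a) (Seq (Inc b) (Inc c)))) (s 0) (s (\<sigma> a))"
  proof (rule exec_While_iterate)
    fix j assume "j < \<sigma> a"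
    let ?\<tau> = "(fst (s j))(a := fst (s j) a - 1)"
    let ?\<tau>' = "?\<tau>(b := Suc (?\<tau> b))"
    have 1: "exec p (Dec a) (s j) (?\<tau>, i, os)"
      using exec_Dec[of p a "fst (s j)" i os] by (simp add: s_def)
    have 2: "exec p (Inc b) (?\<tau>, i, os) (?\<tau>', i, os)"
      by (rule exec_Inc)
    have "s (Suc j) = (?\<tau>'(c := Suc (?\<tau>' c)), i, os)"
      using assms by (auto simp: s_def fun_eq_iff)
    then have "exec p (Seq (Dec a) (Seq (Inc b) (Inc c))) (s j) (s (Suc j))"
      using exec_Seq[OF 1 exec_Seq[OF 2 exec_Inc[of p c ?\<tau>' i os]]] by simp
    then show "fst (s j) a \<noteq> 0 \<and> exec p (Seq (Dec a) (Seq (Inc b) (Inc c))) (s j) (s (Suc j))"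
      using \<open>j < \<sigma> a\<close> assms by (simp add: s_def)
  qed (use assms in \<open>simp add: s_def\<close>)
  moreover have "s 0 = (\<sigma>, i, os)"
    by (auto simp: s_def)
  ultimately show ?thesis
    by (simp add: s_def dup_com_def)
qed

definition clear_com :: "nat \<Rightarrow> com" where
  "clear_com a = While a (Dec a)"

lemma exec_clear: "exec p (clear_com a) (\<sigma>, i, os) (\<sigma>(a := 0), i, os)"
proof -
  define s where "s j = (\<sigma>(a := \<sigma> a - j), i, os)" for j
  have "exec p (While a (Dec a)) (s 0) (s (\<sigma> a))"
  proof (rule exec_While_iterate)
    fix j assume "j < \<sigma> a"
    then show "fst (s j) a \<noteq> 0 \<and> exec p (Dec a) (s j) (s (Suc j))"
      using exec_Dec[of p a "\<sigma>(a := \<sigma> a - j)" i os] by (simp add: s_def)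
  qed (simp add: s_def)
  then show ?thesis
    by (simp add: s_def clear_com_def)
qed

text \<open>Counter \<open>k\<close> is counted down while the pair in \<open>k + 1\<close>, \<open>k + 2\<close> runs through the decodings of \<open>0, 1, \<dots>\<close>\<close>

definition unpair_com :: "nat \<Rightarrow> com" where
  "unpair_com k = While k (Seq (Dec k)
     (If (k + 2) (Seq (Dec (k + 2)) (Inc (k + 1)))
        (Seq (move_com (k + 1) (k + 2)) (Inc (k + 2)))))"

lemma exec_unpair:
  assumes "\<sigma> (k + 1) = 0" "\<sigma> (k + 2) = 0"
  shows "exec p (unpair_com k) (\<sigma>, i, os)
           (\<sigma>(k := 0, k + 1 := pfst (\<sigma> k), k + 2 := psnd (\<sigma> k)), i, os)"
proof -
  define s where
    "s j = (\<sigma>(k := \<sigma> k - j, k + 1 := pfst j, k + 2 := psnd j), i, os)" for j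
  have "exec p (unpair_com k) (s 0) (s (\<sigma> k))"
    unfolding unpair_com_def
  proof (rule exec_While_iterate)
    fix j assume j: "j < \<sigma> k"
    define \<tau> where "\<tau> = (fst (s j))(k := \<sigma> k - Suc j)"
    have dec: "exec p (Dec k) (s j) (\<tau>, i, os)"
      using exec_Dec[of p k "fst (s j)" i os] by (simp add: s_def \<tau>_def)
    have "exec p (If (k + 2) (Seq (Dec (k + 2)) (Inc (k + 1)))
        (Seq (move_com (k + 1) (k + 2)) (Inc (k + 2)))) (\<tau>, i, os) (s (Suc j))"
    proof (rule exec_If, cases "psnd j = 0")
      case True
      then have "s (Suc j) = (\<tau>(k + 1 := 0, k + 2 := Suc (pfst j)), i, os)"
        by (auto simp: s_def \<tau>_def prod_decode_Suc split: prod.splits)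
      then show "exec p (if fst (\<tau>, i, os) (k + 2) = 0 then Seq (move_com (k + 1) (k + 2)) (Inc (k + 2)) else Seq (Dec (k + 2)) (Inc (k + 1))) (\<tau>, i, os) (s (Suc j))"
        using exec_Seq[OF exec_move[of "k + 1" "k + 2" p \<tau> i os] exec_Inc[of p "k + 2"]] True
        by (simp add: s_def \<tau>_def)
    next
      case False
      then have "s (Suc j) = (\<tau>(k + 2 := psnd j - 1, k + 1 := Suc (pfst j)), i, os)"
        by (auto simp: s_def \<tau>_def prod_decode_Suc fun_upd_twist split: prod.splits)
      then show "exec p (if fst (\<tau>, i, os) (k + 2) = 0 then Seq (move_com (k + 1) (k + 2)) (Inc (k + 2)) else Seq (Dec (k + 2)) (Inc (k + 1))) (\<tau>, i, os) (s (Suc j))"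
        using exec_Seq[OF exec_Dec[of p "k + 2" \<tau> i os] exec_Inc[of p "k + 1"]] False
        by (simp add: s_def \<tau>_def)
    qed
    with dec show "fst (s j) k \<noteq> 0 \<and> exec p (Seq (Dec k) (If (k + 2)
        (Seq (Dec (k + 2)) (Inc (k + 1))) (Seq (move_com (k + 1) (k + 2)) (Inc (k + 2)))))
        (s j) (s (Suc j))"
      using j exec_Seq by (auto simp: s_def)
  qed (simp add: s_def)
  moreover have "s 0 = (\<sigma>, i, os)"
    using assms by (auto simp: s_def prod_decode_def prod_decode_aux.simps)
  ultimately show ?thesis
    by (simp add: s_def)
qed

text \<open>
  Computes \<open>triangle (a + b) + a\<close> from the counters \<open>k + 1\<close> and \<open>k + 2\<close> by adding
  \<open>a + b, \<dots>, 1\<close> to \<open>a\<close>.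
\<close>

definition pair_com :: "nat \<Rightarrow> com" where
  "pair_com k = Seq (dup_com (k + 1) k (k + 2))
     (While (k + 2) (Seq (dup_com (k + 2) k (k + 1)) (Seq (Dec (k + 1)) (move_com (k + 1) (k + 2)))))"

lemma exec_pair:
  assumes "\<sigma> k = 0"
  shows "exec p (pair_com k) (\<sigma>, i, os)
           (\<sigma>(k := pair (\<sigma> (k + 1)) (\<sigma> (k + 2)), k + 1 := 0, k + 2 := 0), i, os)"
proof -
  let ?a = "\<sigma> (k + 1)"
  define n where "n = \<sigma> (k + 1) + \<sigma> (k + 2)"
  \<comment> \<open>After \<open>j\<close> rounds the \<open>j\<close> largest of the summands
    \<open>n, n - 1, ..., 1\<close> have been added, which is a difference of triangle
    numbers.\<close>
  define s where "s j = (\<sigma>(k := ?a + (triangle n - triangle (n - j)), k + 1 := 0, k + 2 := n - j), i, os)"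
    for j
  have first: "exec p (dup_com (k + 1) k (k + 2)) (\<sigma>, i, os) (s 0)"
  proof -
    have "s 0 = (\<sigma>(k + 1 := 0, k := \<sigma> k + ?a, k + 2 := \<sigma> (k + 2) + ?a), i, os)"
      using assms by (auto simp: s_def n_def)
    then show ?thesis
      using exec_dup[of "k + 1" k "k + 2" p \<sigma> i os] by simp
  qed
  have "exec p (While (k + 2) (Seq (dup_com (k + 2) k (k + 1)) (Seq (Dec (k + 1)) (move_com (k + 1) (k + 2)))))
      (s 0) (s n)"
  proof (rule exec_While_iterate)
    fix j assume j: "j < n"
    define m where "m = n - Suc j"
    have m: "n - j = Suc m" "n - Suc j = m" using j by (auto simp: m_def)
    have le: "Suc m \<le> n" using j by (auto simp: m_def)
    have "triangle m \<le> triangle n"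
      unfolding triangle_def using le by (intro div_le_mono mult_le_mono) auto
    moreover have "triangle (Suc m) \<le> triangle n"
      unfolding triangle_def using le by (intro div_le_mono mult_le_mono) auto
    ultimately have tri: "triangle n - triangle m = triangle n - triangle (Suc m) + Suc m"
      by simp
    let ?\<tau> = "fst (s j)"
    let ?\<tau>1 = "?\<tau>(k + 2 := 0, k := ?\<tau> k + Suc m, k + 1 := Suc m)"
    let ?\<tau>2 = "?\<tau>1(k + 1 := m)"
    have 1: "exec p (dup_com (k + 2) k (k + 1)) (s j) (?\<tau>1, i, os)"
      using exec_dup[of "k + 2" k "k + 1" p ?\<tau> i os] by (simp add: s_def m)
    have 2: "exec p (Dec (k + 1)) (?\<tau>1, i, os) (?\<tau>2, i, os)"
      using exec_Dec[of p "k + 1" ?\<tau>1 i os] by simp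
    have 3: "exec p (move_com (k + 1) (k + 2)) (?\<tau>2, i, os) (?\<tau>2(k + 1 := 0, k + 2 := m), i, os)"
      using exec_move[of "k + 1" "k + 2" p ?\<tau>2 i os] by simp
    have "(?\<tau>2(k + 1 := 0, k + 2 := m), i, os) = s (Suc j)"
      using tri by (auto simp: s_def m fun_eq_iff)
    then show "fst (s j) (k + 2) \<noteq> 0 \<and>
        exec p (Seq (dup_com (k + 2) k (k + 1)) (Seq (Dec (k + 1)) (move_com (k + 1) (k + 2)))) (s j) (s (Suc j))"
      using exec_Seq[OF 1 exec_Seq[OF 2 3]] j by (simp add: s_def)
  qed (simp add: s_def)
  then show ?thesis
    using exec_Seq[OF first] by (simp add: s_def pair_com_def prod_encode_def n_def add.commute)
qed

text \<open>The counters above \<open>k\<close> are scratch space, zero before and again afterwards,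
  and those below \<open>k\<close> are untouched. This is what lets programs be nested by raising
  \<open>k\<close>.\<close>

definition computes :: "nat \<Rightarrow> com \<Rightarrow> (nat \<Rightarrow> nat) \<Rightarrow> bool" where
  "computes k c f \<longleftrightarrow>
     (\<forall>p \<sigma> i os. (\<forall>r>k. \<sigma> r = 0) \<longrightarrow> exec p c (\<sigma>, i, os) (\<sigma>(k := f (\<sigma> k)), i, os))"

lemma computesD:
  "computes k c f \<Longrightarrow> (\<And>r. r > k \<Longrightarrow> \<sigma> r = 0) \<Longrightarrow> exec p c (\<sigma>, i, os) (\<sigma>(k := f (\<sigma> k)), i, os)"
  by (simp add: computes_def)

lemma computes_pair:
  assumes "computes (k + 1) c f" "computes (k + 2) d g"
  shows "\<exists>e. computes k e (\<lambda>z. pair (f z) (g z))"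
proof
  \<comment> \<open>While \<open>c\<close> works on counter \<open>k + 1\<close>, all higher
    counters must be zero. The second copy of the argument is therefore parked in counter
    \<open>k\<close> and moved to \<open>k + 2\<close> only for \<open>d\<close>.\<close>
  let ?e = "Seq (Seq (Seq (dup_com k (k + 1) (k + 2)) (move_com (k + 2) k))
    (Seq c (Seq (move_com k (k + 2)) d))) (pair_com k)"
  show "computes k ?e (\<lambda>z. pair (f z) (g z))"
    unfolding computes_def
  proof (intro allI impI)
    fix p and \<sigma> :: "nat \<Rightarrow> nat" and i :: nat and os :: "bool list" assume 0: "\<forall>r>k. \<sigma> r = 0"
    let ?x = "\<sigma> k"
    let ?\<sigma>1 = "\<sigma>(k := 0, k + 1 := ?x, k + 2 := ?x)"
    let ?\<sigma>2 = "\<sigma>(k + 1 := ?x)"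
    let ?\<sigma>3 = "\<sigma>(k + 1 := f ?x)"
    let ?\<sigma>4 = "\<sigma>(k := 0, k + 1 := f ?x, k + 2 := ?x)"
    let ?\<sigma>5 = "\<sigma>(k := 0, k + 1 := f ?x, k + 2 := g ?x)"
    have 1: "exec p (dup_com k (k + 1) (k + 2)) (\<sigma>, i, os) (?\<sigma>1, i, os)"
      using exec_dup[of k "k + 1" "k + 2" p \<sigma> i os] 0 by simp
    have eq2: "?\<sigma>1(k + 2 := 0, k := ?x) = ?\<sigma>2"
      using 0 by (auto simp: fun_eq_iff)
    have 2: "exec p (move_com (k + 2) k) (?\<sigma>1, i, os) (?\<sigma>2, i, os)"
      unfolding eq2[symmetric] using exec_move[of "k + 2" k p ?\<sigma>1 i os] by simp
    have 3: "exec p c (?\<sigma>2, i, os) (?\<sigma>3, i, os)"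
      using computesD[OF assms(1), of ?\<sigma>2 p i os] 0 by simp
    have eq4: "?\<sigma>3(k := 0, k + 2 := ?x) = ?\<sigma>4"
      using 0 by (auto simp: fun_eq_iff)
    have 4: "exec p (move_com k (k + 2)) (?\<sigma>3, i, os) (?\<sigma>4, i, os)"
      unfolding eq4[symmetric] using exec_move[of k "k + 2" p ?\<sigma>3 i os] 0 by simp
    have 5: "exec p d (?\<sigma>4, i, os) (?\<sigma>5, i, os)"
      using computesD[OF assms(2), of ?\<sigma>4 p i os] 0 by simp
    have eq6: "?\<sigma>5(k := pair (f ?x) (g ?x), k + 1 := 0, k + 2 := 0) = \<sigma>(k := pair (f ?x) (g ?x))"
      using 0 by (auto simp: fun_eq_iff)
    have 6: "exec p (pair_com k) (?\<sigma>5, i, os) (\<sigma>(k := pair (f ?x) (g ?x)), i, os)"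
      unfolding eq6[symmetric] using exec_pair[of ?\<sigma>5 k p i os] by simp
    show "exec p ?e (\<sigma>, i, os) (\<sigma>(k := pair (f ?x) (g ?x)), i, os)"
      by (rule exec_Seq[OF exec_Seq[OF exec_Seq[OF 1 2] exec_Seq[OF 3 exec_Seq[OF 4 5]]] 6])
  qed
qed

lemma computes_iter:
  assumes "computes (k + 2) c f"
  shows "\<exists>e. computes k e (\<lambda>z. (f ^^ pfst z) (psnd z))"
proof
  let ?e = "Seq (unpair_com k) (Seq (While (k + 1) (Seq (Dec (k + 1)) c)) (move_com (k + 2) k))"
  show "computes k ?e (\<lambda>z. (f ^^ pfst z) (psnd z))"
    unfolding computes_def
  proof (intro allI impI)
    fix p and \<sigma> :: "nat \<Rightarrow> nat" and i :: nat and os :: "bool list" assume 0: "\<forall>r>k. \<sigma> r = 0"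
    let ?n = "pfst (\<sigma> k)" and ?y = "psnd (\<sigma> k)"
    define s where "s j = (\<sigma>(k := 0, k + 1 := ?n - j, k + 2 := (f ^^ j) ?y), i, os)" for j
    have 1: "exec p (unpair_com k) (\<sigma>, i, os) (s 0)"
      using exec_unpair[of \<sigma> k p i os] 0 by (simp add: s_def)
    have 2: "exec p (While (k + 1) (Seq (Dec (k + 1)) c)) (s 0) (s ?n)"
    proof (rule exec_While_iterate)
      fix j assume j: "j < ?n"
      let ?\<tau> = "\<sigma>(k := 0, k + 1 := ?n - Suc j, k + 2 := (f ^^ j) ?y)"
      have "exec p (Dec (k + 1)) (s j) (?\<tau>, i, os)"
        using exec_Dec[of p "k + 1" "fst (s j)" i os] by (simp add: s_def fun_upd_twist)
      moreover have "exec p c (?\<tau>, i, os) (s (Suc j))"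
        using computesD[OF assms, of ?\<tau> p i os] 0 by (simp add: s_def)
      ultimately show "fst (s j) (k + 1) \<noteq> 0 \<and> exec p (Seq (Dec (k + 1)) c) (s j) (s (Suc j))"
        using j exec_Seq by (auto simp: s_def)
    qed (simp add: s_def)
    have eq3: "(fst (s ?n))(k + 2 := 0, k := (f ^^ ?n) ?y) = \<sigma>(k := (f ^^ ?n) ?y)"
      using 0 by (auto simp: s_def fun_eq_iff)
    have 3: "exec p (move_com (k + 2) k) (s ?n) (\<sigma>(k := (f ^^ ?n) ?y), i, os)"
      unfolding eq3[symmetric] using exec_move[of "k + 2" k p "fst (s ?n)" i os] by (simp add: s_def)
    show "exec p ?e (\<sigma>, i, os) (\<sigma>(k := (f ^^ ?n) ?y), i, os)"
      by (rule exec_Seq[OF 1 exec_Seq[OF 2 3]])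
  qed
qed

lemma primrec_fun_computes:
  assumes "primrec_fun f"
  shows "\<exists>c. computes k c f"
  using assms
proof (induction arbitrary: k)
  case pr_Suc0
  have "computes k (Inc k) Suc"
    by (simp add: computes_def exec_Inc)
  then show ?case by blast
next
  case pr_zero0
  have "computes k (clear_com k) (\<lambda>_. 0)"
    by (simp add: computes_def exec_clear)
  then show ?case by blast
next
  case pr_fst0
  let ?c = "Seq (unpair_com k) (Seq (move_com (k + 1) k) (clear_com (k + 2)))"
  have "computes k ?c pfst"
    unfolding computes_def
  proof (intro allI impI)
    fix p and \<sigma> :: "nat \<Rightarrow> nat" and i :: nat and os :: "bool list" assume 0: "\<forall>r>k. \<sigma> r = 0"
    let ?\<tau> = "\<sigma>(k := 0, k + 1 := pfst (\<sigma> k), k + 2 := psnd (\<sigma> k))"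
    have "exec p ?c (\<sigma>, i, os) (?\<tau>(k + 1 := 0, k := pfst (\<sigma> k), k + 2 := 0), i, os)"
      using exec_Seq[OF exec_unpair[of \<sigma> k p i os]
          exec_Seq[OF exec_move[of "k + 1" k p ?\<tau> i os] exec_clear[of p "k + 2"]]] 0 by simp
    moreover have "?\<tau>(k + 1 := 0, k := pfst (\<sigma> k), k + 2 := 0) = \<sigma>(k := pfst (\<sigma> k))"
      using 0 by (auto simp: fun_eq_iff)
    ultimately show "exec p ?c (\<sigma>, i, os) (\<sigma>(k := pfst (\<sigma> k)), i, os)"
      by metis
  qed
  then show ?case by blast
next
  case pr_snd0
  let ?c = "Seq (unpair_com k) (Seq (move_com (k + 2) k) (clear_com (k + 1)))"
  have "computes k ?c psnd"
    unfolding computes_def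
  proof (intro allI impI)
    fix p and \<sigma> :: "nat \<Rightarrow> nat" and i :: nat and os :: "bool list" assume 0: "\<forall>r>k. \<sigma> r = 0"
    let ?\<tau> = "\<sigma>(k := 0, k + 1 := pfst (\<sigma> k), k + 2 := psnd (\<sigma> k))"
    have "exec p ?c (\<sigma>, i, os) (?\<tau>(k + 2 := 0, k := psnd (\<sigma> k), k + 1 := 0), i, os)"
      using exec_Seq[OF exec_unpair[of \<sigma> k p i os]
          exec_Seq[OF exec_move[of "k + 2" k p ?\<tau> i os] exec_clear[of p "k + 1"]]] 0 by simp
    moreover have "?\<tau>(k + 2 := 0, k := psnd (\<sigma> k), k + 1 := 0) = \<sigma>(k := psnd (\<sigma> k))"
      using 0 by (auto simp: fun_eq_iff)
    ultimately show "exec p ?c (\<sigma>, i, os) (\<sigma>(k := psnd (\<sigma> k)), i, os)"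
      by metis
  qed
  then show ?case by blast
next
  case (pr_comp f g)
  then obtain c d where cd: "computes k c f" "computes k d g" by blast
  have "computes k (Seq d c) (\<lambda>z. f (g z))"
    unfolding computes_def
  proof (intro allI impI)
    fix p and \<sigma> :: "nat \<Rightarrow> nat" and i :: nat and os :: "bool list" assume 0: "\<forall>r>k. \<sigma> r = 0"
    show "exec p (Seq d c) (\<sigma>, i, os) (\<sigma>(k := f (g (\<sigma> k))), i, os)"
      using exec_Seq[OF computesD[OF cd(2), of \<sigma> p i os] computesD[OF cd(1), of "\<sigma>(k := g (\<sigma> k))" p i os]] 0
      by simp
  qed
  then show ?case by blast
next
  case (pr_pair0 f g)
  then show ?case using computes_pair by blast
next
  case (pr_iter0 f)
  then show ?case using computes_iter by blast
qed

primrec state_at :: "(nat \<Rightarrow> nat) \<Rightarrow> nat \<Rightarrow> name \<Rightarrow> nat \<Rightarrow> nat" where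
  "state_at u x p 0 = x"
| "state_at u x p (Suc n) = u (pair (of_bool (p n)) (state_at u x p n))"

text \<open>Each round consumes one input bit and writes one output bit, and it always terminates.
  Hence the computed function is total, defined also on inputs that name nothing.\<close>

theorem computable_fun_primrec:
  assumes "primrec_fun u"
  shows "computable_fun (\<lambda>p. Some (\<lambda>n. pfst (state_at u x p (Suc n)) \<noteq> 0))"
proof -
  obtain c where c: "computes 1 c u" using primrec_fun_computes[OF assms] by blast
  obtain d where d: "computes 4 d pfst" using primrec_fun_computes[OF pr_fst0] by blast
  have "\<exists>e. \<forall>p \<sigma> i os. exec p e (\<sigma>, i, os) (\<sigma>(3 := \<sigma> 3 + x), i, os)"
  proof (induction x)
    case 0
    then show ?case using exec_Skip by auto
  next
    case (Suc x)
    then obtain e where "\<And>p \<sigma> i os. exec p e (\<sigma>, i, os) (\<sigma>(3 := \<sigma> 3 + x), i, os)" by blast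
    then have "exec p (Seq e (Inc 3)) (\<sigma>, i, os) (\<sigma>(3 := \<sigma> 3 + Suc x), i, os)" for p \<sigma> i os
      using exec_Seq[OF _ exec_Inc, of p e "(\<sigma>, i, os)" "\<sigma>(3 := \<sigma> 3 + x)" i os 3] by simp
    then show ?case by blast
  qed
  then obtain e where e: "\<And>p \<sigma> i os. exec p e (\<sigma>, i, os) (\<sigma>(3 := \<sigma> 3 + x), i, os)" by blast
  \<comment> \<open>Counter 0 keeps the value 1 and drives the endless loop. The bit goes to counter
    2 and the state is kept in counter 3, where \<open>pair_com 1\<close> expects its
    arguments.\<close>
  let ?body = "Seq (Read 2) (Seq (pair_com 1) (Seq c (Seq (dup_com 1 3 4)
    (Seq d (Seq (Write 4) (clear_com 4))))))"
  define st :: "name \<Rightarrow> nat \<Rightarrow> store" where "st p n = ((\<lambda>_. 0)(0 := 1, 3 := state_at u x p n), n,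
      map (\<lambda>n. pfst (state_at u x p (Suc n)) \<noteq> 0) [0..<n])" for p n
  have body: "exec p ?body (st p n) (st p (Suc n))" for p n
  proof -
    let ?x = "state_at u x p n" and ?x' = "state_at u x p (Suc n)" and ?b = "of_bool (p n) :: nat"
    let ?os = "map (\<lambda>n. pfst (state_at u x p (Suc n)) \<noteq> 0) [0..<n]"
    let ?\<sigma> = "\<lambda>a b c d. (\<lambda>_ :: nat. 0 :: nat)(0 := 1, 1 := a, 2 := b, 3 := c, 4 := d)"
    have upd: "(?\<sigma> a b c d)(2 := b') = ?\<sigma> a b' c d" "(?\<sigma> a b c d)(1 := a') = ?\<sigma> a' b c d"
      "(?\<sigma> a b c d)(3 := c') = ?\<sigma> a b c' d" "(?\<sigma> a b c d)(4 := d') = ?\<sigma> a b c d'"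
      for a b c d a' b' c' d' :: nat
      by (auto simp: fun_eq_iff)
    have 0: "st p n = (?\<sigma> 0 0 ?x 0, n, ?os)"
      by (auto simp: st_def fun_eq_iff)
    have 1: "exec p (Read 2) (?\<sigma> 0 0 ?x 0, n, ?os) (?\<sigma> 0 ?b ?x 0, Suc n, ?os)"
      using exec_Read[of p 2 "?\<sigma> 0 0 ?x 0" n ?os] unfolding upd by simp
    have 2: "exec p (pair_com 1) (?\<sigma> 0 ?b ?x 0, Suc n, ?os) (?\<sigma> (pair ?b ?x) 0 0 0, Suc n, ?os)"
      using exec_pair[of "?\<sigma> 0 ?b ?x 0" 1 p "Suc n" ?os]
      by (simp add: numeral_2_eq_2[symmetric] numeral_3_eq_3[symmetric] upd[simplified])
    have 3: "exec p c (?\<sigma> (pair ?b ?x) 0 0 0, Suc n, ?os) (?\<sigma> ?x' 0 0 0, Suc n, ?os)"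
      using computesD[OF c, of "?\<sigma> (pair ?b ?x) 0 0 0" p "Suc n" ?os] unfolding upd by simp
    have 4: "exec p (dup_com 1 3 4) (?\<sigma> ?x' 0 0 0, Suc n, ?os) (?\<sigma> 0 0 ?x' ?x', Suc n, ?os)"
      using exec_dup[of 1 3 4 p "?\<sigma> ?x' 0 0 0" "Suc n" ?os] unfolding upd by simp
    have 5: "exec p d (?\<sigma> 0 0 ?x' ?x', Suc n, ?os) (?\<sigma> 0 0 ?x' (pfst ?x'), Suc n, ?os)"
      using computesD[OF d, of "?\<sigma> 0 0 ?x' ?x'" p "Suc n" ?os] unfolding upd by simp
    have 6: "exec p (Write 4) (?\<sigma> 0 0 ?x' (pfst ?x'), Suc n, ?os)
        (?\<sigma> 0 0 ?x' (pfst ?x'), Suc n, ?os @ [pfst ?x' \<noteq> 0])"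
      using exec_Write[of p 4 "?\<sigma> 0 0 ?x' (pfst ?x')" "Suc n" ?os] by simp
    have 7: "exec p (clear_com 4) (?\<sigma> 0 0 ?x' (pfst ?x'), Suc n, ?os @ [pfst ?x' \<noteq> 0]) (st p (Suc n))"
    proof -
      have "st p (Suc n) = (?\<sigma> 0 0 ?x' 0, Suc n, ?os @ [pfst ?x' \<noteq> 0])"
        by (auto simp: st_def fun_eq_iff)
      then show ?thesis
        using exec_clear[of p 4 "?\<sigma> 0 0 ?x' (pfst ?x')" "Suc n" "?os @ [pfst ?x' \<noteq> 0]"] unfolding upd by simp
    qed
    show ?thesis
      unfolding 0 by (rule exec_Seq[OF 1 exec_Seq[OF 2 exec_Seq[OF 3 exec_Seq[OF 4 exec_Seq[OF 5 exec_Seq[OF 6 7]]]]]])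
  qed
  have "com_steps p (Seq (Seq (Inc 0) e) (While 0 ?body), \<lambda>_. 0, 0, []) (While 0 ?body, st p n)" for p n
  proof (induction n)
    case 0
    have "exec p (Seq (Inc 0) e) (\<lambda>_. 0, 0, []) (st p 0)"
      using exec_Seq[OF exec_Inc[of p 0 "\<lambda>_. 0" 0 "[]"] e] by (simp add: st_def)
    then show ?case by (rule exec_Seq_steps)
  next
    case (Suc n)
    then show ?case
      using While_steps[OF _ body, of p n 0] by (auto simp: st_def intro: rtranclp_trans)
  qed
  then have "\<exists>c' \<sigma> i. com_steps p (Seq (Seq (Inc 0) e) (While 0 ?body), \<lambda>_. 0, 0, [])
      (c', \<sigma>, i, map (\<lambda>n. pfst (state_at u x p (Suc n)) \<noteq> 0) [0..<n])" for p n
    unfolding st_def by blast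
  then show ?thesis
    by (rule computable_fun_com)
qed

section \<open>Primitive recursive functions\<close>

named_theorems primrec_intros

lemma pr_id [primrec_intros]: "primrec_fun (\<lambda>x. x)"
  using pr_pair0[OF pr_fst0 pr_snd0] by simp

lemma pr_const [primrec_intros]: "primrec_fun (\<lambda>_. c)"
proof (induction c)
  case 0
  then show ?case by (rule pr_zero0)
next
  case (Suc c)
  then show ?case by (rule pr_comp[OF pr_Suc0])
qed

lemma pr_Suc [primrec_intros]: "primrec_fun f \<Longrightarrow> primrec_fun (\<lambda>x. Suc (f x))"
  by (rule pr_comp[OF pr_Suc0])

lemma pr_fst [primrec_intros]: "primrec_fun f \<Longrightarrow> primrec_fun (\<lambda>x. pfst (f x))"
  by (rule pr_comp[OF pr_fst0])

lemma pr_snd [primrec_intros]: "primrec_fun f \<Longrightarrow> primrec_fun (\<lambda>x. psnd (f x))"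
  by (rule pr_comp[OF pr_snd0])

lemma pr_pair [primrec_intros]:
  "primrec_fun f \<Longrightarrow> primrec_fun g \<Longrightarrow> primrec_fun (\<lambda>x. pair (f x) (g x))"
  by (rule pr_pair0)

lemma pr_rec [primrec_intros]:
  assumes "primrec_fun f" "primrec_fun n"
    and "primrec_fun (\<lambda>z. G (pfst z) (pfst (psnd z)) (psnd (psnd z)))"
  shows "primrec_fun (\<lambda>x. rec_nat (f x) (G x) (n x))"
proof -
  \<comment> \<open>The iterated value carries the parameter and the index along with the
    result.\<close>
  define H where "H z = pair (pfst z) (pair (Suc (pfst (psnd z)))
    (G (pfst z) (pfst (psnd z)) (psnd (psnd z))))" for z
  have "primrec_fun H"
    unfolding H_def[abs_def] by (intro primrec_intros assms)
  from pr_iter0[OF this]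
  have "primrec_fun (\<lambda>x. (\<lambda>z. (H ^^ pfst z) (psnd z)) (pair (n x) (pair x (pair 0 (f x)))))"
    by (rule pr_comp) (intro primrec_intros assms)
  moreover have "(H ^^ k) (pair x (pair 0 a)) = pair x (pair k (rec_nat a (G x) k))" for k x a
    by (induction k) (auto simp: H_def)
  ultimately have "primrec_fun (\<lambda>x. psnd (psnd (pair x (pair (n x) (rec_nat (f x) (G x) (n x))))))"
    by (intro pr_snd) simp
  then show ?thesis by simp
qed

lemma pr_compose2:
  assumes "primrec_fun (\<lambda>z. G (pfst z) (psnd z))" "primrec_fun f" "primrec_fun g"
  shows "primrec_fun (\<lambda>x. G (f x) (g x))"
  using pr_comp[OF assms(1) pr_pair[OF assms(2,3)]] by simp

lemma pr_funpow [primrec_intros]: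
  assumes "primrec_fun (\<lambda>z. G (pfst z) (psnd z))" "primrec_fun n" "primrec_fun f"
  shows "primrec_fun (\<lambda>x. (G x ^^ n x) (f x))"
proof -
  have "(G x ^^ k) a = rec_nat a (\<lambda>_. G x) k" for x k a
    by (induction k) auto
  moreover have "primrec_fun (\<lambda>x. rec_nat (f x) (\<lambda>_. G x) (n x))"
    by (intro pr_rec assms pr_compose2[OF assms(1)] primrec_intros)
  ultimately show ?thesis by simp
qed

lemma pr_add [primrec_intros]:
  assumes "primrec_fun f" "primrec_fun g"
  shows "primrec_fun (\<lambda>x. f x + g x)"
proof -
  have "a + b = rec_nat a (\<lambda>_. Suc) b" for a b :: nat
    by (induction b) auto
  then show ?thesis
    by (simp only:) (intro primrec_intros assms)
qed

lemma pr_mult [primrec_intros]: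
  assumes "primrec_fun f" "primrec_fun g"
  shows "primrec_fun (\<lambda>x. f x * g x)"
proof -
  have "a * b = rec_nat 0 (\<lambda>_ c. c + a) b" for a b :: nat
    by (induction b) auto
  then show ?thesis
    by (simp only:) (intro primrec_intros assms pr_comp[OF assms(1)])
qed

lemma pr_diff [primrec_intros]:
  assumes "primrec_fun f" "primrec_fun g"
  shows "primrec_fun (\<lambda>x. f x - g x)"
proof -
  have pred: "n - 1 = rec_nat 0 (\<lambda>i _. i) n" for n :: nat
    by (cases n) auto
  have "a - b = rec_nat a (\<lambda>_ c. rec_nat 0 (\<lambda>i _. i) c) b" for a b :: nat
    unfolding pred[symmetric] by (induction b) auto
  then show ?thesis
    by (simp only:) (intro primrec_intros assms)
qed

definition primrec_pred :: "(nat \<Rightarrow> bool) \<Rightarrow> bool" where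
  "primrec_pred P \<longleftrightarrow> primrec_fun (\<lambda>x. of_bool (P x))"

lemma pr_of_bool [primrec_intros]: "primrec_pred P \<Longrightarrow> primrec_fun (\<lambda>x. of_bool (P x))"
  by (simp add: primrec_pred_def)

lemma pr_if [primrec_intros]:
  assumes "primrec_pred P" "primrec_fun f" "primrec_fun g"
  shows "primrec_fun (\<lambda>x. if P x then f x else g x)"
proof -
  have "primrec_fun (\<lambda>x. of_bool (P x) * f x + (1 - of_bool (P x)) * g x)"
    by (intro primrec_intros assms)
  also have "(\<lambda>x. of_bool (P x) * f x + (1 - of_bool (P x)) * g x)
      = (\<lambda>x. if P x then f x else g x)"
    by auto
  finally show ?thesis .
qed

lemma pp_const [primrec_intros]: "primrec_pred (\<lambda>_. b)"
  unfolding primrec_pred_def by (rule pr_const)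

lemma pp_le [primrec_intros]:
  assumes "primrec_fun f" "primrec_fun g"
  shows "primrec_pred (\<lambda>x. f x \<le> g x)"
proof -
  have "primrec_fun (\<lambda>x. 1 - (f x - g x))"
    by (intro primrec_intros assms)
  also have "(\<lambda>x. 1 - (f x - g x)) = (\<lambda>x. of_bool (f x \<le> g x))"
    by auto
  finally show ?thesis by (simp add: primrec_pred_def)
qed

lemma pp_not [primrec_intros]:
  assumes "primrec_pred P"
  shows "primrec_pred (\<lambda>x. \<not> P x)"
proof -
  have "primrec_fun (\<lambda>x. 1 - of_bool (P x))"
    by (intro primrec_intros assms)
  also have "(\<lambda>x. 1 - of_bool (P x)) = (\<lambda>x. of_bool (\<not> P x) :: nat)"
    by auto
  finally show ?thesis by (simp add: primrec_pred_def)
qed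

lemma pp_conj [primrec_intros]:
  assumes "primrec_pred P" "primrec_pred Q"
  shows "primrec_pred (\<lambda>x. P x \<and> Q x)"
proof -
  have "primrec_fun (\<lambda>x. of_bool (P x) * of_bool (Q x))"
    by (intro primrec_intros assms)
  then show ?thesis by (simp add: primrec_pred_def of_bool_conj)
qed

lemma pp_disj [primrec_intros]:
  assumes "primrec_pred P" "primrec_pred Q"
  shows "primrec_pred (\<lambda>x. P x \<or> Q x)"
proof -
  have "primrec_pred (\<lambda>x. \<not> (\<not> P x \<and> \<not> Q x))"
    by (intro primrec_intros assms)
  then show ?thesis by simp
qed

lemma pp_imp [primrec_intros]:
  assumes "primrec_pred P" "primrec_pred Q"
  shows "primrec_pred (\<lambda>x. P x \<longrightarrow> Q x)"
proof -
  have "primrec_pred (\<lambda>x. \<not> P x \<or> Q x)"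
    by (intro primrec_intros assms)
  then show ?thesis by (simp only: imp_conv_disj)
qed

lemma pp_less [primrec_intros]:
  assumes "primrec_fun f" "primrec_fun g"
  shows "primrec_pred (\<lambda>x. f x < g x)"
  unfolding not_le[symmetric] by (intro primrec_intros assms)

lemma pp_eq [primrec_intros]:
  assumes "primrec_fun f" "primrec_fun g"
  shows "primrec_pred (\<lambda>x. f x = g x)"
  unfolding order_eq_iff by (intro primrec_intros assms)

lemma pp_bex [primrec_intros]:
  assumes "primrec_fun b" "primrec_pred (\<lambda>z. P (pfst z) (psnd z))"
  shows "primrec_pred (\<lambda>x. \<exists>i<b x. P x i)"
proof -
  have "primrec_fun (\<lambda>z. of_bool (P (pfst z) (psnd z)))"
    by (intro primrec_intros assms)
  from pr_compose2[where G = "\<lambda>x i. of_bool (P x i)", OF this]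
  have P: "primrec_pred (\<lambda>z. P (f z) (g z))" if "primrec_fun f" "primrec_fun g" for f g
    using that by (simp add: primrec_pred_def)
  have "primrec_fun (\<lambda>x. rec_nat 0 (\<lambda>i a. if P x i then 1 else a) (b x))"
    by (intro primrec_intros assms P)
  moreover have "rec_nat 0 (\<lambda>i a. if P x i then 1 else a) k = (of_bool (\<exists>i<k. P x i) :: nat)" for x k
    by (induction k) (auto simp: less_Suc_eq)
  ultimately show ?thesis by (simp add: primrec_pred_def)
qed

lemma pp_ball [primrec_intros]:
  assumes "primrec_fun b" "primrec_pred (\<lambda>z. P (pfst z) (psnd z))"
  shows "primrec_pred (\<lambda>x. \<forall>i<b x. P x i)"
proof -
  have "primrec_pred (\<lambda>x. \<not> (\<exists>i<b x. \<not> P x i))"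
    by (intro primrec_intros assms)
  then show ?thesis by simp
qed

lemma pr_sum [primrec_intros]:
  assumes "primrec_fun b" "primrec_fun (\<lambda>z. G (pfst z) (psnd z))"
  shows "primrec_fun (\<lambda>x. \<Sum>i<b x. G x i)"
proof -
  have "primrec_fun (\<lambda>x. rec_nat 0 (\<lambda>i a. a + G x i) (b x))"
    by (intro primrec_intros assms pr_compose2[OF assms(2)])
  moreover have "rec_nat 0 (\<lambda>i a. a + G x i) k = (\<Sum>i<k. G x i)" for x k
    by (induction k) auto
  ultimately show ?thesis by simp
qed

lemma pr_div2 [primrec_intros]:
  assumes "primrec_fun f"
  shows "primrec_fun (\<lambda>x. f x div 2)"
proof -
  have "(\<Sum>i<n. of_bool (2 * i + 2 \<le> n)) = n div 2" for n :: nat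
  proof -
    have "{..<n} \<inter> {i. 2 * i + 2 \<le> n} = {..<n div 2}"
      by auto
    then show ?thesis unfolding sum_of_bool_eq[OF finite_lessThan] by simp
  qed
  moreover have "primrec_fun (\<lambda>x. \<Sum>i<f x. of_bool (2 * i + 2 \<le> f x))"
    by (intro primrec_intros assms pr_comp[OF assms])
  ultimately show ?thesis by simp
qed

lemma pp_even [primrec_intros]:
  assumes "primrec_fun f"
  shows "primrec_pred (\<lambda>x. even (f x))"
proof -
  have "even n \<longleftrightarrow> 2 * (n div 2) = n" for n :: nat
    by (metis dvd_mult_div_cancel dvd_triv_left)
  then show ?thesis
    by (simp only:) (intro primrec_intros assms pr_comp[OF assms])
qed

section \<open>Coded lists\<close>

text \<open>\<open>list_encode\<close> maps the empty list to 0 and a nonempty one to the successor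
  of a pair. So \<open>psnd (y - 1)\<close> is the tail, and 0 is mapped to 0.\<close>

definition code_nth :: "nat \<Rightarrow> nat \<Rightarrow> nat" where
  "code_nth z i = pfst (((\<lambda>y. psnd (y - 1)) ^^ i) z - 1)"

text \<open>Counts the nonempty tails; the bound \<open>z\<close> suffices because a list is never
  longer than its code.\<close>

definition code_length :: "nat \<Rightarrow> nat" where
  "code_length z = (\<Sum>i<z. of_bool (((\<lambda>y. psnd (y - 1)) ^^ i) z \<noteq> 0))"

lemma pr_code_nth [primrec_intros]:
  assumes "primrec_fun f" "primrec_fun g"
  shows "primrec_fun (\<lambda>x. code_nth (f x) (g x))"
  unfolding code_nth_def by (intro primrec_intros assms)

lemma pr_code_length [primrec_intros]:
  assumes "primrec_fun f"
  shows "primrec_fun (\<lambda>x. code_length (f x))"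
  unfolding code_length_def by (intro primrec_intros assms pr_comp[OF assms])

lemma prod_decode_0: "prod_decode 0 = (0, 0)"
  by (simp add: prod_decode_def prod_decode_aux.simps)

lemma code_drop: "((\<lambda>y. psnd (y - 1)) ^^ i) (list_encode xs) = list_encode (drop i xs)"
proof (induction i arbitrary: xs)
  case (Suc i)
  have "psnd (list_encode xs - 1) = list_encode (drop 1 xs)"
    by (cases xs) (auto simp: prod_decode_0)
  then show ?case
    using Suc[of "drop 1 xs"] by (simp add: funpow_Suc_right drop_drop del: funpow.simps(2))
qed simp

lemma list_encode_eq_0: "list_encode xs = 0 \<longleftrightarrow> xs = []"
  by (cases xs) auto

lemma length_le_list_encode: "length xs \<le> list_encode xs"
proof (induction xs)
  case (Cons x xs)
  then show ?case using le_prod_encode_2[of "list_encode xs" x] by simp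
qed simp

lemma code_length_eq: "code_length z = length (list_decode z)"
proof -
  define xs where "xs = list_decode z"
  have z: "z = list_encode xs" by (simp add: xs_def)
  have "{..<z} \<inter> {i. ((\<lambda>y. psnd (y - 1)) ^^ i) z \<noteq> 0} = {..<length xs}"
    using length_le_list_encode[of xs] unfolding z code_drop list_encode_eq_0 by auto
  then show ?thesis
    unfolding code_length_def sum_of_bool_eq[OF finite_lessThan] by (simp add: xs_def)
qed

lemma code_nth_eq:
  assumes "i < length (list_decode z)"
  shows "code_nth z i = list_decode z ! i"
proof -
  define xs where "xs = list_decode z"
  have z: "z = list_encode xs" by (simp add: xs_def)
  have "drop i xs = xs ! i # drop (Suc i) xs"
    using assms by (simp add: xs_def Cons_nth_drop_Suc)
  then show ?thesis
    unfolding code_nth_def z code_drop list_encode_inverse by simp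
qed

lemma pp_member [primrec_intros]:
  assumes "primrec_fun f" "primrec_fun g"
  shows "primrec_pred (\<lambda>x. f x \<in> set (list_decode (g x)))"
proof -
  have "a \<in> set (list_decode z) \<longleftrightarrow> (\<exists>i<code_length z. code_nth z i = a)" for a z
    by (auto simp: code_length_eq code_nth_eq in_set_conv_nth)
  then show ?thesis
    by (simp only:) (intro primrec_intros assms pr_comp[OF assms(1)] pr_comp[OF assms(2)])
qed

section \<open>Coded rational numbers\<close>

text \<open>
  With \<open>int_decode a = \<lbrakk>a even\<rbrakk> (a div 2) - \<lbrakk>a odd\<rbrakk> (a div 2 + 1)\<close>, the inequality is cross-multiplied
  and the negative parts are moved to the other side, so that it speaks about natural numbers.
\<close>

lemma rat_of_code_le_iff:
  "rat_of_code x \<le> rat_of_code y \<longleftrightarrow>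
     of_bool (even (pfst x)) * (pfst x div 2) * Suc (psnd y)
       + of_bool (odd (pfst y)) * (pfst y div 2 + 1) * Suc (psnd x)
     \<le> of_bool (even (pfst y)) * (pfst y div 2) * Suc (psnd x)
       + of_bool (odd (pfst x)) * (pfst x div 2 + 1) * Suc (psnd y)"
proof -
  obtain a b c d where xy: "prod_decode x = (a, b)" "prod_decode y = (c, d)"
    by (metis surj_pair)
  let ?P = "\<lambda>a. of_bool (even a) * (a div 2)" and ?N = "\<lambda>a. of_bool (odd a) * (a div 2 + 1) :: nat"
  have dec: "int_decode a = int (?P a) - int (?N a)" for a
    by (auto simp: int_decode_def sum_decode_def)
  have "rat_of_code x \<le> rat_of_code y \<longleftrightarrow>
      real_of_int (int_decode a) * real (Suc d) \<le> real_of_int (int_decode c) * real (Suc b)"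
    unfolding rat_of_code_def xy by (simp add: divide_simps mult.commute del: of_nat_Suc)
  also have "\<dots> \<longleftrightarrow> int_decode a * int (Suc d) \<le> int_decode c * int (Suc b)"
    by (metis of_int_le_iff of_int_mult of_int_of_nat_eq)
  also have "\<dots> \<longleftrightarrow> int (?P a * Suc d + ?N c * Suc b) \<le> int (?P c * Suc b + ?N a * Suc d)"
    unfolding dec of_nat_add of_nat_mult by (auto simp: algebra_simps)
  finally show ?thesis
    unfolding xy fst_conv snd_conv of_nat_le_iff .
qed

lemma pp_rat_le [primrec_intros]:
  assumes "primrec_fun f" "primrec_fun g"
  shows "primrec_pred (\<lambda>x. rat_of_code (f x) \<le> rat_of_code (g x))"
  unfolding rat_of_code_le_iff by (intro primrec_intros assms)

lemma pp_rat_less [primrec_intros]: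
  assumes "primrec_fun f" "primrec_fun g"
  shows "primrec_pred (\<lambda>x. rat_of_code (f x) < rat_of_code (g x))"
  unfolding not_le[symmetric] by (intro primrec_intros assms)

lemma rat_of_code_surj: "\<exists>n. rat_of_code n = real_of_rat q"
proof -
  obtain a b where q: "q = Fract a b" "b > 0" using Rat_cases by metis
  have "rat_of_code (pair (int_encode a) (nat (b - 1))) = real_of_rat q"
    using q by (simp add: rat_of_code_def of_rat_rat Suc_nat_eq_nat_zadd1)
  then show ?thesis ..
qed

lemma rat_of_code_0 [simp]: "rat_of_code 0 = 0"
  by (simp add: rat_of_code_def prod_decode_0 int_decode_def sum_decode_def)

section \<open>The parity of the winding number\<close>

definition frame :: "real \<Rightarrow> real \<Rightarrow> real \<Rightarrow> real \<Rightarrow> (real \<times> real) set" where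
  "frame a b c d = {a, b} \<times> {c..d} \<union> {a..b} \<times> {c, d}"

definition sqrt_on :: "(real \<times> real) set \<Rightarrow> (real \<times> real \<Rightarrow> complex) \<Rightarrow> (real \<times> real \<Rightarrow> complex) \<Rightarrow> bool" where
  "sqrt_on S F h \<longleftrightarrow> continuous_on S h \<and> (\<forall>z\<in>S. F z = (h z)\<^sup>2)"

text \<open>For \<open>F\<close> without zeros on the frame this says that its winding number around 0 is odd.\<close>

definition odd_on :: "(real \<times> real \<Rightarrow> complex) \<Rightarrow> real \<Rightarrow> real \<Rightarrow> real \<Rightarrow> real \<Rightarrow> bool" where
  "odd_on F a b c d \<longleftrightarrow> \<not> (\<exists>h. sqrt_on (frame a b c d) F h)"

lemma sqrt_on_subset: "sqrt_on S F h \<Longrightarrow> T \<subseteq> S \<Longrightarrow> sqrt_on T F h"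
  unfolding sqrt_on_def by (meson continuous_on_subset subsetD)

text \<open>A rectangle is contractible, so without zeros \<open>F\<close> would have a square root
  on all of it, in particular on the frame.\<close>

lemma odd_on_zero:
  assumes "odd_on F a b c d" "a \<le> b" "c \<le> d" "continuous_on ({a..b} \<times> {c..d}) F"
  shows "\<exists>z\<in>{a..b} \<times> {c..d}. F z = 0"
proof (rule ccontr)
  assume "\<not> ?thesis"
  then have "\<And>z. z \<in> {a..b} \<times> {c..d} \<Longrightarrow> F z \<noteq> 0" by blast
  moreover have "contractible ({a..b} \<times> {c..d})"
    by (intro convex_imp_contractible convex_Times) auto
  ultimately obtain h where "continuous_on ({a..b} \<times> {c..d}) h"
      "\<And>z. z \<in> {a..b} \<times> {c..d} \<Longrightarrow> F z = (h z)\<^sup>2"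
    using continuous_sqrt_on_contractible[OF assms(4)] by metis
  then have "sqrt_on ({a..b} \<times> {c..d}) F h"
    by (simp add: sqrt_on_def)
  moreover have "frame a b c d \<subseteq> {a..b} \<times> {c..d}"
    using assms(2,3) by (auto simp: frame_def)
  ultimately show False
    using assms(1) sqrt_on_subset unfolding odd_on_def by blast
qed

text \<open>The quotient of two roots is continuous with values in \<open>{1, -1}\<close>, hence
  constant on a connected set.\<close>

lemma sqrt_unique_connected:
  fixes h g :: "'a::topological_space \<Rightarrow> complex"
  assumes "connected S" "continuous_on S h" "continuous_on S g"
    and sq: "\<And>z. z \<in> S \<Longrightarrow> (h z)\<^sup>2 = (g z)\<^sup>2" and nz: "\<And>z. z \<in> S \<Longrightarrow> g z \<noteq> 0"
  obtains \<sigma> where "\<sigma> = 1 \<or> \<sigma> = -1" "\<And>z. z \<in> S \<Longrightarrow> h z = \<sigma> * g z"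
proof -
  have q: "h z / g z = 1 \<or> h z / g z = -1" if "z \<in> S" for z
    using sq[OF that] nz[OF that] by (auto simp: power2_eq_iff)
  then have "(\<lambda>z. h z / g z) ` S \<subseteq> {1, -1}"
    by blast
  then have "finite ((\<lambda>z. h z / g z) ` S)"
    by (rule finite_subset) simp
  moreover have "continuous_on S (\<lambda>z. h z / g z)"
    by (intro continuous_on_divide assms) (use nz in auto)
  ultimately have "(\<lambda>z. h z / g z) constant_on S"
    by (intro continuous_finite_range_constant assms)
  then obtain \<sigma> where \<sigma>: "\<And>z. z \<in> S \<Longrightarrow> h z / g z = \<sigma>"
    unfolding constant_on_def by blast
  show ?thesis
  proof (cases "S = {}")
    case True
    then show ?thesis using that[of 1] by auto
  next
    case False
    then show ?thesis using that[of \<sigma>] \<sigma> q nz by (auto simp: divide_simps)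
  qed
qed

lemma sqrt_on_glue:
  assumes "sqrt_on S F f" "sqrt_on T F g" "closed S" "closed T"
    and "\<And>z. z \<in> S \<Longrightarrow> z \<in> T \<Longrightarrow> f z = g z"
  obtains h where "sqrt_on (S \<union> T) F h" "\<And>z. z \<in> S \<Longrightarrow> h z = f z" "\<And>z. z \<in> T \<Longrightarrow> h z = g z"
proof
  let ?h = "\<lambda>z. if z \<in> S then f z else g z"
  have "continuous_on (S \<union> T) ?h"
    by (rule continuous_on_cases) (use assms in \<open>auto simp: sqrt_on_def\<close>)
  then show "sqrt_on (S \<union> T) F ?h"
    using assms(1,2) by (auto simp: sqrt_on_def)
qed (use assms(5) in auto)

lemma closed_frame: "closed (frame a b c d)"
  unfolding frame_def by (intro closed_Un closed_Times) auto

text \<open>Roots on the frames of both halves differ by a single sign on the common edge, which is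
  connected and free of zeros. After this sign has been adjusted they glue, and the union of the two
  frames contains the outer one.\<close>

lemma odd_on_split:
  assumes odd: "odd_on F a b c d" and m: "a \<le> m" "m \<le> b" "c \<le> d"
    and nz: "\<And>t. t \<in> {c..d} \<Longrightarrow> F (m, t) \<noteq> 0"
  shows "odd_on F a m c d \<or> odd_on F m b c d"
proof (rule ccontr)
  assume "\<not> ?thesis"
  then obtain f g where f: "sqrt_on (frame a m c d) F f" and g: "sqrt_on (frame m b c d) F g"
    unfolding odd_on_def by blast
  let ?E = "{m} \<times> {c..d}"
  have E: "?E \<subseteq> frame a m c d" "?E \<subseteq> frame m b c d"
    by (auto simp: frame_def)
  have sq: "(f z)\<^sup>2 = F z" "(g z)\<^sup>2 = F z" if "z \<in> ?E" for z
    using f g E that unfolding sqrt_on_def by (metis subsetD)+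
  have "connected ?E"
    by (intro connected_Times) auto
  moreover have "continuous_on ?E f" "continuous_on ?E g"
    using f g E unfolding sqrt_on_def by (meson continuous_on_subset)+
  ultimately obtain \<sigma> where \<sigma>: "\<sigma> = 1 \<or> \<sigma> = -1" "\<And>z. z \<in> ?E \<Longrightarrow> f z = \<sigma> * g z"
    by (rule sqrt_unique_connected) (use sq nz in \<open>force+\<close>)
  have "frame a m c d \<inter> frame m b c d \<subseteq> ?E"
    using m by (auto simp: frame_def)
  then have agree: "f z = \<sigma> * g z" if "z \<in> frame a m c d" "z \<in> frame m b c d" for z
    using \<sigma>(2) that by blast
  have "sqrt_on (frame m b c d) F (\<lambda>z. \<sigma> * g z)"
    using g \<sigma>(1) unfolding sqrt_on_def
    by (auto intro!: continuous_intros simp: power_mult_distrib)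
  then obtain h where "sqrt_on (frame a m c d \<union> frame m b c d) F h"
    by (rule sqrt_on_glue[OF f _ closed_frame closed_frame agree])
  moreover have "frame a b c d \<subseteq> frame a m c d \<union> frame m b c d"
    using m by (auto simp: frame_def)
  ultimately show False
    using odd sqrt_on_subset unfolding odd_on_def by blast
qed

lemma sqrt_on_swap:
  assumes "sqrt_on (frame a b c d) F h"
  shows "sqrt_on (frame c d a b) (F \<circ> prod.swap) (h \<circ> prod.swap)"
proof -
  have "prod.swap ` frame c d a b = frame a b c d"
    by (simp add: frame_def image_Un product_swap Un_commute)
  moreover from this have "continuous_on (frame c d a b) (h \<circ> prod.swap)"
    using assms by (intro continuous_on_compose continuous_on_swap) (simp add: sqrt_on_def)
  ultimately show ?thesis
    using assms unfolding sqrt_on_def by auto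
qed

text \<open>Exchanging the coordinates reduces horizontal cuts to vertical ones.\<close>

lemma odd_on_swap: "odd_on (F \<circ> prod.swap) c d a b \<longleftrightarrow> odd_on F a b c d"
  using sqrt_on_swap[of a b c d F] sqrt_on_swap[of c d a b "F \<circ> prod.swap"]
  unfolding odd_on_def by (auto simp: comp_assoc)

lemma odd_on_split':
  assumes "odd_on F a b c d" "c \<le> m" "m \<le> d" "a \<le> b"
    and "\<And>s. s \<in> {a..b} \<Longrightarrow> F (s, m) \<noteq> 0"
  shows "odd_on F a b c m \<or> odd_on F a b m d"
  using odd_on_split[of "F \<circ> prod.swap" c d a b m] assms by (simp add: odd_on_swap)

section \<open>Branches of the square root on half-planes\<close>

text \<open>The half-planes 0, 1, 2, 3 are right, lower, left and upper.\<close>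

definition in_half :: "nat \<Rightarrow> complex \<Rightarrow> bool" where
  "in_half k z \<longleftrightarrow> k < 4 \<and> 0 < Re (\<i> ^ k * z)"

text \<open>The half-plane \<open>k\<close> is rotated onto the right one, the principal root is
  taken, and the result is rotated back by half the angle: the square of
  \<open>(1 - \<i>) / sqrt 2\<close> is \<open>- \<i>\<close>.\<close>

definition branch :: "nat \<Rightarrow> complex \<Rightarrow> complex" where
  "branch k z = ((1 - \<i>) / sqrt 2) ^ k * csqrt (\<i> ^ k * z)"

text \<open>Branches of neighbouring half-planes agree except across the seam between 3 and 0, where
  the four half rotations have accumulated the factor
  \<open>((1 - \<i>) / sqrt 2) ^ 4 = -1\<close>.\<close>

definition flips :: "nat \<Rightarrow> nat \<Rightarrow> nat" where
  "flips k l = of_bool (k = 0 \<and> l = 3 \<or> k = 3 \<and> l = 0)"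

lemma in_half_simps:
  "in_half 0 z \<longleftrightarrow> 0 < Re z"
  "in_half 1 z \<longleftrightarrow> Im z < 0"
  "in_half 2 z \<longleftrightarrow> Re z < 0"
  "in_half 3 z \<longleftrightarrow> 0 < Im z"
  by (auto simp: in_half_def power3_eq_cube)

lemma in_half_nonzero: "in_half k z \<Longrightarrow> z \<noteq> 0"
  by (auto simp: in_half_def)

lemma unit_square: "((1 - \<i>) / sqrt 2)\<^sup>2 = - \<i>"
  by (simp add: power_divide power2_diff flip: of_real_power)

lemma branch_square: "(branch k z)\<^sup>2 = z"
proof -
  have "(branch k z)\<^sup>2 = (((1 - \<i>) / sqrt 2)\<^sup>2) ^ k * (\<i> ^ k * z)"
    unfolding branch_def power_mult_distrib power2_csqrt by (simp only: power_mult[symmetric] mult.commute)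
  also have "\<dots> = (- \<i> * \<i>) ^ k * z"
    unfolding unit_square by (simp only: power_mult_distrib mult.assoc)
  finally show ?thesis by simp
qed

lemma continuous_on_branch:
  assumes "continuous_on S g" "\<And>x. x \<in> S \<Longrightarrow> in_half k (g x)"
  shows "continuous_on S (\<lambda>x. branch k (g x))"
proof -
  have "\<i> ^ k * g x \<notin> \<real>\<^sub>\<le>\<^sub>0" if "x \<in> S" for x
    using assms(2)[OF that] by (auto simp: in_half_def complex_nonpos_Reals_iff)
  then have "continuous_on S (\<lambda>x. csqrt (\<i> ^ k * g x))"
    by (intro continuous_on_compose2[OF holomorphic_on_imp_continuous_on[OF holomorphic_on_csqrt]]
        continuous_intros assms(1)) auto
  then show ?thesis
    unfolding branch_def by (intro continuous_intros)
qed

text \<open>\<open>u\<close> lies in the fourth and \<open>\<i> * u\<close> in the first quadrant,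
  so the rotation does not cross the branch cut of \<open>csqrt\<close>.\<close>

lemma csqrt_quarter_turn:
  assumes "0 < Re u" "Im u < 0"
  shows "csqrt u = (1 - \<i>) / sqrt 2 * csqrt (\<i> * u)"
proof (rule csqrt_unique)
  show "((1 - \<i>) / sqrt 2 * csqrt (\<i> * u))\<^sup>2 = u"
    unfolding power_mult_distrib power2_csqrt unit_square by simp
  have "0 < Re (csqrt (\<i> * u))"
    using csqrt_principal[of "\<i> * u"] assms
    by (smt (verit) Im_i_times Re_i_times complex_eq_iff csqrt_square power2_csqrt Re_power2 zero_less_power2 power2_eq_square mult_nonneg_nonneg zero_complex.sel mult_minus_left)
  moreover have "0 \<le> Im (csqrt (\<i> * u))"
    using assms abs_Re_le_cmod[of "\<i> * u"] by simp
  moreover have "Re ((1 - \<i>) / sqrt 2 * s) = (Re s + Im s) / sqrt 2" for s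
    by (simp add: field_simps)
  ultimately show "0 < Re ((1 - \<i>) / sqrt 2 * csqrt (\<i> * u)) \<or>
      Re ((1 - \<i>) / sqrt 2 * csqrt (\<i> * u)) = 0 \<and> 0 \<le> Im ((1 - \<i>) / sqrt 2 * csqrt (\<i> * u))"
    by (simp only:) (simp add: add_pos_nonneg)
qed

lemma branch_next:
  assumes "in_half k z" "in_half (Suc k) z"
  shows "branch k z = branch (Suc k) z"
proof -
  have "csqrt (\<i> ^ k * z) = (1 - \<i>) / sqrt 2 * csqrt (\<i> * (\<i> ^ k * z))"
    by (rule csqrt_quarter_turn) (use assms in \<open>auto simp: in_half_def mult.assoc\<close>)
  then show ?thesis
    by (simp add: branch_def mult.assoc)
qed

lemma branch_wrap:
  assumes "in_half 0 z" "in_half 3 z"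
  shows "branch 0 z = - branch 3 z"
proof -
  define w where "w = (1 - \<i>) / sqrt 2"
  have w4: "w ^ 4 = - 1"
    using unit_square unfolding w_def[symmetric] by (metis i_squared mult_2_right numeral_Bit0 power2_minus power_mult power2_eq_square power_add)
  have "csqrt (- \<i> * z) = w * csqrt (\<i> * (- \<i> * z))"
    unfolding w_def by (rule csqrt_quarter_turn) (use assms in \<open>auto simp: in_half_simps\<close>)
  moreover have "\<i> * (- \<i> * z) = z" "\<i> ^ 3 = - \<i>"
    by (simp_all add: power3_eq_cube flip: mult.assoc)
  ultimately have "branch 3 z = w ^ 3 * (w * csqrt z)"
    unfolding branch_def w_def[symmetric] by simp
  also have "\<dots> = w ^ 4 * csqrt z"
    by (simp add: eval_nat_numeral)
  finally show ?thesis
    by (simp add: w4 branch_def)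
qed

text \<open>Opposite half-planes are disjoint, so only equal and cyclically neighbouring labels have
  to be compared.\<close>

lemma branch_change:
  assumes "in_half k z" "in_half l z"
  shows "branch k z = (-1) ^ flips k l * branch l z"
proof -
  have "k \<in> {0, 1, 2, 3}" "l \<in> {0, 1, 2, 3}"
    using assms by (auto simp: in_half_def)
  then consider "k = l" | "l = Suc k" | "k = Suc l" | "k = 0" "l = 3" | "k = 3" "l = 0"
    | "k = 0" "l = 2" | "k = 2" "l = 0" | "k = 1" "l = 3" | "k = 3" "l = 1"
    by auto
  then show ?thesis
  proof cases
    case 2
    then show ?thesis using branch_next[of k z] assms by (auto simp: flips_def)
  next
    case 3
    then show ?thesis using branch_next[of l z] assms by (auto simp: flips_def)
  next
    case 4
    then show ?thesis using branch_wrap[of z] assms by (simp add: flips_def)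
  next
    case 5
    then show ?thesis using branch_wrap[of z] assms by (simp add: flips_def)
  qed (use assms in \<open>auto simp: flips_def in_half_simps simp del: One_nat_def\<close>)
qed

section \<open>Square roots along a subdivided frame\<close>

lemma mesh_mono:
  fixes x :: "nat \<Rightarrow> real"
  assumes "\<And>i. i \<le> m \<Longrightarrow> x i \<le> x (Suc i)" "i \<le> j" "j \<le> Suc m"
  shows "x i \<le> x j"
  using assms(2,3) by (induction j rule: dec_induct) (auto intro: order_trans[OF _ assms(1)])

text \<open>On each cell \<open>h\<close> is a constant sign times the branch belonging to its
  label; at the mesh points the sign changes as told by \<open>flips\<close>. Cells may be
  degenerate.\<close>

lemma sqrt_along_chain:
  fixes x :: "nat \<Rightarrow> real" and g h :: "real \<Rightarrow> complex"
  assumes mono: "\<And>i. i \<le> n \<Longrightarrow> x i \<le> x (Suc i)"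
    and lab: "\<And>i s. i \<le> n \<Longrightarrow> s \<in> {x i..x (Suc i)} \<Longrightarrow> in_half (l i) (g s)"
    and cont: "continuous_on {x 0..x (Suc n)} g" "continuous_on {x 0..x (Suc n)} h"
    and sq: "\<And>s. s \<in> {x 0..x (Suc n)} \<Longrightarrow> g s = (h s)\<^sup>2"
    and start: "h (x 0) = \<sigma> * branch (l 0) (g (x 0))"
  shows "h (x (Suc n)) = \<sigma> * (-1) ^ (\<Sum>i<n. flips (l i) (l (Suc i))) * branch (l n) (g (x (Suc n)))"
proof -
  note mono' = mesh_mono[of n x, OF mono]
  have piece: "h (x (Suc i)) = \<tau> * branch (l i) (g (x (Suc i)))"
    if i: "i \<le> n" and left: "h (x i) = \<tau> * branch (l i) (g (x i))" for i \<tau>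
  proof -
    have sub: "{x i..x (Suc i)} \<subseteq> {x 0..x (Suc n)}"
      using mono'[of 0 i] mono'[of "Suc i" "Suc n"] i by auto
    have "continuous_on {x i..x (Suc i)} (\<lambda>s. branch (l i) (g s))"
      using continuous_on_subset[OF cont(1) sub] lab[OF i] by (rule continuous_on_branch)
    moreover have "(h s)\<^sup>2 = (branch (l i) (g s))\<^sup>2" "branch (l i) (g s) \<noteq> 0"
      if "s \<in> {x i..x (Suc i)}" for s
      using sq[of s] that sub in_half_nonzero[OF lab[OF i that]] branch_square[of "l i" "g s"]
      by auto
    ultimately obtain \<rho> where \<rho>: "\<And>s. s \<in> {x i..x (Suc i)} \<Longrightarrow> h s = \<rho> * branch (l i) (g s)"
      using sqrt_unique_connected[OF _ continuous_on_subset[OF cont(2) sub]]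
      by (metis connected_Icc)
    have "branch (l i) (g (x i)) \<noteq> 0"
      using in_half_nonzero[OF lab[OF i, of "x i"]] branch_square[of "l i" "g (x i)"] mono[OF i] by auto
    then have "\<rho> = \<tau>"
      using \<rho>[of "x i"] left mono[OF i] by simp
    then show ?thesis
      using \<rho>[of "x (Suc i)"] mono[OF i] by simp
  qed
  have "h (x (Suc j)) = \<sigma> * (-1) ^ (\<Sum>i<j. flips (l i) (l (Suc i))) * branch (l j) (g (x (Suc j)))"
    if "j \<le> n" for j
    using that
  proof (induction j)
    case 0
    then show ?case using piece[of 0 \<sigma>] start by simp
  next
    case (Suc j)
    have "branch (l j) (g (x (Suc j))) = (-1) ^ flips (l j) (l (Suc j)) * branch (l (Suc j)) (g (x (Suc j)))"
      using lab[of j "x (Suc j)"] lab[of "Suc j" "x (Suc j)"] mono[of j] mono[of "Suc j"] Suc.prems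
      by (intro branch_change) auto
    then have "h (x (Suc j)) = (\<sigma> * (-1) ^ (\<Sum>i<Suc j. flips (l i) (l (Suc i)))) * branch (l (Suc j)) (g (x (Suc j)))"
      using Suc by (simp add: power_add)
    then show ?case
      using piece[of "Suc j"] Suc.prems by simp
  qed
  then show ?thesis by simp
qed

lemma sqrt_on_edge:
  assumes "convex E" "continuous_on E F" "\<And>z. z \<in> E \<Longrightarrow> F z \<noteq> 0" "p \<in> E" "v\<^sup>2 = F p"
  obtains h where "sqrt_on E F h" "h p = v"
proof -
  obtain g where g: "continuous_on E g" "\<And>z. z \<in> E \<Longrightarrow> F z = (g z)\<^sup>2"
    using continuous_sqrt_on_contractible[OF assms(2) convex_imp_contractible[OF assms(1)] assms(3)] by metis
  then have "g p = v \<or> g p = - v"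
    using assms(4,5) power2_eq_iff[of "g p" v] by simp
  moreover have "sqrt_on E F g" "sqrt_on E F (\<lambda>z. - g z)"
    using g by (auto simp: sqrt_on_def intro: continuous_on_minus)
  ultimately show ?thesis
    using that[of g] that[of "\<lambda>z. - g z"] by force
qed

text \<open>Adds the sign changes on the two ways from the lower left to the upper right corner,
  bottom and right against left and top. A sum will do instead of a difference, as only the parity
  matters.\<close>

definition flip_count :: "nat \<Rightarrow> nat \<Rightarrow> (nat \<Rightarrow> nat \<Rightarrow> nat) \<Rightarrow> nat" where
  "flip_count m n l =
     (\<Sum>i<m. flips (l i 0) (l (Suc i) 0)) + (\<Sum>j<n. flips (l m j) (l m (Suc j)))
     + ((\<Sum>j<n. flips (l 0 j) (l 0 (Suc j))) + (\<Sum>i<m. flips (l i n) (l (Suc i) n)))"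

lemma mesh_cover:
  fixes x :: "nat \<Rightarrow> real"
  assumes "s \<in> {x 0..x (Suc m)}"
  shows "\<exists>i\<le>m. s \<in> {x i..x (Suc i)}"
proof -
  define i where "i = (LEAST i. s \<le> x (Suc i))"
  have ex: "s \<le> x (Suc m)" using assms by simp
  have 1: "s \<le> x (Suc i)" unfolding i_def by (rule LeastI[of _ m]) (rule ex)
  have 2: "i \<le> m" unfolding i_def by (rule Least_le) (rule ex)
  have "x i \<le> s"
    using assms not_less_Least[of "i - 1" "\<lambda>i. s \<le> x (Suc i)"]
    by (cases i) (auto simp: i_def[symmetric])
  then show ?thesis using 1 2 by auto
qed

lemma frame_nonzero:
  fixes x y :: "nat \<Rightarrow> real"
  assumes mono: "\<And>i. i \<le> m \<Longrightarrow> x i \<le> x (Suc i)" "\<And>j. j \<le> n \<Longrightarrow> y j \<le> y (Suc j)"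
    and lab: "\<And>i j s t. i \<le> m \<Longrightarrow> j \<le> n \<Longrightarrow> i = 0 \<or> i = m \<or> j = 0 \<or> j = n \<Longrightarrow>
        s \<in> {x i..x (Suc i)} \<Longrightarrow> t \<in> {y j..y (Suc j)} \<Longrightarrow>
        (s, t) \<in> frame (x 0) (x (Suc m)) (y 0) (y (Suc n)) \<Longrightarrow> in_half (l i j) (F (s, t))"
    and z: "z \<in> frame (x 0) (x (Suc m)) (y 0) (y (Suc n))"
  shows "F z \<noteq> 0"
proof -
  let ?a = "x 0" and ?b = "x (Suc m)" and ?c = "y 0" and ?d = "y (Suc n)"
  have ends: "?a \<le> x (Suc 0)" "x m \<le> ?b" "?c \<le> y (Suc 0)" "y n \<le> ?d"
    using mono(1)[of 0] mono(1)[of m] mono(2)[of 0] mono(2)[of n] by auto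
  obtain s t where st: "z = (s, t)" by (cases z)
  note lab' = lab[where s = s and t = t, OF _ _ _ _ _ z[unfolded st]]
  consider "s = ?a" "t \<in> {?c..?d}" | "s = ?b" "t \<in> {?c..?d}"
    | "t = ?c" "s \<in> {?a..?b}" | "t = ?d" "s \<in> {?a..?b}"
    using z by (auto simp: frame_def st)
  then obtain k where "in_half k (F (s, t))"
  proof cases
    case 1
    then obtain j where "j \<le> n" "t \<in> {y j..y (Suc j)}" using mesh_cover by blast
    then show ?thesis using lab'[of 0 j] that 1 ends by auto
  next
    case 2
    then obtain j where "j \<le> n" "t \<in> {y j..y (Suc j)}" using mesh_cover by blast
    then show ?thesis using lab'[of m j] that 2 ends by auto
  next
    case 3
    then obtain i where "i \<le> m" "s \<in> {x i..x (Suc i)}" using mesh_cover by blast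
    then show ?thesis using lab'[of i 0] that 3 ends by auto
  next
    case 4
    then obtain i where "i \<le> m" "s \<in> {x i..x (Suc i)}" using mesh_cover by blast
    then show ?thesis using lab'[of i n] that 4 ends by auto
  qed
  then show ?thesis using in_half_nonzero by (auto simp: st)
qed

text \<open>A root is followed from the lower left corner along both ways to the upper right one; a
  root on the whole frame exists iff both ways arrive with the same sign. Labels are required only
  where the outermost cells touch the frame, since \<open>F\<close> may vanish elsewhere in
  them.\<close>

lemma odd_on_iff_flip_count:
  fixes x y :: "nat \<Rightarrow> real"
  assumes mono: "\<And>i. i \<le> m \<Longrightarrow> x i \<le> x (Suc i)" "\<And>j. j \<le> n \<Longrightarrow> y j \<le> y (Suc j)"
    and strict: "x 0 < x (Suc m)" "y 0 < y (Suc n)"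
    and cont: "continuous_on (frame (x 0) (x (Suc m)) (y 0) (y (Suc n))) F"
    and lab: "\<And>i j s t. i \<le> m \<Longrightarrow> j \<le> n \<Longrightarrow> i = 0 \<or> i = m \<or> j = 0 \<or> j = n \<Longrightarrow>
        s \<in> {x i..x (Suc i)} \<Longrightarrow> t \<in> {y j..y (Suc j)} \<Longrightarrow>
        (s, t) \<in> frame (x 0) (x (Suc m)) (y 0) (y (Suc n)) \<Longrightarrow> in_half (l i j) (F (s, t))"
  shows "odd_on F (x 0) (x (Suc m)) (y 0) (y (Suc n)) \<longleftrightarrow> odd (flip_count m n l)"
proof -
  let ?a = "x 0" and ?b = "x (Suc m)" and ?c = "y 0" and ?d = "y (Suc n)"
  let ?fr = "frame ?a ?b ?c ?d"
  let ?B = "\<Sum>i<m. flips (l i 0) (l (Suc i) 0)" and ?T = "\<Sum>i<m. flips (l i n) (l (Suc i) n)"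
  let ?L = "\<Sum>j<n. flips (l 0 j) (l 0 (Suc j))" and ?R = "\<Sum>j<n. flips (l m j) (l m (Suc j))"
  define EB where "EB = {?a..?b} \<times> {?c}"
  define ET where "ET = {?a..?b} \<times> {?d}"
  define EL where "EL = {?a} \<times> {?c..?d}"
  define ER where "ER = {?b} \<times> {?c..?d}"
  note E_defs = EB_def ET_def EL_def ER_def
  have fr: "?fr = (EL \<union> EB) \<union> (ET \<union> ER)"
    by (auto simp: frame_def E_defs)
  have ends: "?a \<le> x (Suc 0)" "x m \<le> ?b" "?c \<le> y (Suc 0)" "y n \<le> ?d"
    using mono(1)[of 0] mono(1)[of m] mono(2)[of 0] mono(2)[of n] by auto
  have nz: "F z \<noteq> 0" if "z \<in> ?fr" for z
    by (rule frame_nonzero[where x = x and y = y and m = m and n = n and l = l and F = F, OF mono lab that])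
  have within: "s \<in> {?a..?b}" if "i \<le> m" "s \<in> {x i..x (Suc i)}" for i s
    using mesh_mono[of m x 0 i] mesh_mono[of m x "Suc i" "Suc m"] mono(1) that by fastforce
  have within': "t \<in> {?c..?d}" if "j \<le> n" "t \<in> {y j..y (Suc j)}" for j t
    using mesh_mono[of n y 0 j] mesh_mono[of n y "Suc j" "Suc n"] mono(2) that by fastforce
  have chain_x: "h (?b, t) = \<sigma> * (-1) ^ (\<Sum>i<m. flips (l i j) (l (Suc i) j)) * branch (l m j) (F (?b, t))"
    if h: "sqrt_on ({?a..?b} \<times> {t}) F h" and start: "h (?a, t) = \<sigma> * branch (l 0 j) (F (?a, t))"
      and j: "j = 0 \<and> t = ?c \<or> j = n \<and> t = ?d" for h t \<sigma> j
  proof -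
    have "continuous_on {?a..?b} (\<lambda>s. h (s, t))" "continuous_on {?a..?b} (\<lambda>s. F (s, t))"
      using h j unfolding sqrt_on_def
      by (auto intro!: continuous_on_compose2[of "{?a..?b} \<times> {t}" h]
          continuous_on_compose2[OF cont] continuous_intros simp: frame_def)
    then show ?thesis
      using sqrt_along_chain[of m x "\<lambda>i. l i j" "\<lambda>s. F (s, t)" "\<lambda>s. h (s, t)" \<sigma>]
        mono(1) lab[of _ j _ t] within h start j ends
      unfolding sqrt_on_def by (auto simp: frame_def)
  qed
  have chain_y: "h (s, ?d) = \<sigma> * (-1) ^ (\<Sum>j<n. flips (l i j) (l i (Suc j))) * branch (l i n) (F (s, ?d))"
    if h: "sqrt_on ({s} \<times> {?c..?d}) F h" and start: "h (s, ?c) = \<sigma> * branch (l i 0) (F (s, ?c))"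
      and i: "i = 0 \<and> s = ?a \<or> i = m \<and> s = ?b" for h s \<sigma> i
  proof -
    have "continuous_on {?c..?d} (\<lambda>t. h (s, t))" "continuous_on {?c..?d} (\<lambda>t. F (s, t))"
      using h i unfolding sqrt_on_def
      by (auto intro!: continuous_on_compose2[of "{s} \<times> {?c..?d}" h]
          continuous_on_compose2[OF cont] continuous_intros simp: frame_def)
    then show ?thesis
      using sqrt_along_chain[of n y "\<lambda>j. l i j" "\<lambda>t. F (s, t)" "\<lambda>t. h (s, t)" \<sigma>]
        mono(2) lab[of i _ s _] within' h start i ends
      unfolding sqrt_on_def by (auto simp: frame_def)
  qed
  have br_nz: "branch (l m n) (F (?b, ?d)) \<noteq> 0"
    using nz[of "(?b, ?d)"] branch_square[of "l m n" "F (?b, ?d)"] strict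
    by (auto simp: frame_def)
  have "\<not> odd (flip_count m n l)" if h: "sqrt_on ?fr F h" for h
  proof -
    have sub: "sqrt_on EB F h" "sqrt_on ET F h" "sqrt_on EL F h" "sqrt_on ER F h"
      using h by (auto intro: sqrt_on_subset simp: fr)
    have "(h (?a, ?c))\<^sup>2 = (branch (l 0 0) (F (?a, ?c)))\<^sup>2"
      using sub(1) strict by (simp add: sqrt_on_def EB_def branch_square)
    then obtain \<sigma> :: complex where \<sigma>: "\<sigma> = 1 \<or> \<sigma> = -1" "h (?a, ?c) = \<sigma> * branch (l 0 0) (F (?a, ?c))"
      using power2_eq_iff[of "h (?a, ?c)"] that
      by (metis mult_1 mult_minus1)
    have "h (?b, ?d) = \<sigma> * (-1) ^ ?B * (-1) ^ ?R * branch (l m n) (F (?b, ?d))"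
      using chain_y[OF sub(4)[unfolded ER_def], of _ m] chain_x[OF sub(1)[unfolded EB_def] \<sigma>(2)] by simp
    moreover have "h (?b, ?d) = \<sigma> * (-1) ^ ?L * (-1) ^ ?T * branch (l m n) (F (?b, ?d))"
      using chain_x[OF sub(2)[unfolded ET_def], of _ n] chain_y[OF sub(3)[unfolded EL_def] \<sigma>(2)] by simp
    ultimately have "(-1 :: complex) ^ (?B + ?R) = (-1) ^ (?L + ?T)"
      using br_nz \<sigma>(1) by (auto simp: power_add)
    then have "even (?B + ?R) \<longleftrightarrow> even (?L + ?T)"
      by (auto simp: minus_one_power_iff split: if_splits)
    then show ?thesis
      by (simp add: flip_count_def)
  qed
  \<comment> \<open>Conversely, roots on the four edges are chained from the lower left corner; even
    parity makes them agree at the upper right one, so that they can be glued.\<close>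
  moreover have "\<exists>h. sqrt_on ?fr F h" if even: "even (flip_count m n l)"
  proof -
    have conv: "convex EB" "convex ET" "convex EL" "convex ER"
      by (auto simp: E_defs intro!: convex_Times)
    have clos: "closed EB" "closed ET" "closed EL" "closed ER"
      by (auto simp: E_defs intro!: closed_Times)
    have contE: "continuous_on E F" "\<And>z. z \<in> E \<Longrightarrow> F z \<noteq> 0" if "E \<in> {EB, ET, EL, ER}" for E
      using that nz continuous_on_subset[OF cont, of E] by (auto simp: fr)
    have corners: "(?a, ?c) \<in> EB" "(?a, ?c) \<in> EL" "(?a, ?d) \<in> ET" "(?b, ?c) \<in> ER"
      "(?a, ?d) \<in> EL" "(?b, ?c) \<in> EB"
      using strict by (auto simp: E_defs)
    obtain hB where hB: "sqrt_on EB F hB" "hB (?a, ?c) = branch (l 0 0) (F (?a, ?c))"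
      by (rule sqrt_on_edge[OF conv(1) contE _ branch_square]) (use corners in auto)
    obtain hL where hL: "sqrt_on EL F hL" "hL (?a, ?c) = branch (l 0 0) (F (?a, ?c))"
      by (rule sqrt_on_edge[OF conv(3) contE _ branch_square]) (use corners in auto)
    have ends_sq: "(hL (?a, ?d))\<^sup>2 = F (?a, ?d)" "(hB (?b, ?c))\<^sup>2 = F (?b, ?c)"
      using hL(1) hB(1) corners by (auto simp: sqrt_on_def)
    obtain hT where hT: "sqrt_on ET F hT" "hT (?a, ?d) = hL (?a, ?d)"
      by (rule sqrt_on_edge[OF conv(2) contE _ ends_sq(1)]) (use corners in auto)
    obtain hR where hR: "sqrt_on ER F hR" "hR (?b, ?c) = hB (?b, ?c)"
      by (rule sqrt_on_edge[OF conv(4) contE _ ends_sq(2)]) (use corners in auto)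
    have "hR (?b, ?d) = (-1) ^ ?B * (-1) ^ ?R * branch (l m n) (F (?b, ?d))"
      using chain_y[OF hR(1)[unfolded ER_def], of _ m] chain_x[OF hB(1)[unfolded EB_def], of 1 0] hB(2) hR(2)
      by simp
    moreover have "hT (?b, ?d) = (-1) ^ ?L * (-1) ^ ?T * branch (l m n) (F (?b, ?d))"
      using chain_x[OF hT(1)[unfolded ET_def], of _ n] chain_y[OF hL(1)[unfolded EL_def], of 1 0] hL(2) hT(2)
      by simp
    moreover have "(-1 :: complex) ^ (?B + ?R) = (-1) ^ (?L + ?T)"
      using even by (auto simp: flip_count_def minus_one_power_iff)
    ultimately have RT: "hT (?b, ?d) = hR (?b, ?d)"
      by (simp add: power_add)
    obtain h1 where h1: "sqrt_on (EL \<union> EB) F h1" "\<And>z. z \<in> EL \<Longrightarrow> h1 z = hL z" "\<And>z. z \<in> EB \<Longrightarrow> h1 z = hB z"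
      by (rule sqrt_on_glue[OF hL(1) hB(1)]) (use clos hL hB in \<open>auto simp: E_defs\<close>)
    obtain h2 where h2: "sqrt_on (ET \<union> ER) F h2" "\<And>z. z \<in> ET \<Longrightarrow> h2 z = hT z" "\<And>z. z \<in> ER \<Longrightarrow> h2 z = hR z"
      by (rule sqrt_on_glue[OF hT(1) hR(1)]) (use clos RT in \<open>auto simp: E_defs\<close>)
    \<comment> \<open>Since the rectangle is not degenerate, the two glued pairs of edges share only
      two corners, where the later edge root was started with the value of the earlier one.\<close>
    have "h1 z = h2 z" if "z \<in> EL \<union> EB" "z \<in> ET \<union> ER" for z
    proof -
      have "z = (?a, ?d) \<or> z = (?b, ?c)"
        using that strict by (auto simp: E_defs)
      then show ?thesis
        using h1(2,3) h2(2,3) hT(2) hR(2) corners by metis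
    qed
    then show ?thesis
      using sqrt_on_glue[OF h1(1) h2(1)] clos unfolding fr by (metis closed_Un)
  qed
  ultimately show ?thesis
    unfolding odd_on_def by blast
qed

section \<open>Certificates\<close>

abbreviation box_x :: "nat \<Rightarrow> nat" where "box_x P \<equiv> pfst (psnd P)"
abbreviation box_y :: "nat \<Rightarrow> nat" where "box_y P \<equiv> psnd (psnd P)"

text \<open>Since \<open>int_decode 2 = 1\<close>, this codes the fraction 1/1.\<close>

abbreviation rat_one :: nat where "rat_one \<equiv> pair 2 0"

text \<open>
  Both paths are extended horizontally to the whole line, with ordinates \<open>e\<close> on the left and
  \<open>e'\<close> on the right; \<open>L\<close> lists the subbasic codes read so far.
\<close>

definition known_box :: "nat \<Rightarrow> nat \<Rightarrow> nat \<Rightarrow> nat \<Rightarrow> bool" where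
  "known_box e e' L P \<longleftrightarrow> P \<in> set (list_decode L) \<or>
     lower (pfst P) \<le> upper (pfst P) \<and>
     lower (box_x P) < lower (pfst P) \<and> upper (pfst P) < upper (box_x P) \<and>
     (upper (pfst P) \<le> rat_of_code 0 \<and> lower (box_y P) < rat_of_code e \<and> rat_of_code e < upper (box_y P) \<or>
      rat_of_code rat_one \<le> lower (pfst P) \<and> lower (box_y P) < rat_of_code e' \<and> rat_of_code e' < upper (box_y P))"

text \<open>A rational number has many codes, so adjacent end points are compared by value; equality
  is expressed by two inequalities, which are decidable on codes.\<close>

definition known_chain :: "nat \<Rightarrow> nat \<Rightarrow> nat \<Rightarrow> nat \<Rightarrow> bool" where
  "known_chain e e' L c \<longleftrightarrow> code_length c \<noteq> 0 \<and>
     (\<forall>i<code_length c. known_box e e' L (code_nth c i)) \<and>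
     (\<forall>i<code_length c - 1.
        upper (pfst (code_nth c i)) \<le> lower (pfst (code_nth c (Suc i))) \<and>
        lower (pfst (code_nth c (Suc i))) \<le> upper (pfst (code_nth c i)))"

definition chain_start :: "nat \<Rightarrow> nat" where
  "chain_start c = pfst (pfst (code_nth c 0))"

definition chain_end :: "nat \<Rightarrow> nat" where
  "chain_end c = psnd (pfst (code_nth c (code_length c - 1)))"

text \<open>The half-plane containing the difference of the two boxes, or 4 if there is none.\<close>

definition box_label :: "nat \<Rightarrow> nat \<Rightarrow> nat" where
  "box_label P Q =
     (if upper (box_x Q) \<le> lower (box_x P) then 0
      else if upper (box_y P) \<le> lower (box_y Q) then 1
      else if upper (box_x P) \<le> lower (box_x Q) then 2
      else if upper (box_y Q) \<le> lower (box_y P) then 3 else 4)"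

text \<open>The chains only have to cover \<open>R\<close>: absence of zeros passes to subsets, so a
  certificate stays valid when the rectangle shrinks.\<close>

definition separation_cert :: "nat \<Rightarrow> nat \<Rightarrow> nat \<Rightarrow> nat \<Rightarrow> bool" where
  "separation_cert L K R c \<longleftrightarrow>
     known_chain 0 rat_one L (pfst c) \<and> known_chain rat_one 0 K (psnd c) \<and>
     rat_of_code (chain_start (pfst c)) \<le> lower (pfst R) \<and>
     upper (pfst R) \<le> rat_of_code (chain_end (pfst c)) \<and>
     rat_of_code (chain_start (psnd c)) \<le> lower (psnd R) \<and>
     upper (psnd R) \<le> rat_of_code (chain_end (psnd c)) \<and>
     (\<forall>i<code_length (pfst c). \<forall>j<code_length (psnd c).
        box_label (code_nth (pfst c) i) (code_nth (psnd c) j) \<noteq> 4)"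

text \<open>Oddness is not inherited by smaller rectangles, so here the chains must end exactly at
  the sides of \<open>R\<close>. They may be compared as codes because \<open>R\<close> does not
  change while the certificate is awaited. Only outermost cells need a label.\<close>

definition odd_cert :: "nat \<Rightarrow> nat \<Rightarrow> nat \<Rightarrow> nat \<Rightarrow> bool" where
  "odd_cert L K R c \<longleftrightarrow>
     known_chain 0 rat_one L (pfst c) \<and> known_chain rat_one 0 K (psnd c) \<and>
     chain_start (pfst c) = pfst (pfst R) \<and> chain_end (pfst c) = psnd (pfst R) \<and>
     chain_start (psnd c) = pfst (psnd R) \<and> chain_end (psnd c) = psnd (psnd R) \<and>
     (\<forall>i<code_length (pfst c). \<forall>j<code_length (psnd c).
        i = 0 \<or> i = code_length (pfst c) - 1 \<or> j = 0 \<or> j = code_length (psnd c) - 1 \<longrightarrow>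
        box_label (code_nth (pfst c) i) (code_nth (psnd c) j) \<noteq> 4) \<and>
     odd (flip_count (code_length (pfst c) - 1) (code_length (psnd c) - 1)
       (\<lambda>i j. box_label (code_nth (pfst c) i) (code_nth (psnd c) j)))"

section \<open>The algorithm\<close>

text \<open>
  A cut \<open>x\<close> is a pair of a direction and a rational number. It cuts the first interval of
  the rectangle \<open>R\<close> if the direction is 0 and the second one otherwise.
\<close>

definition proper_cut :: "nat \<Rightarrow> nat \<Rightarrow> bool" where
  "proper_cut x R \<longleftrightarrow>
     (if pfst x = 0
      then lower (pfst R) < rat_of_code (psnd x) \<and> rat_of_code (psnd x) < upper (pfst R)
      else lower (psnd R) < rat_of_code (psnd x) \<and> rat_of_code (psnd x) < upper (psnd R))"

definition cut_line :: "nat \<Rightarrow> nat \<Rightarrow> nat" where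
  "cut_line x R = (if pfst x = 0 then pair (pair (psnd x) (psnd x)) (psnd R)
     else pair (pfst R) (pair (psnd x) (psnd x)))"

definition half_below :: "nat \<Rightarrow> nat \<Rightarrow> nat" where
  "half_below x R = (if pfst x = 0 then pair (pair (pfst (pfst R)) (psnd x)) (psnd R)
     else pair (pfst R) (pair (pfst (psnd R)) (psnd x)))"

definition half_above :: "nat \<Rightarrow> nat \<Rightarrow> nat" where
  "half_above x R = (if pfst x = 0 then pair (pair (psnd x) (psnd (pfst R))) (psnd R)
     else pair (pfst R) (pair (psnd x) (psnd (psnd R))))"

text \<open>
  The state consists of a rectangle \<open>R\<close>, a mode \<open>m\<close> and a counter \<open>k\<close>. In mode 0
  the cut \<open>pfst k\<close> is examined, so that every cut is examined infinitely often; it is adopted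
  if the paths are seen to be disjoint along the cut. In mode \<open>Suc x\<close> the machine waits for
  one of the two halves to be certified.
\<close>

definition refine :: "nat \<Rightarrow> nat \<Rightarrow> nat \<Rightarrow> nat \<Rightarrow> nat" where
  "refine n L K Y =
     (if pfst (psnd Y) = 0
      then pair (pfst Y)
        (pair (if proper_cut (pfst (psnd (psnd Y))) (pfst Y) \<and>
                  (\<exists>c<n. separation_cert L K (cut_line (pfst (psnd (psnd Y))) (pfst Y)) c)
               then Suc (pfst (psnd (psnd Y))) else 0)
           (Suc (psnd (psnd Y))))
      else if \<exists>c<n. odd_cert L K (half_below (pfst (psnd Y) - 1) (pfst Y)) c
      then pair (half_below (pfst (psnd Y) - 1) (pfst Y)) (pair 0 (psnd (psnd Y)))
      else if \<exists>c<n. odd_cert L K (half_above (pfst (psnd Y) - 1) (pfst Y)) c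
      then pair (half_above (pfst (psnd Y) - 1) (pfst Y)) (pair 0 (psnd (psnd Y)))
      else Y)"

text \<open>
  \<open>read_bit\<close> acts on the pair of the length of the current block of ones and the list of the
  codes read so far; \<open>emit\<close> acts on the number of ones that remain to be written before the
  next zero.
\<close>

definition read_bit :: "nat \<Rightarrow> nat \<Rightarrow> nat" where
  "read_bit b A = (if b = 0 then pair 0 (Suc A) else pair (Suc (pfst A)) (psnd A))"

definition emit :: "nat \<Rightarrow> nat \<Rightarrow> nat" where
  "emit I v = (if v = 0 then I else v - 1)"

text \<open>\<open>n\<close> is the time, \<open>A\<close> and \<open>B\<close> read the two names,
  \<open>Y\<close> is the state of \<open>refine\<close>, and \<open>v\<close> and \<open>w\<close>
  emit the two intervals.\<close>

definition make_state :: "nat \<Rightarrow> nat \<Rightarrow> nat \<Rightarrow> nat \<Rightarrow> nat \<Rightarrow> nat \<Rightarrow> nat" where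
  "make_state n A B Y v w = pair n (pair A (pair B (pair Y (pair v w))))"

text \<open>By the interleaving in \<open>pair_rep\<close>, even times belong to the first component
  and odd times to the second, on the input as well as on the output. The bit is written from the
  emitter before its update, whereas \<open>refine\<close> advances every time.\<close>

definition update :: "nat \<Rightarrow> nat \<Rightarrow> nat \<Rightarrow> nat \<Rightarrow> nat \<Rightarrow> nat \<Rightarrow> nat \<Rightarrow> nat" where
  "update b n A B Y v w =
     (if even n
      then pair v (make_state (Suc n) (read_bit b A) B (refine n (psnd A) (psnd B) Y)
        (emit (pfst (pfst Y)) v) w)
      else pair w (make_state (Suc n) A (read_bit b B) (refine n (psnd A) (psnd B) Y)
        v (emit (psnd (pfst Y)) w)))"

text \<open>The first component of \<open>psnd z\<close> is the previous output, which is
  skipped.\<close>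

definition update_code :: "nat \<Rightarrow> nat" where
  "update_code z = update (pfst z) (pfst (psnd (psnd z))) (pfst (psnd (psnd (psnd z))))
     (pfst (psnd (psnd (psnd (psnd z))))) (pfst (psnd (psnd (psnd (psnd (psnd z))))))
     (pfst (psnd (psnd (psnd (psnd (psnd (psnd z)))))))
     (psnd (psnd (psnd (psnd (psnd (psnd (psnd z)))))))"

lemma pp_known_box [primrec_intros]:
  assumes "primrec_fun e" "primrec_fun e'" "primrec_fun L" "primrec_fun P"
  shows "primrec_pred (\<lambda>x. known_box (e x) (e' x) (L x) (P x))"
  unfolding known_box_def lower_def upper_def by (intro primrec_intros assms)

lemma pp_known_chain [primrec_intros]:
  assumes "primrec_fun e" "primrec_fun e'" "primrec_fun L" "primrec_fun c"
  shows "primrec_pred (\<lambda>x. known_chain (e x) (e' x) (L x) (c x))"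
  unfolding known_chain_def lower_def upper_def
  by (intro primrec_intros assms assms[THEN pr_comp])

lemma pr_chain_start [primrec_intros]:
  "primrec_fun c \<Longrightarrow> primrec_fun (\<lambda>x. chain_start (c x))"
  unfolding chain_start_def by (intro primrec_intros)

lemma pr_chain_end [primrec_intros]:
  "primrec_fun c \<Longrightarrow> primrec_fun (\<lambda>x. chain_end (c x))"
  unfolding chain_end_def by (intro primrec_intros)

lemma pr_box_label [primrec_intros]:
  "primrec_fun P \<Longrightarrow> primrec_fun Q \<Longrightarrow> primrec_fun (\<lambda>x. box_label (P x) (Q x))"
  unfolding box_label_def lower_def upper_def by (intro primrec_intros)

lemma pr_flips [primrec_intros]:
  "primrec_fun f \<Longrightarrow> primrec_fun g \<Longrightarrow> primrec_fun (\<lambda>x. flips (f x) (g x))"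
  unfolding flips_def by (intro primrec_intros)

lemma pp_separation_cert [primrec_intros]:
  assumes "primrec_fun L" "primrec_fun K" "primrec_fun R" "primrec_fun c"
  shows "primrec_pred (\<lambda>x. separation_cert (L x) (K x) (R x) (c x))"
  unfolding separation_cert_def lower_def upper_def
  by (intro primrec_intros assms assms[THEN pr_comp])

lemma pp_odd_cert [primrec_intros]:
  assumes "primrec_fun L" "primrec_fun K" "primrec_fun R" "primrec_fun c"
  shows "primrec_pred (\<lambda>x. odd_cert (L x) (K x) (R x) (c x))"
  unfolding odd_cert_def flip_count_def
  by (intro primrec_intros assms assms[THEN pr_comp])

lemma pp_proper_cut [primrec_intros]:
  assumes "primrec_fun f" "primrec_fun R"
  shows "primrec_pred (\<lambda>x. proper_cut (f x) (R x))"
  unfolding proper_cut_def lower_def upper_def if_bool_eq_conj by (intro primrec_intros assms)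

lemma pr_cuts [primrec_intros]:
  assumes "primrec_fun f" "primrec_fun R"
  shows "primrec_fun (\<lambda>x. cut_line (f x) (R x))"
    and "primrec_fun (\<lambda>x. half_below (f x) (R x))"
    and "primrec_fun (\<lambda>x. half_above (f x) (R x))"
  unfolding cut_line_def half_below_def half_above_def by (intro primrec_intros assms)+

lemma pr_refine [primrec_intros]:
  assumes "primrec_fun n" "primrec_fun L" "primrec_fun K" "primrec_fun Y"
  shows "primrec_fun (\<lambda>x. refine (n x) (L x) (K x) (Y x))"
  unfolding refine_def by (intro primrec_intros assms assms[THEN pr_comp])

lemma primrec_update_code: "primrec_fun update_code"
  unfolding update_code_def[abs_def] update_def make_state_def read_bit_def emit_def
  by (intro primrec_intros)

section \<open>Soundness and completeness of the certificates\<close>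

definition extend :: "(real \<Rightarrow> real \<times> real) \<Rightarrow> real \<Rightarrow> real \<times> real" where
  "extend h s = h (max 0 (min 1 s)) + (s - max 0 (min 1 s), 0)"

definition path_diff :: "(real \<Rightarrow> real \<times> real) \<Rightarrow> (real \<Rightarrow> real \<times> real) \<Rightarrow> real \<times> real \<Rightarrow> complex" where
  "path_diff f g z = Complex (fst (f (fst z)) - fst (g (snd z))) (snd (f (fst z)) - snd (g (snd z)))"

lemma path_diff_eq_0_iff: "path_diff f g (s, t) = 0 \<longleftrightarrow> f s = g t"
  by (auto simp: path_diff_def complex_eq_iff prod_eq_iff)

lemma continuous_on_path_diff:
  assumes "continuous_on UNIV f" "continuous_on UNIV g"
  shows "continuous_on S (path_diff f g)"
  unfolding path_diff_def Complex_eq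
  by (intro continuous_intros continuous_on_compose2[OF assms(1)] continuous_on_compose2[OF assms(2)]) auto

lemma extend_eq: "s \<in> {0..1} \<Longrightarrow> extend h s = h s"
  by (simp add: extend_def zero_prod_def[symmetric])

lemma extend_left: "s \<le> 0 \<Longrightarrow> extend h s = h 0 + (s, 0)"
  by (simp add: extend_def)

lemma extend_right: "1 \<le> s \<Longrightarrow> extend h s = h 1 + (s - 1, 0)"
  by (simp add: extend_def)

lemma continuous_on_extend:
  assumes "continuous_on {0..1} h"
  shows "continuous_on UNIV (extend h)"
  unfolding extend_def by (intro continuous_intros continuous_on_compose2[OF assms]) auto

definition box_holds :: "(real \<Rightarrow> real \<times> real) \<Rightarrow> nat \<Rightarrow> bool" where
  "box_holds f P \<longleftrightarrow> lower (pfst P) \<le> upper (pfst P) \<and>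
     (\<forall>s\<in>{lower (pfst P)..upper (pfst P)}.
        lower (box_x P) < fst (f s) \<and> fst (f s) < upper (box_x P) \<and>
        lower (box_y P) < snd (f s) \<and> snd (f s) < upper (box_y P))"

lemma box_holdsD:
  assumes "box_holds f P" "s \<in> {lower (pfst P)..upper (pfst P)}"
  shows "lower (box_x P) < fst (f s)" "fst (f s) < upper (box_x P)"
    "lower (box_y P) < snd (f s)" "snd (f s) < upper (box_y P)"
  using assms unfolding box_holds_def by auto

text \<open>The boxes are open, so weak inequalities between their bounds become strict ones between
  the values.\<close>

lemma in_half_box_label:
  assumes "box_holds f P" "box_holds g Q" "box_label P Q \<noteq> 4"
    and "s \<in> {lower (pfst P)..upper (pfst P)}" "t \<in> {lower (pfst Q)..upper (pfst Q)}"
  shows "in_half (box_label P Q) (path_diff f g (s, t))"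
  using box_holdsD[OF assms(1,4)] box_holdsD[OF assms(2,5)] assms(3)
  by (auto simp: box_label_def in_half_simps[simplified] path_diff_def split: if_splits)

lemma rat_of_code_one: "rat_of_code rat_one = 1"
  by (simp add: rat_of_code_def int_decode_def sum_decode_def)

lemma subbasic_codes_iff:
  "P \<in> subbasic_codes f \<longleftrightarrow> 0 \<le> lower (pfst P) \<and> upper (pfst P) \<le> 1 \<and> box_holds f P"
proof -
  obtain i j k where P: "P = pair i (pair j k)"
    by (metis prod_decode_inverse surj_pair)
  show ?thesis
    unfolding P by (auto simp: subbasic_codes_def box_holds_def subset_iff mem_Times_iff simp del: split_paired_All)
qed

lemma box_holds_extend:
  assumes "{lower (pfst P)..upper (pfst P)} \<subseteq> {0..1}"
  shows "box_holds (extend h) P \<longleftrightarrow> box_holds h P"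
proof -
  have "extend h s = h s" if "s \<in> {lower (pfst P)..upper (pfst P)}" for s
    using that assms extend_eq by blast
  then show ?thesis by (simp add: box_holds_def)
qed

text \<open>\<open>known_box\<close> cannot verify a box whose interval straddles 0 or 1, where the
  path changes into its extension. Boxes are kept within one of the three parts.\<close>

definition region :: "nat \<Rightarrow> bool" where
  "region P \<longleftrightarrow> upper (pfst P) \<le> 0 \<or> 0 \<le> lower (pfst P) \<and> upper (pfst P) \<le> 1 \<or> 1 \<le> lower (pfst P)"

text \<open>On the collars the abscissa of the path equals its parameter, as
  \<open>fst (h 0) = 0\<close> and \<open>fst (h 1) = 1\<close>. There a box is checked by comparing
  rational numbers, without any input.\<close>

lemma known_box_sound:
  assumes "set (list_decode L) \<subseteq> subbasic_codes h" "fst (h 0) = 0" "fst (h 1) = 1"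
    "rat_of_code e = snd (h 0)" "rat_of_code e' = snd (h 1)" "known_box e e' L P"
  shows "box_holds (extend h) P"
proof (cases "P \<in> set (list_decode L)")
  case True
  then have "0 \<le> lower (pfst P)" "upper (pfst P) \<le> 1" "box_holds h P"
    using assms(1) subbasic_codes_iff by auto
  then show ?thesis by (subst box_holds_extend) auto
next
  case False
  then show ?thesis
    using assms(2-6) unfolding known_box_def box_holds_def
    by (auto simp: extend_left extend_right rat_of_code_one)
qed

lemma known_box_complete:
  assumes "box_holds (extend h) P" "region P" "fst (h 0) = 0" "fst (h 1) = 1"
    "rat_of_code e = snd (h 0)" "rat_of_code e' = snd (h 1)"
    "P \<in> subbasic_codes h \<Longrightarrow> P \<in> set (list_decode L)"
  shows "known_box e e' L P"
proof -
  let ?l = "lower (pfst P)" and ?u = "upper (pfst P)"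
  have le: "?l \<le> ?u" using assms(1) by (simp add: box_holds_def)
  note bl = box_holdsD[OF assms(1), of ?l] and bu = box_holdsD[OF assms(1), of ?u]
  consider "?u \<le> 0" | "0 \<le> ?l" "?u \<le> 1" | "1 \<le> ?l"
    using assms(2) by (auto simp: region_def)
  then show ?thesis
  proof cases
    case 1
    then show ?thesis
      using bl bu le assms(3,5) by (auto simp: known_box_def extend_left)
  next
    case 2
    then have "P \<in> subbasic_codes h"
      using assms(1) box_holds_extend[of P h] by (auto simp: subbasic_codes_iff)
    then show ?thesis using assms(7) by (simp add: known_box_def)
  next
    case 3
    then show ?thesis
      using bl bu le assms(4,6) by (auto simp: known_box_def extend_right rat_of_code_one)
  qed
qed

section \<open>Chains of boxes along a path\<close>

definition chain :: "(real \<Rightarrow> real \<times> real) \<Rightarrow> nat \<Rightarrow> nat \<Rightarrow> nat list \<Rightarrow> bool" where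
  "chain f a b ps \<longleftrightarrow> ps \<noteq> [] \<and> (\<forall>P\<in>set ps. box_holds f P) \<and>
     pfst (pfst (hd ps)) = a \<and> psnd (pfst (last ps)) = b \<and>
     (\<forall>i<length ps - 1. upper (pfst (ps ! i)) = lower (pfst (ps ! Suc i)))"

lemma chain_mesh:
  assumes "chain f a b ps"
  shows "\<exists>x. x 0 = rat_of_code a \<and> x (Suc (length ps - 1)) = rat_of_code b \<and>
    (\<forall>i\<le>length ps - 1. x i \<le> x (Suc i)) \<and>
    (\<forall>i\<le>length ps - 1.
      {x i..x (Suc i)} = {lower (pfst (ps ! i))..upper (pfst (ps ! i))} \<and> box_holds f (ps ! i))"
proof -
  define x where "x i = (if i < length ps then lower (pfst (ps ! i)) else rat_of_code b)" for i
  have ne: "ps \<noteq> []" using assms by (simp add: chain_def)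
  have cell: "x i = lower (pfst (ps ! i)) \<and> x (Suc i) = upper (pfst (ps ! i)) \<and> box_holds f (ps ! i)"
    if "i \<le> length ps - 1" for i
  proof -
    have i: "i < length ps" using that ne by (cases ps) auto
    then have box: "box_holds f (ps ! i)" using assms by (simp add: chain_def)
    show ?thesis
    proof (cases "Suc i < length ps")
      case True
      then show ?thesis using assms i box by (auto simp: chain_def x_def)
    next
      case False
      then have "i = length ps - 1" using i by simp
      then show ?thesis
        using assms i box by (auto simp: chain_def x_def last_conv_nth upper_def)
    qed
  qed
  have "x 0 = rat_of_code a" "x (Suc (length ps - 1)) = rat_of_code b"
    using assms ne by (auto simp: x_def chain_def hd_conv_nth lower_def)
  then show ?thesis
    using cell by (intro exI[of _ x]) (auto simp: box_holds_def)
qed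

lemma chains_odd_iff:
  assumes "chain f a b ps" "chain g c d qs" "continuous_on UNIV f" "continuous_on UNIV g"
    and lt: "rat_of_code a < rat_of_code b" "rat_of_code c < rat_of_code d"
    and lab: "\<And>i j. i < length ps \<Longrightarrow> j < length qs \<Longrightarrow>
        i = 0 \<or> i = length ps - 1 \<or> j = 0 \<or> j = length qs - 1 \<Longrightarrow> box_label (ps ! i) (qs ! j) \<noteq> 4"
  shows "odd_on (path_diff f g) (rat_of_code a) (rat_of_code b) (rat_of_code c) (rat_of_code d) \<longleftrightarrow>
      odd (flip_count (length ps - 1) (length qs - 1) (\<lambda>i j. box_label (ps ! i) (qs ! j)))" (is ?odd)
    and "\<And>z. z \<in> frame (rat_of_code a) (rat_of_code b) (rat_of_code c) (rat_of_code d) \<Longrightarrow>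
      path_diff f g z \<noteq> 0"
proof -
  have len: "length ps \<noteq> 0" "length qs \<noteq> 0" using assms(1,2) by (auto simp: chain_def)
  obtain x where x: "x 0 = rat_of_code a" "x (Suc (length ps - 1)) = rat_of_code b"
    "\<And>i. i \<le> length ps - 1 \<Longrightarrow> x i \<le> x (Suc i)"
    "\<And>i. i \<le> length ps - 1 \<Longrightarrow>
      {x i..x (Suc i)} = {lower (pfst (ps ! i))..upper (pfst (ps ! i))} \<and> box_holds f (ps ! i)"
    using chain_mesh[OF assms(1)] by blast
  obtain y where y: "y 0 = rat_of_code c" "y (Suc (length qs - 1)) = rat_of_code d"
    "\<And>i. i \<le> length qs - 1 \<Longrightarrow> y i \<le> y (Suc i)"
    "\<And>i. i \<le> length qs - 1 \<Longrightarrow>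
      {y i..y (Suc i)} = {lower (pfst (qs ! i))..upper (pfst (qs ! i))} \<and> box_holds g (qs ! i)"
    using chain_mesh[OF assms(2)] by blast
  have half: "in_half (box_label (ps ! i) (qs ! j)) (path_diff f g (s, t))"
    if "i \<le> length ps - 1" "j \<le> length qs - 1"
      "i = 0 \<or> i = length ps - 1 \<or> j = 0 \<or> j = length qs - 1"
      "s \<in> {x i..x (Suc i)}" "t \<in> {y j..y (Suc j)}" for i j s t
  proof -
    have "i < length ps" "j < length qs" using that(1,2) len by linarith+
    then show ?thesis
      using in_half_box_label[of f "ps ! i" g "qs ! j" s t] lab[of i j] x(4)[of i] y(4)[of j] that
      by blast
  qed
  show ?odd
    unfolding x(1,2)[symmetric] y(1,2)[symmetric]
    by (rule odd_on_iff_flip_count)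
      (use x(1-3) y(1-3) lt half continuous_on_path_diff[OF assms(3,4)] in auto)
  show "path_diff f g z \<noteq> 0"
    if z: "z \<in> frame (rat_of_code a) (rat_of_code b) (rat_of_code c) (rat_of_code d)" for z
    by (rule frame_nonzero[of "length ps - 1" x "length qs - 1" y
          "\<lambda>i j. box_label (ps ! i) (qs ! j)" "path_diff f g" z])
      (use x(1-3) y(1-3) half z in auto)
qed

lemma code_between:
  assumes "x < y"
  obtains c where "x < rat_of_code c" "rat_of_code c < y"
proof -
  obtain q where "x < real_of_rat q" "real_of_rat q < y" using of_rat_dense[OF assms] by blast
  then show ?thesis using that rat_of_code_surj by metis
qed

definition small_box :: "real \<Rightarrow> nat \<Rightarrow> bool" where
  "small_box e P \<longleftrightarrow> upper (box_x P) - lower (box_x P) < e \<and> upper (box_y P) - lower (box_y P) < e"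

definition fine_chain :: "real \<Rightarrow> (real \<Rightarrow> real \<times> real) \<Rightarrow> nat \<Rightarrow> nat \<Rightarrow> bool" where
  "fine_chain e f a b \<longleftrightarrow> (\<exists>ps. chain f a b ps \<and> (\<forall>P\<in>set ps. small_box e P \<and> region P))"

lemma fine_chain_trans:
  assumes "fine_chain e f a b" "fine_chain e f b c"
  shows "fine_chain e f a c"
proof -
  obtain ps qs where ps: "chain f a b ps" "\<forall>P\<in>set ps. small_box e P \<and> region P"
    and qs: "chain f b c qs" "\<forall>P\<in>set qs. small_box e P \<and> region P"
    using assms unfolding fine_chain_def by blast
  have "upper (pfst ((ps @ qs) ! i)) = lower (pfst ((ps @ qs) ! Suc i))"
    if "i < length (ps @ qs) - 1" for i
  proof -
    consider "i < length ps - 1" | "i = length ps - 1" "i < length ps" | "length ps \<le> i"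
      by linarith
    then show ?thesis
    proof cases
      case 1
      then show ?thesis using ps(1) by (auto simp: chain_def nth_append)
    next
      case 2
      have ne: "ps \<noteq> []" "qs \<noteq> []" using ps(1) qs(1) by (auto simp: chain_def)
      then have "(ps @ qs) ! i = last ps" "(ps @ qs) ! Suc i = hd qs"
        using 2 by (auto simp: nth_append last_conv_nth hd_conv_nth)
      then show ?thesis using ps(1) qs(1) by (simp add: chain_def upper_def lower_def)
    next
      case 3
      then show ?thesis using that qs(1) by (auto simp: chain_def nth_append Suc_diff_le)
    qed
  qed
  then have "chain f a c (ps @ qs)"
    using ps(1) qs(1) by (auto simp: chain_def)
  then show ?thesis
    using ps(2) qs(2) unfolding fine_chain_def by (metis Un_iff set_append)
qed

lemma fine_chain_single:
  assumes ab: "rat_of_code a \<le> rat_of_code b" "region (pair (pair a b) 0)" and e: "0 < e"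
    and close: "\<And>s. s \<in> {rat_of_code a..rat_of_code b} \<Longrightarrow> dist (f s) (f (rat_of_code a)) < e / 4"
  shows "fine_chain e f a b"
proof -
  define u v where "u = fst (f (rat_of_code a))" and "v = snd (f (rat_of_code a))"
  \<comment> \<open>The values stay within \<open>e / 4\<close> of \<open>(u, v)\<close> while the
    sides of the box lie between \<open>e / 4\<close> and \<open>e / 2\<close> away from it, so the
    box is correct and shorter than \<open>e\<close> in both directions.\<close>
  obtain j1 where j1: "u - e / 2 < rat_of_code j1" "rat_of_code j1 < u - e / 4"
    using code_between[of "u - e / 2" "u - e / 4"] e by auto
  obtain j2 where j2: "u + e / 4 < rat_of_code j2" "rat_of_code j2 < u + e / 2"
    using code_between[of "u + e / 4" "u + e / 2"] e by auto
  obtain k1 where k1: "v - e / 2 < rat_of_code k1" "rat_of_code k1 < v - e / 4"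
    using code_between[of "v - e / 2" "v - e / 4"] e by auto
  obtain k2 where k2: "v + e / 4 < rat_of_code k2" "rat_of_code k2 < v + e / 2"
    using code_between[of "v + e / 4" "v + e / 2"] e by auto
  define P where "P = pair (pair a b) (pair (pair j1 j2) (pair k1 k2))"
  have "\<bar>fst (f s) - u\<bar> < e / 4 \<and> \<bar>snd (f s) - v\<bar> < e / 4"
    if "s \<in> {rat_of_code a..rat_of_code b}" for s
    using close[OF that] dist_fst_le[of "f s" "f (rat_of_code a)"] dist_snd_le[of "f s" "f (rat_of_code a)"]
    by (simp add: u_def v_def dist_real_def)
  then have "rat_of_code j1 < fst (f s) \<and> fst (f s) < rat_of_code j2 \<and>
      rat_of_code k1 < snd (f s) \<and> snd (f s) < rat_of_code k2"
    if "s \<in> {rat_of_code a..rat_of_code b}" for s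
    using that j1 j2 k1 k2 by (smt (verit))
  then have "box_holds f P"
    using ab(1) by (auto simp: box_holds_def P_def lower_def upper_def)
  then have "chain f a b [P]"
    by (simp add: chain_def P_def)
  moreover have "small_box e P" "region P"
    using j1 j2 k1 k2 ab(2) by (auto simp: small_box_def P_def region_def lower_def upper_def)
  ultimately show ?thesis
    unfolding fine_chain_def by (intro exI[of _ "[P]"]) simp
qed

lemma fine_chain_in_region:
  assumes f: "continuous_on UNIV f" and e: "0 < e"
    and ab: "rat_of_code a \<le> rat_of_code b" "region (pair (pair a b) 0)"
  shows "fine_chain e f a b"
proof -
  let ?I = "{rat_of_code a..rat_of_code b}"
  have "uniformly_continuous_on ?I f"
    by (intro compact_uniformly_continuous continuous_on_subset[OF f]) auto
  then obtain d where d: "d > 0" "\<And>s t. s \<in> ?I \<Longrightarrow> t \<in> ?I \<Longrightarrow> dist s t < d \<Longrightarrow> dist (f s) (f t) < e / 4"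
    using e unfolding uniformly_continuous_on_def
    by (metis divide_pos_pos zero_less_numeral)
  have reg: "region (pair (pair a' b') 0)"
    if "rat_of_code a \<le> rat_of_code a'" "rat_of_code b' \<le> rat_of_code b"
       "rat_of_code a' \<le> rat_of_code b'" for a' b'
    using ab(2) that by (auto simp: region_def lower_def upper_def)
  \<comment> \<open>Induction on the number of steps that remain: each box advances by more than
    \<open>d / 2\<close>, which bounds their number, and by less than \<open>d\<close>, which keeps
    them small.\<close>
  have "fine_chain e f a' b"
    if "rat_of_code a \<le> rat_of_code a'" "rat_of_code a' \<le> rat_of_code b"
      "rat_of_code b - rat_of_code a' < real n * (d / 2)" for a' n
    using that
  proof (induction n arbitrary: a')
    case (Suc n)
    show ?case
    proof (cases "rat_of_code b - rat_of_code a' < d")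
      case True
      show ?thesis
        by (rule fine_chain_single[OF Suc.prems(2) reg e]) (use Suc.prems True d in \<open>auto simp: dist_real_def\<close>)
    next
      case False
      obtain c where c: "rat_of_code a' + d / 2 < rat_of_code c" "rat_of_code c < rat_of_code a' + d"
        using code_between[of "rat_of_code a' + d / 2" "rat_of_code a' + d"] d(1) by auto
      have "fine_chain e f a' c"
        by (rule fine_chain_single[OF _ reg e]) (use Suc.prems False c d in \<open>auto simp: dist_real_def\<close>)
      moreover have "fine_chain e f c b"
        by (rule Suc.IH) (use Suc.prems False c d(1) in \<open>auto simp: algebra_simps\<close>)
      ultimately show ?thesis by (rule fine_chain_trans)
    qed
  qed simp
  moreover obtain n where "rat_of_code b - rat_of_code a < real n * (d / 2)"
    using reals_Archimedean3[of "d / 2"] d(1) by (meson half_gt_zero)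
  ultimately show ?thesis
    using ab(1) by blast
qed

text \<open>Breaking the interval at 0 and 1 places every box in one region.\<close>

lemma fine_chain_exists:
  assumes f: "continuous_on UNIV f" and e: "0 < e" and ab: "rat_of_code a \<le> rat_of_code b"
  shows "fine_chain e f a b"
proof -
  note step = fine_chain_in_region[OF f e]
  have right: "fine_chain e f a b" if "0 \<le> rat_of_code a" "rat_of_code a \<le> rat_of_code b" for a
  proof (cases "1 \<le> rat_of_code a \<or> rat_of_code b \<le> 1")
    case True
    then show ?thesis
      using that by (intro step) (auto simp: region_def lower_def upper_def)
  next
    case False
    show ?thesis
      by (rule fine_chain_trans[of e f a rat_one]; rule step)
        (use that False in \<open>auto simp: region_def lower_def upper_def rat_of_code_one\<close>)
  qed
  consider "0 \<le> rat_of_code a" | "rat_of_code b \<le> 0" | "rat_of_code a < 0" "0 < rat_of_code b"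
    by linarith
  then show ?thesis
  proof cases
    case 1
    then show ?thesis using right ab by blast
  next
    case 2
    then show ?thesis
      using ab by (intro step) (auto simp: region_def lower_def upper_def)
  next
    case 3
    then have "fine_chain e f a 0"
      by (intro step) (auto simp: region_def lower_def upper_def)
    then show ?thesis
      using right[of 0] 3 by (intro fine_chain_trans[of e f a 0 b]) auto
  qed
qed

text \<open>By compactness the larger of the two coordinate distances is at least some
  \<open>e > 0\<close> on \<open>Z\<close>. Boxes with sides below \<open>e / 2\<close> are then
  disjoint in one coordinate, and the label tells in which.\<close>

lemma separating_chains:
  assumes f: "continuous_on UNIV f" and g: "continuous_on UNIV g"
    and Z: "compact Z" "\<And>z. z \<in> Z \<Longrightarrow> path_diff f g z \<noteq> 0"
    and le: "rat_of_code a \<le> rat_of_code b" "rat_of_code c \<le> rat_of_code d"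
  shows "\<exists>ps qs. chain f a b ps \<and> chain g c d qs \<and>
    (\<forall>P\<in>set ps. region P) \<and> (\<forall>Q\<in>set qs. region Q) \<and>
    (\<forall>P\<in>set ps. \<forall>Q\<in>set qs. \<forall>(s, t)\<in>Z.
      s \<in> {lower (pfst P)..upper (pfst P)} \<longrightarrow> t \<in> {lower (pfst Q)..upper (pfst Q)} \<longrightarrow>
      box_label P Q \<noteq> 4)"
proof -
  let ?F = "path_diff f g"
  obtain e where e: "e > 0" "\<And>z. z \<in> Z \<Longrightarrow> e \<le> max \<bar>Re (?F z)\<bar> \<bar>Im (?F z)\<bar>"
  proof (cases "Z = {}")
    case True
    then show ?thesis using that[of 1] by auto
  next
    case False
    have "continuous_on Z (\<lambda>z. max \<bar>Re (?F z)\<bar> \<bar>Im (?F z)\<bar>)"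
      by (intro continuous_intros continuous_on_path_diff f g)
    from continuous_attains_inf[OF Z(1) False this] obtain z0 where z0: "z0 \<in> Z"
      "\<And>z. z \<in> Z \<Longrightarrow> max \<bar>Re (?F z0)\<bar> \<bar>Im (?F z0)\<bar> \<le> max \<bar>Re (?F z)\<bar> \<bar>Im (?F z)\<bar>"
      by blast
    have "max \<bar>Re (?F z0)\<bar> \<bar>Im (?F z0)\<bar> > 0"
      using Z(2)[OF z0(1)] by (auto simp: complex_eq_iff max_def)
    then show ?thesis using that z0(2) by blast
  qed
  have half: "0 < e / 2" using e(1) by simp
  obtain ps qs where ps: "chain f a b ps" "\<forall>P\<in>set ps. small_box (e / 2) P \<and> region P"
    and qs: "chain g c d qs" "\<forall>P\<in>set qs. small_box (e / 2) P \<and> region P"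
    using fine_chain_exists[OF f half le(1)] fine_chain_exists[OF g half le(2)]
    unfolding fine_chain_def by blast
  have "box_label P Q \<noteq> 4"
    if P: "P \<in> set ps" and Q: "Q \<in> set qs" and "(s, t) \<in> Z"
      and s: "s \<in> {lower (pfst P)..upper (pfst P)}" and t: "t \<in> {lower (pfst Q)..upper (pfst Q)}"
    for P Q s t
  proof -
    have "box_holds f P" "box_holds g Q"
      using ps(1) qs(1) P Q by (auto simp: chain_def)
    note f = box_holdsD[OF this(1) s] and g = box_holdsD[OF this(2) t]
    have "e \<le> \<bar>fst (f s) - fst (g t)\<bar> \<or> e \<le> \<bar>snd (f s) - snd (g t)\<bar>"
      using e(2)[OF \<open>(s, t) \<in> Z\<close>] by (auto simp: path_diff_def le_max_iff_disj)
    moreover have "small_box (e / 2) P" "small_box (e / 2) Q"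
      using ps(2) qs(2) P Q by auto
    ultimately show ?thesis
      using f g unfolding box_label_def small_box_def by (auto split: if_splits)
  qed
  then show ?thesis
    using ps qs by blast
qed

lemma known_chain_sound:
  assumes "known_chain e e' L c" "\<And>P. known_box e e' L P \<Longrightarrow> box_holds f P"
  shows "chain f (chain_start c) (chain_end c) (list_decode c)"
proof -
  have len: "list_decode c \<noteq> []"
    using assms(1) by (auto simp: known_chain_def code_length_eq)
  have "box_holds f P" if P: "P \<in> set (list_decode c)" for P
  proof -
    obtain i where "i < length (list_decode c)" "list_decode c ! i = P"
      using P by (auto simp: in_set_conv_nth)
    then show ?thesis
      using assms by (auto simp: known_chain_def code_length_eq code_nth_eq)
  qed
  moreover have "upper (pfst (list_decode c ! i)) = lower (pfst (list_decode c ! Suc i))"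
    if "i < length (list_decode c) - 1" for i
    using assms(1) that by (force simp: known_chain_def code_length_eq code_nth_eq)
  ultimately show ?thesis
    using len by (auto simp: chain_def chain_start_def chain_end_def code_length_eq code_nth_eq
        hd_conv_nth last_conv_nth)
qed

lemma known_chain_complete:
  assumes "chain f a b ps" "\<And>P. P \<in> set ps \<Longrightarrow> known_box e e' L P"
  shows "known_chain e e' L (list_encode ps)"
  using assms by (auto simp: known_chain_def chain_def code_length_eq code_nth_eq)

lemma chain_ends:
  assumes "chain f a b ps"
  shows "chain_start (list_encode ps) = a" "chain_end (list_encode ps) = b"
  using assms by (auto simp: chain_def chain_start_def chain_end_def code_length_eq code_nth_eq
      hd_conv_nth last_conv_nth)

lemma eventually_list:
  assumes "\<And>P. P \<in> set ps \<Longrightarrow> \<exists>N::nat. \<forall>n\<ge>N. Q n P"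
  shows "\<exists>N. \<forall>n\<ge>N. \<forall>P\<in>set ps. Q n P"
  using assms
proof (induction ps)
  case (Cons P ps)
  then obtain N M where "\<forall>n\<ge>N. Q n P" "\<forall>n\<ge>M. \<forall>P\<in>set ps. Q n P"
    by (metis list.set_intros)
  then have "\<forall>n\<ge>max N M. \<forall>P\<in>set (P # ps). Q n P" by auto
  then show ?case by blast
qed simp

text \<open>The codes \<open>pair 1 0\<close> and \<open>pair 4 0\<close> stand for -1 and 2; the
  final 0 decodes to mode 0 and counter 0.\<close>

definition initial_state :: nat where
  "initial_state = pair (pair (pair (pair 1 0) (pair 4 0)) (pair (pair 1 0) (pair 4 0))) 0"

lemma initial_interval: "lower (pair (pair 1 0) (pair 4 0)) = -1" "upper (pair (pair 1 0) (pair 4 0)) = 2"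
  by (simp_all add: lower_def upper_def rat_of_code_def int_decode_def sum_decode_def)

text \<open>The run is studied apart from the machine: the lists of codes read by time
  \<open>n\<close> may grow at any pace, as long as they are correct and every code is present from
  some time on.\<close>

locale crossing_run =
  fixes \<phi> \<psi> :: "real \<Rightarrow> real \<times> real" and L K Y :: "nat \<Rightarrow> nat"
  assumes crossing: "(\<phi>, \<psi>) \<in> crossing_paths"
    and L_sound: "\<And>n. set (list_decode (L n)) \<subseteq> subbasic_codes \<phi>"
    and L_complete: "\<And>P. P \<in> subbasic_codes \<phi> \<Longrightarrow> \<exists>N. \<forall>n\<ge>N. P \<in> set (list_decode (L n))"
    and K_sound: "\<And>n. set (list_decode (K n)) \<subseteq> subbasic_codes \<psi>"
    and K_complete: "\<And>P. P \<in> subbasic_codes \<psi> \<Longrightarrow> \<exists>N. \<forall>n\<ge>N. P \<in> set (list_decode (K n))"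
    and Y_0: "Y 0 = initial_state"
    and Y_Suc: "\<And>n. Y (Suc n) = refine n (L n) (K n) (Y n)"
begin

definition f where "f = extend \<phi>"
definition g where "g = extend \<psi>"
abbreviation "F \<equiv> path_diff f g"

definition "R n = pfst (Y n)"
definition "mode n = pfst (psnd (Y n))"
definition "visits n = psnd (psnd (Y n))"

lemma ends: "\<phi> 0 = (0, 0)" "\<phi> 1 = (1, 1)" "\<psi> 0 = (0, 1)" "\<psi> 1 = (1, 0)"
  using crossing by (auto simp: crossing_paths_def)

lemma continuous_f: "continuous_on UNIV f" and continuous_g: "continuous_on UNIV g"
  using crossing unfolding f_def g_def crossing_paths_def path_def
  by (auto intro: continuous_on_extend)

lemma in_square:
  assumes "s \<in> {0..1}"
  shows "fst (f s) \<in> {0..1}" "snd (f s) \<in> {0..1}" "fst (g s) \<in> {0..1}" "snd (g s) \<in> {0..1}"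
proof -
  have "\<phi> s \<in> {0..1} \<times> {0..1}" "\<psi> s \<in> {0..1} \<times> {0..1}"
    using crossing assms unfolding crossing_paths_def path_image_def by blast+
  then show "fst (f s) \<in> {0..1}" "snd (f s) \<in> {0..1}" "fst (g s) \<in> {0..1}" "snd (g s) \<in> {0..1}"
    using assms by (auto simp: f_def g_def extend_eq mem_Times_iff)
qed

lemma outside:
  "s \<le> 0 \<Longrightarrow> f s = (s, 0)" "1 \<le> s \<Longrightarrow> f s = (s, 1)"
  "s \<le> 0 \<Longrightarrow> g s = (s, 1)" "1 \<le> s \<Longrightarrow> g s = (s, 0)"
  by (simp_all add: f_def g_def extend_left extend_right ends)

section \<open>Certificates relative to the codes read so far\<close>

lemma known_box_f: "known_box 0 rat_one (L n) P \<Longrightarrow> box_holds f P"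
  unfolding f_def by (rule known_box_sound[OF L_sound]) (auto simp: ends rat_of_code_one)

lemma known_box_g: "known_box rat_one 0 (K n) P \<Longrightarrow> box_holds g P"
  unfolding g_def by (rule known_box_sound[OF K_sound]) (auto simp: ends rat_of_code_one)

lemma chain_f:
  "known_chain 0 rat_one (L n) c \<Longrightarrow> chain f (chain_start c) (chain_end c) (list_decode c)"
  by (rule known_chain_sound[OF _ known_box_f])

lemma chain_g:
  "known_chain rat_one 0 (K n) c \<Longrightarrow> chain g (chain_start c) (chain_end c) (list_decode c)"
  by (rule known_chain_sound[OF _ known_box_g])

lemma eventually_known_f:
  assumes "chain f a b ps" "\<And>P. P \<in> set ps \<Longrightarrow> region P"
  shows "\<exists>N. \<forall>n\<ge>N. known_chain 0 rat_one (L n) (list_encode ps)"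
proof -
  have "\<exists>N. \<forall>n\<ge>N. known_box 0 rat_one (L n) P" if P: "P \<in> set ps" for P
  proof -
    have "box_holds (extend \<phi>) P" using assms(1) P by (simp add: chain_def f_def)
    then have "known_box 0 rat_one (L n) P" if "P \<in> subbasic_codes \<phi> \<Longrightarrow> P \<in> set (list_decode (L n))" for n
      by (rule known_box_complete[OF _ assms(2)[OF P]]) (auto simp: ends rat_of_code_one that)
    moreover obtain N where "\<forall>n\<ge>N. P \<in> subbasic_codes \<phi> \<longrightarrow> P \<in> set (list_decode (L n))"
      using L_complete[of P] by blast
    ultimately show ?thesis by blast
  qed
  from eventually_list[where Q = "\<lambda>n. known_box 0 rat_one (L n)", OF this] obtain N
    where "\<forall>n\<ge>N. \<forall>P\<in>set ps. known_box 0 rat_one (L n) P" by blast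
  then show ?thesis
    using known_chain_complete[OF assms(1)] by (intro exI[of _ N]) simp
qed

lemma eventually_known_g:
  assumes "chain g a b ps" "\<And>P. P \<in> set ps \<Longrightarrow> region P"
  shows "\<exists>N. \<forall>n\<ge>N. known_chain rat_one 0 (K n) (list_encode ps)"
proof -
  have "\<exists>N. \<forall>n\<ge>N. known_box rat_one 0 (K n) P" if P: "P \<in> set ps" for P
  proof -
    have "box_holds (extend \<psi>) P" using assms(1) P by (simp add: chain_def g_def)
    then have "known_box rat_one 0 (K n) P" if "P \<in> subbasic_codes \<psi> \<Longrightarrow> P \<in> set (list_decode (K n))" for n
      by (rule known_box_complete[OF _ assms(2)[OF P]]) (auto simp: ends rat_of_code_one that)
    moreover obtain N where "\<forall>n\<ge>N. P \<in> subbasic_codes \<psi> \<longrightarrow> P \<in> set (list_decode (K n))"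
      using K_complete[of P] by blast
    ultimately show ?thesis by blast
  qed
  from eventually_list[where Q = "\<lambda>n. known_box rat_one 0 (K n)", OF this] obtain N
    where "\<forall>n\<ge>N. \<forall>P\<in>set ps. known_box rat_one 0 (K n) P" by blast
  then show ?thesis
    using known_chain_complete[OF assms(1)] by (intro exI[of _ N]) simp
qed

text \<open>\<open>odd_on\<close> speaks about a winding number only if the frame carries no zeros,
  and without this no separated boxes along the frame could be found.\<close>

definition good :: "nat \<Rightarrow> bool" where
  "good Q \<longleftrightarrow> lower (pfst Q) < upper (pfst Q) \<and> lower (psnd Q) < upper (psnd Q) \<and>
     odd_on F (lower (pfst Q)) (upper (pfst Q)) (lower (psnd Q)) (upper (psnd Q)) \<and>
     (\<forall>z\<in>frame (lower (pfst Q)) (upper (pfst Q)) (lower (psnd Q)) (upper (psnd Q)). F z \<noteq> 0)"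

definition rectangle :: "nat \<Rightarrow> (real \<times> real) set" where
  "rectangle Q = {lower (pfst Q)..upper (pfst Q)} \<times> {lower (psnd Q)..upper (psnd Q)}"

lemma odd_cert_sound:
  assumes cert: "odd_cert (L n) (K n) Q c"
    and lt: "lower (pfst Q) < upper (pfst Q)" "lower (psnd Q) < upper (psnd Q)"
  shows "good Q"
proof -
  let ?ps = "list_decode (pfst c)" and ?qs = "list_decode (psnd c)"
  have ch: "chain f (pfst (pfst Q)) (psnd (pfst Q)) ?ps" "chain g (pfst (psnd Q)) (psnd (psnd Q)) ?qs"
    using chain_f[of n "pfst c"] chain_g[of n "psnd c"] cert by (auto simp: odd_cert_def)
  have lab: "box_label (?ps ! i) (?qs ! j) \<noteq> 4"
    if "i < length ?ps" "j < length ?qs" "i = 0 \<or> i = length ?ps - 1 \<or> j = 0 \<or> j = length ?qs - 1" for i j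
    using cert that unfolding odd_cert_def by (auto simp: code_length_eq code_nth_eq)
  have "flip_count (length ?ps - 1) (length ?qs - 1) (\<lambda>i j. box_label (?ps ! i) (?qs ! j)) =
      flip_count (code_length (pfst c) - 1) (code_length (psnd c) - 1)
        (\<lambda>i j. box_label (code_nth (pfst c) i) (code_nth (psnd c) j))"
    using ch unfolding flip_count_def
    by (intro arg_cong2[where f = "(+)"] sum.cong) (auto simp: code_length_eq code_nth_eq chain_def)
  then have odd: "odd (flip_count (length ?ps - 1) (length ?qs - 1) (\<lambda>i j. box_label (?ps ! i) (?qs ! j)))"
    using cert by (simp add: odd_cert_def)
  note iff = chains_odd_iff[OF ch continuous_f continuous_g lt[unfolded lower_def upper_def] lab]
  show ?thesis
    using iff odd lt by (simp add: good_def lower_def upper_def)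
qed

lemma compact_frame: "compact (frame a b c d)"
  unfolding frame_def by (intro compact_Un compact_Times) auto

lemma odd_cert_complete:
  assumes "good Q"
  shows "\<exists>N. \<forall>n\<ge>N. \<exists>c<n. odd_cert (L n) (K n) Q c"
proof -
  let ?a = "pfst (pfst Q)" and ?b = "psnd (pfst Q)" and ?c = "pfst (psnd Q)" and ?d = "psnd (psnd Q)"
  let ?fr = "frame (rat_of_code ?a) (rat_of_code ?b) (rat_of_code ?c) (rat_of_code ?d)"
  have lt: "rat_of_code ?a < rat_of_code ?b" "rat_of_code ?c < rat_of_code ?d"
    and odd: "odd_on F (rat_of_code ?a) (rat_of_code ?b) (rat_of_code ?c) (rat_of_code ?d)"
    and nz: "\<And>z. z \<in> ?fr \<Longrightarrow> F z \<noteq> 0"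
    using assms by (auto simp: good_def lower_def upper_def)
  obtain ps qs where ps: "chain f ?a ?b ps" "\<And>P. P \<in> set ps \<Longrightarrow> region P"
    and qs: "chain g ?c ?d qs" "\<And>Q. Q \<in> set qs \<Longrightarrow> region Q"
    and sep: "\<And>P Q s t. P \<in> set ps \<Longrightarrow> Q \<in> set qs \<Longrightarrow> (s, t) \<in> ?fr \<Longrightarrow>
      s \<in> {lower (pfst P)..upper (pfst P)} \<Longrightarrow> t \<in> {lower (pfst Q)..upper (pfst Q)} \<Longrightarrow>
      box_label P Q \<noteq> 4"
    using separating_chains[where Z = ?fr, OF continuous_f continuous_g compact_frame nz
        less_imp_le[OF lt(1)] less_imp_le[OF lt(2)]] by blast
  have ne: "ps \<noteq> []" "qs \<noteq> []" using ps(1) qs(1) by (auto simp: chain_def)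
  have lab: "box_label (ps ! i) (qs ! j) \<noteq> 4"
    if ij: "i < length ps" "j < length qs" "i = 0 \<or> i = length ps - 1 \<or> j = 0 \<or> j = length qs - 1" for i j
  proof -
    obtain x where x: "x 0 = rat_of_code ?a" "x (Suc (length ps - 1)) = rat_of_code ?b"
      "\<And>i. i \<le> length ps - 1 \<Longrightarrow> x i \<le> x (Suc i)"
      "\<And>i. i \<le> length ps - 1 \<Longrightarrow>
        {x i..x (Suc i)} = {lower (pfst (ps ! i))..upper (pfst (ps ! i))} \<and> box_holds f (ps ! i)"
      using chain_mesh[OF ps(1)] by blast
    obtain y where y: "y 0 = rat_of_code ?c" "y (Suc (length qs - 1)) = rat_of_code ?d"
      "\<And>i. i \<le> length qs - 1 \<Longrightarrow> y i \<le> y (Suc i)"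
      "\<And>i. i \<le> length qs - 1 \<Longrightarrow>
        {y i..y (Suc i)} = {lower (pfst (qs ! i))..upper (pfst (qs ! i))} \<and> box_holds g (qs ! i)"
      using chain_mesh[OF qs(1)] by blast
    have i: "i \<le> length ps - 1" and j: "j \<le> length qs - 1" using ij by linarith+
    have bx: "x 0 \<le> x i" "x (Suc i) \<le> x (Suc (length ps - 1))" "x i \<le> x (Suc i)"
      using mesh_mono[of "length ps - 1" x] x(3) i by auto
    have by': "y 0 \<le> y j" "y (Suc j) \<le> y (Suc (length qs - 1))" "y j \<le> y (Suc j)"
      using mesh_mono[of "length qs - 1" y] y(3) j by auto
    \<comment> \<open>Every outermost cell contains a point of the frame, so \<open>sep\<close>,
      which is available only at such points, yields its label.\<close>
    have "\<exists>s\<in>{x i..x (Suc i)}. \<exists>t\<in>{y j..y (Suc j)}. (s, t) \<in> ?fr"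
    proof -
      consider "i = 0" | "i = length ps - 1" | "j = 0" | "j = length qs - 1" using ij(3) by blast
      then show ?thesis
      proof cases
        case 1
        then show ?thesis
          by (intro bexI[of _ "x i"] bexI[of _ "y j"]) (use bx by' x(1,2) y(1,2) in \<open>auto simp: frame_def\<close>)
      next
        case 2
        then show ?thesis
          by (intro bexI[of _ "x (Suc i)"] bexI[of _ "y j"]) (use bx by' x(1,2) y(1,2) in \<open>auto simp: frame_def\<close>)
      next
        case 3
        then show ?thesis
          by (intro bexI[of _ "x i"] bexI[of _ "y j"]) (use bx by' x(1,2) y(1,2) in \<open>auto simp: frame_def\<close>)
      next
        case 4
        then show ?thesis
          by (intro bexI[of _ "x i"] bexI[of _ "y (Suc j)"]) (use bx by' x(1,2) y(1,2) in \<open>auto simp: frame_def\<close>)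
      qed
    qed
    then show ?thesis
      using sep[of "ps ! i" "qs ! j"] ij(1,2) x(4)[OF i] y(4)[OF j] by (metis nth_mem)
  qed
  have flips: "odd (flip_count (length ps - 1) (length qs - 1) (\<lambda>i j. box_label (ps ! i) (qs ! j)))"
    using chains_odd_iff(1)[OF ps(1) qs(1) continuous_f continuous_g lt lab] odd by blast
  let ?cert = "pair (list_encode ps) (list_encode qs)"
  have "flip_count (length ps - 1) (length qs - 1)
        (\<lambda>i j. box_label (code_nth (list_encode ps) i) (code_nth (list_encode qs) j)) =
      flip_count (length ps - 1) (length qs - 1) (\<lambda>i j. box_label (ps ! i) (qs ! j))"
    using ne unfolding flip_count_def
    by (intro arg_cong2[where f = "(+)"] sum.cong) (auto simp: code_nth_eq)
  then have "odd_cert (L n) (K n) Q ?cert"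
    if "known_chain 0 rat_one (L n) (list_encode ps)" "known_chain rat_one 0 (K n) (list_encode qs)" for n
    using that flips lab chain_ends[OF ps(1)] chain_ends[OF qs(1)] unfolding odd_cert_def
    by (auto simp: code_length_eq code_nth_eq)
  moreover obtain N M where "\<forall>n\<ge>N. known_chain 0 rat_one (L n) (list_encode ps)"
    "\<forall>n\<ge>M. known_chain rat_one 0 (K n) (list_encode qs)"
    using eventually_known_f[OF ps] eventually_known_g[OF qs] by blast
  ultimately show ?thesis
    \<comment> \<open>The time \<open>n\<close> also bounds the search for certificates, hence
      \<open>Suc ?cert\<close>.\<close>
    by (intro exI[of _ "max (max N M) (Suc ?cert)"]) (auto intro!: exI[of _ ?cert])
qed

lemma separation_cert_sound:
  assumes cert: "separation_cert (L n) (K n) Q c" and z: "z \<in> rectangle Q"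
  shows "F z \<noteq> 0"
proof -
  let ?ps = "list_decode (pfst c)" and ?qs = "list_decode (psnd c)"
  obtain s t where st: "z = (s, t)" by (cases z)
  have ch: "chain f (chain_start (pfst c)) (chain_end (pfst c)) ?ps"
    "chain g (chain_start (psnd c)) (chain_end (psnd c)) ?qs"
    using chain_f[of n "pfst c"] chain_g[of n "psnd c"] cert by (auto simp: separation_cert_def)
  obtain x where x: "x 0 = rat_of_code (chain_start (pfst c))"
    "x (Suc (length ?ps - 1)) = rat_of_code (chain_end (pfst c))"
    "\<And>i. i \<le> length ?ps - 1 \<Longrightarrow> x i \<le> x (Suc i)"
    "\<And>i. i \<le> length ?ps - 1 \<Longrightarrow>
      {x i..x (Suc i)} = {lower (pfst (?ps ! i))..upper (pfst (?ps ! i))} \<and> box_holds f (?ps ! i)"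
    using chain_mesh[OF ch(1)] by blast
  obtain y where y: "y 0 = rat_of_code (chain_start (psnd c))"
    "y (Suc (length ?qs - 1)) = rat_of_code (chain_end (psnd c))"
    "\<And>i. i \<le> length ?qs - 1 \<Longrightarrow> y i \<le> y (Suc i)"
    "\<And>i. i \<le> length ?qs - 1 \<Longrightarrow>
      {y i..y (Suc i)} = {lower (pfst (?qs ! i))..upper (pfst (?qs ! i))} \<and> box_holds g (?qs ! i)"
    using chain_mesh[OF ch(2)] by blast
  have "s \<in> {x 0..x (Suc (length ?ps - 1))}" "t \<in> {y 0..y (Suc (length ?qs - 1))}"
    using z cert unfolding separation_cert_def x(1,2) y(1,2) by (auto simp: rectangle_def st)
  then obtain i j where ij: "i \<le> length ?ps - 1" "s \<in> {x i..x (Suc i)}"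
    "j \<le> length ?qs - 1" "t \<in> {y j..y (Suc j)}"
    using mesh_cover by blast
  moreover have "length ?ps \<noteq> 0" "length ?qs \<noteq> 0" using ch by (auto simp: chain_def)
  ultimately have lt: "i < length ?ps" "j < length ?qs" by linarith+
  then have "box_label (?ps ! i) (?qs ! j) \<noteq> 4"
    using cert unfolding separation_cert_def by (auto simp: code_length_eq code_nth_eq)
  then show ?thesis
    using in_half_box_label[of f "?ps ! i" g "?qs ! j" s t] x(4)[OF ij(1)] y(4)[OF ij(3)] ij
      in_half_nonzero unfolding st by blast
qed

text \<open>The time \<open>N\<close> is the same for all parts \<open>Q'\<close> of
  \<open>Q\<close>; the rectangle may have shrunk by the time the cut is examined again.\<close>

lemma separation_cert_complete:
  assumes le: "lower (pfst Q) \<le> upper (pfst Q)" "lower (psnd Q) \<le> upper (psnd Q)"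
    and nz: "\<And>z. z \<in> rectangle Q \<Longrightarrow> F z \<noteq> 0"
  shows "\<exists>N. \<forall>n\<ge>N. \<forall>Q'. lower (pfst Q) \<le> lower (pfst Q') \<and> upper (pfst Q') \<le> upper (pfst Q) \<and>
     lower (psnd Q) \<le> lower (psnd Q') \<and> upper (psnd Q') \<le> upper (psnd Q) \<longrightarrow>
     (\<exists>c<n. separation_cert (L n) (K n) Q' c)"
proof -
  have "compact (rectangle Q)"
    unfolding rectangle_def by (intro compact_Times) auto
  from separating_chains[OF continuous_f continuous_g this nz le[unfolded lower_def upper_def]]
  obtain ps qs where ps: "chain f (pfst (pfst Q)) (psnd (pfst Q)) ps" "\<And>P. P \<in> set ps \<Longrightarrow> region P"
    and qs: "chain g (pfst (psnd Q)) (psnd (psnd Q)) qs" "\<And>Q. Q \<in> set qs \<Longrightarrow> region Q"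
    and sep: "\<And>P Q' s t. P \<in> set ps \<Longrightarrow> Q' \<in> set qs \<Longrightarrow> (s, t) \<in> rectangle Q \<Longrightarrow>
      s \<in> {lower (pfst P)..upper (pfst P)} \<Longrightarrow> t \<in> {lower (pfst Q')..upper (pfst Q')} \<Longrightarrow>
      box_label P Q' \<noteq> 4"
    by blast
  have lab: "box_label (ps ! i) (qs ! j) \<noteq> 4"
    if ij: "i < length ps" "j < length qs" for i j
  proof -
    obtain x where x: "x 0 = lower (pfst Q)" "x (Suc (length ps - 1)) = upper (pfst Q)"
      "\<And>i. i \<le> length ps - 1 \<Longrightarrow> x i \<le> x (Suc i)"
      "\<And>i. i \<le> length ps - 1 \<Longrightarrow>
        {x i..x (Suc i)} = {lower (pfst (ps ! i))..upper (pfst (ps ! i))} \<and> box_holds f (ps ! i)"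
      using chain_mesh[OF ps(1)] unfolding lower_def[of "pfst Q"] upper_def[of "pfst Q"] by blast
    obtain y where y: "y 0 = lower (psnd Q)" "y (Suc (length qs - 1)) = upper (psnd Q)"
      "\<And>i. i \<le> length qs - 1 \<Longrightarrow> y i \<le> y (Suc i)"
      "\<And>i. i \<le> length qs - 1 \<Longrightarrow>
        {y i..y (Suc i)} = {lower (pfst (qs ! i))..upper (pfst (qs ! i))} \<and> box_holds g (qs ! i)"
      using chain_mesh[OF qs(1)] unfolding lower_def[of "psnd Q"] upper_def[of "psnd Q"] by blast
    have i: "i \<le> length ps - 1" and j: "j \<le> length qs - 1" using ij by linarith+
    have bx: "x 0 \<le> x i" "x (Suc i) \<le> x (Suc (length ps - 1))" "x i \<le> x (Suc i)"
      using mesh_mono[of "length ps - 1" x] x(3) i by auto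
    have by': "y 0 \<le> y j" "y (Suc j) \<le> y (Suc (length qs - 1))" "y j \<le> y (Suc j)"
      using mesh_mono[of "length qs - 1" y] y(3) j by auto
    have "(x i, y j) \<in> rectangle Q" "x i \<in> {x i..x (Suc i)}" "y j \<in> {y j..y (Suc j)}"
      using bx by' x(1,2) y(1,2) by (auto simp: rectangle_def)
    then show ?thesis
      using sep[of "ps ! i" "qs ! j"] ij(1,2) x(4)[OF i] y(4)[OF j] by (metis nth_mem)
  qed
  let ?cert = "pair (list_encode ps) (list_encode qs)"
  have "separation_cert (L n) (K n) Q' ?cert"
    if "known_chain 0 rat_one (L n) (list_encode ps)" "known_chain rat_one 0 (K n) (list_encode qs)"
      "lower (pfst Q) \<le> lower (pfst Q') \<and> upper (pfst Q') \<le> upper (pfst Q) \<and>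
       lower (psnd Q) \<le> lower (psnd Q') \<and> upper (psnd Q') \<le> upper (psnd Q)" for n Q'
    using that lab chain_ends[OF ps(1)] chain_ends[OF qs(1)] unfolding separation_cert_def
    by (auto simp: code_length_eq code_nth_eq lower_def[of "pfst Q"] upper_def[of "pfst Q"]
        lower_def[of "psnd Q"] upper_def[of "psnd Q"])
  moreover obtain N M where "\<forall>n\<ge>N. known_chain 0 rat_one (L n) (list_encode ps)"
    "\<forall>n\<ge>M. known_chain rat_one 0 (K n) (list_encode qs)"
    using eventually_known_f[OF ps] eventually_known_g[OF qs] by blast
  ultimately show ?thesis
    by (intro exI[of _ "max (max N M) (Suc ?cert)"]) (auto intro!: exI[of _ ?cert])
qed

end

section \<open>The limit of the rectangles\<close>

context crossing_run
begin

lemma good_initial: "good (R 0)"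
proof -
  \<comment> \<open>The mesh -1, 0, 1, 2 separates the square from the collars. On the corner cells
    both paths are on their collars; on the four middle cells \<open>F\<close> is controlled only on
    the frame.\<close>
  let ?x = "\<lambda>i. real i - 1"
  let ?l = "\<lambda>i j. if i = 0 then (if j = 0 then 1 else 2)
    else if j = 2 then (if i = 1 then 2 else 3) else (0 :: nat)"
  have lab: "in_half (?l i j) (F (s, t))"
    if ij: "i \<le> 2" "j \<le> 2" "i = 0 \<or> i = 2 \<or> j = 0 \<or> j = 2"
      and s: "s \<in> {?x i..?x (Suc i)}" and t: "t \<in> {?x j..?x (Suc j)}"
      and fr: "(s, t) \<in> frame (?x 0) (?x (Suc 2)) (?x 0) (?x (Suc 2))" for i j :: nat and s t
  proof -
    have "i = 0 \<or> i = 1 \<or> i = 2" "j = 0 \<or> j = 1 \<or> j = 2" using ij by auto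
    then consider "i = 0" "j = 0" | "i = 1" "j = 0" | "i = 2" "j = 0" | "i = 2" "j = 1"
      | "i = 2" "j = 2" | "i = 1" "j = 2" | "i = 0" "j = 2" | "i = 0" "j = 1"
      using ij(3) by auto
    then show ?thesis
    proof cases
      case 1
      then show ?thesis
        using s t outside(1)[of s] outside(3)[of t] by (simp add: in_half_simps[simplified] path_diff_def)
    next
      case 2
      then have "t = -1" "s \<in> {0..1}" using s t fr by (auto simp: frame_def)
      then show ?thesis
        using 2 in_square(1)[of s] outside(3)[of t] by (simp add: in_half_simps[simplified] path_diff_def)
    next
      case 3
      then show ?thesis
        using s t outside(2)[of s] outside(3)[of t] by (simp add: in_half_simps[simplified] path_diff_def)
    next
      case 4
      then have "s = 2" "t \<in> {0..1}" using s t fr by (auto simp: frame_def)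
      then show ?thesis
        using 4 in_square(3)[of t] outside(2)[of s] by (simp add: in_half_simps[simplified] path_diff_def)
    next
      case 5
      then show ?thesis
        using s t outside(2)[of s] outside(4)[of t] by (simp add: in_half_simps[simplified] path_diff_def)
    next
      case 6
      then have "t = 2" "s \<in> {0..1}" using s t fr by (auto simp: frame_def)
      then show ?thesis
        using 6 in_square(1)[of s] outside(4)[of t] by (simp add: in_half_simps[simplified] path_diff_def)
    next
      case 7
      then show ?thesis
        using s t outside(1)[of s] outside(4)[of t] by (simp add: in_half_simps[simplified] path_diff_def)
    next
      case 8
      then have "s = -1" "t \<in> {0..1}" using s t fr by (auto simp: frame_def)
      then show ?thesis
        using 8 in_square(3)[of t] outside(1)[of s] by (simp add: in_half_simps[simplified] path_diff_def)
    qed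
  qed
  have "odd_on F (?x 0) (?x (Suc 2)) (?x 0) (?x (Suc 2)) \<longleftrightarrow> odd (flip_count 2 2 ?l)"
    by (rule odd_on_iff_flip_count)
      (use lab in \<open>auto intro: continuous_on_path_diff continuous_f continuous_g\<close>)
  \<comment> \<open>The seam is crossed once, on the right edge, where the label changes from 0 to
    3.\<close>
  moreover have "flip_count 2 2 ?l = 1"
    by (simp add: flip_count_def flips_def numeral_2_eq_2)
  moreover have "F z \<noteq> 0" if "z \<in> frame (?x 0) (?x (Suc 2)) (?x 0) (?x (Suc 2))" for z
    by (rule frame_nonzero[of 2 ?x 2 ?x ?l F z]) (use lab that in auto)
  ultimately show ?thesis
    unfolding good_def R_def Y_0 initial_state_def
    by (auto simp: initial_interval[simplified])
qed

section \<open>Invariant and progress of the run\<close>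

lemma refine_mode_0:
  assumes "mode n = 0"
  shows "R (Suc n) = R n" "visits (Suc n) = Suc (visits n)"
    "mode (Suc n) = (if proper_cut (pfst (visits n)) (R n) \<and>
        (\<exists>c<n. separation_cert (L n) (K n) (cut_line (pfst (visits n)) (R n)) c)
      then Suc (pfst (visits n)) else 0)"
  using assms by (simp_all add: R_def mode_def visits_def Y_Suc refine_def)

lemma refine_mode_Suc:
  assumes "mode n = Suc x"
  shows "(\<exists>c<n. odd_cert (L n) (K n) (half_below x (R n)) c) \<and>
      R (Suc n) = half_below x (R n) \<and> mode (Suc n) = 0 \<and> visits (Suc n) = visits n \<or>
    (\<exists>c<n. odd_cert (L n) (K n) (half_above x (R n)) c) \<and>
      R (Suc n) = half_above x (R n) \<and> mode (Suc n) = 0 \<and> visits (Suc n) = visits n \<or>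
    (\<nexists>c. c < n \<and> odd_cert (L n) (K n) (half_below x (R n)) c) \<and>
    (\<nexists>c. c < n \<and> odd_cert (L n) (K n) (half_above x (R n)) c) \<and> Y (Suc n) = Y n"
  using assms by (auto simp: R_def mode_def visits_def Y_Suc refine_def)

lemmas interval_simps = lower_def upper_def prod_encode_inverse fst_conv snd_conv

lemma good_halves:
  assumes Q: "good Q" and cut: "proper_cut x Q" and nz: "\<And>z. z \<in> rectangle (cut_line x Q) \<Longrightarrow> F z \<noteq> 0"
  shows "good (half_below x Q) \<or> good (half_above x Q)"
proof (cases "pfst x = 0")
  case True
  define a b c d m where "a = lower (pfst Q)" and "b = upper (pfst Q)" and "c = lower (psnd Q)"
    and "d = upper (psnd Q)" and "m = rat_of_code (psnd x)"
  have m: "a < m" "m < b" "c < d" "odd_on F a b c d" "\<And>z. z \<in> frame a b c d \<Longrightarrow> F z \<noteq> 0"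
    using Q cut True by (auto simp: good_def proper_cut_def a_def b_def c_def d_def m_def)
  have line: "F (m, t) \<noteq> 0" if "t \<in> {c..d}" for t
    using nz[of "(m, t)"] that True
    by (simp add: rectangle_def cut_line_def c_def d_def m_def lower_def upper_def)
  have "frame a m c d \<subseteq> frame a b c d \<union> {m} \<times> {c..d}" "frame m b c d \<subseteq> frame a b c d \<union> {m} \<times> {c..d}"
    using m by (auto simp: frame_def)
  then have "F z \<noteq> 0" if "z \<in> frame a m c d \<union> frame m b c d" for z
    using that m(5) line by blast
  moreover have "odd_on F a m c d \<or> odd_on F m b c d"
    using odd_on_split[of F a b c d m] m line by auto
  ultimately show ?thesis
    using m True by (auto simp: good_def half_below_def half_above_def interval_simps
        a_def b_def c_def d_def m_def)
next
  case False
  define a b c d m where "a = lower (pfst Q)" and "b = upper (pfst Q)" and "c = lower (psnd Q)"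
    and "d = upper (psnd Q)" and "m = rat_of_code (psnd x)"
  have m: "c < m" "m < d" "a < b" "odd_on F a b c d" "\<And>z. z \<in> frame a b c d \<Longrightarrow> F z \<noteq> 0"
    using Q cut False by (auto simp: good_def proper_cut_def a_def b_def c_def d_def m_def)
  have line: "F (s, m) \<noteq> 0" if "s \<in> {a..b}" for s
    using nz[of "(s, m)"] that False
    by (simp add: rectangle_def cut_line_def a_def b_def m_def lower_def upper_def)
  have "frame a b c m \<subseteq> frame a b c d \<union> {a..b} \<times> {m}" "frame a b m d \<subseteq> frame a b c d \<union> {a..b} \<times> {m}"
    using m by (auto simp: frame_def)
  then have "F z \<noteq> 0" if "z \<in> frame a b c m \<union> frame a b m d" for z
    using that m(5) line by blast
  moreover have "odd_on F a b c m \<or> odd_on F a b m d"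
    using odd_on_split'[of F a b c d m] m line by auto
  ultimately show ?thesis
    using m False by (auto simp: good_def half_below_def half_above_def interval_simps
        a_def b_def c_def d_def m_def)
qed

lemma halves_subset:
  assumes "proper_cut x Q" "Q' = half_below x Q \<or> Q' = half_above x Q"
  shows "lower (pfst Q) \<le> lower (pfst Q')" "upper (pfst Q') \<le> upper (pfst Q)"
    "lower (psnd Q) \<le> lower (psnd Q')" "upper (psnd Q') \<le> upper (psnd Q)"
    "\<not> proper_cut x Q'"
    "lower (pfst Q) < upper (pfst Q) \<Longrightarrow> lower (pfst Q') < upper (pfst Q')"
    "lower (psnd Q) < upper (psnd Q) \<Longrightarrow> lower (psnd Q') < upper (psnd Q')"
  using assms by (auto simp: proper_cut_def half_below_def half_above_def interval_simps split: if_splits)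

text \<open>The clause for mode \<open>Suc x\<close> remembers that the adopted cut is proper and
  free of zeros, from which \<open>good_halves\<close> guarantees a half worth waiting for.\<close>

lemma invariant:
  "good (R n) \<and> (\<forall>x. mode n = Suc x \<longrightarrow>
     proper_cut x (R n) \<and> (\<forall>z\<in>rectangle (cut_line x (R n)). F z \<noteq> 0))"
proof (induction n)
  case 0
  have "mode 0 = 0" by (simp add: mode_def Y_0 initial_state_def prod_decode_0)
  then show ?case using good_initial by simp
next
  case (Suc n)
  show ?case
  proof (cases "mode n")
    case 0
    show ?thesis
      using Suc refine_mode_0[OF 0] separation_cert_sound by auto
  next
    case (Suc x)
    have cut: "proper_cut x (R n)" and lt: "lower (pfst (R n)) < upper (pfst (R n))"
      "lower (psnd (R n)) < upper (psnd (R n))"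
      using \<open>good (R n) \<and> _\<close> Suc by (auto simp: good_def)
    have "good Q" if "\<exists>c<n. odd_cert (L n) (K n) Q c" "Q = half_below x (R n) \<or> Q = half_above x (R n)" for Q
      using that odd_cert_sound halves_subset(6,7)[OF cut that(2)] lt by blast
    then have "good (R (Suc n)) \<and> mode (Suc n) = 0 \<or> Y (Suc n) = Y n"
      using refine_mode_Suc[OF Suc] by metis
    then show ?thesis
      using \<open>good (R n) \<and> _\<close> by (auto simp: R_def mode_def)
  qed
qed

lemma R_Suc_subset:
  "lower (pfst (R n)) \<le> lower (pfst (R (Suc n)))" "upper (pfst (R (Suc n))) \<le> upper (pfst (R n))"
  "lower (psnd (R n)) \<le> lower (psnd (R (Suc n)))" "upper (psnd (R (Suc n))) \<le> upper (psnd (R n))"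
proof -
  have "R (Suc n) = R n \<or> (\<exists>x. proper_cut x (R n) \<and> (R (Suc n) = half_below x (R n) \<or> R (Suc n) = half_above x (R n)))"
  proof (cases "mode n")
    case 0
    then show ?thesis using refine_mode_0 by simp
  next
    case (Suc x)
    then show ?thesis
      using refine_mode_Suc[OF Suc] invariant[of n] by (auto simp: R_def)
  qed
  then show "lower (pfst (R n)) \<le> lower (pfst (R (Suc n)))" "upper (pfst (R (Suc n))) \<le> upper (pfst (R n))"
    "lower (psnd (R n)) \<le> lower (psnd (R (Suc n)))" "upper (psnd (R (Suc n))) \<le> upper (psnd (R n))"
    using halves_subset(1-4) by (metis order_refl)+
qed

lemma R_mono:
  assumes "n \<le> m"
  shows "lower (pfst (R n)) \<le> lower (pfst (R m))" "upper (pfst (R m)) \<le> upper (pfst (R n))"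
    "lower (psnd (R n)) \<le> lower (psnd (R m))" "upper (psnd (R m)) \<le> upper (psnd (R n))"
proof -
  show "lower (pfst (R n)) \<le> lower (pfst (R m))"
    using lift_Suc_mono_le[of "\<lambda>n. lower (pfst (R n))" n m] R_Suc_subset assms by simp
  show "upper (pfst (R m)) \<le> upper (pfst (R n))"
    using lift_Suc_antimono_le[of "\<lambda>n. upper (pfst (R n))" n m] R_Suc_subset assms by simp
  show "lower (psnd (R n)) \<le> lower (psnd (R m))"
    using lift_Suc_mono_le[of "\<lambda>n. lower (psnd (R n))" n m] R_Suc_subset assms by simp
  show "upper (psnd (R m)) \<le> upper (psnd (R n))"
    using lift_Suc_antimono_le[of "\<lambda>n. upper (psnd (R n))" n m] R_Suc_subset assms by simp
qed

text \<open>While the run waits, its state is frozen. One half is good, so its certificate appears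
  eventually and ends the waiting.\<close>

lemma ex_mode_0: "\<exists>n\<ge>N. mode n = 0"
proof (rule ccontr)
  assume no: "\<not> ?thesis"
  have stay: "Y (Suc n) = Y n" if n: "n \<ge> N" for n
  proof -
    obtain x where x: "mode n = Suc x" using no n by (cases "mode n") auto
    have "mode (Suc n) \<noteq> 0" using no n by auto
    then show ?thesis using refine_mode_Suc[OF x] by auto
  qed
  have Y_const: "Y n = Y N" if "n \<ge> N" for n
    using that by (induction n rule: dec_induct) (auto simp: stay)
  have const: "R n = R N" "mode n = mode N" if "n \<ge> N" for n
    unfolding R_def mode_def Y_const[OF that] by (rule refl)+
  obtain x where x: "mode N = Suc x" using no by (cases "mode N") auto
  have "good (half_below x (R N)) \<or> good (half_above x (R N))"
    using invariant[of N] x by (intro good_halves) auto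
  then obtain M where "\<forall>n\<ge>M. (\<exists>c<n. odd_cert (L n) (K n) (half_below x (R N)) c) \<or>
      (\<exists>c<n. odd_cert (L n) (K n) (half_above x (R N)) c)"
    using odd_cert_complete by blast
  then have "(\<exists>c<max N M. odd_cert (L (max N M)) (K (max N M)) (half_below x (R N)) c) \<or>
      (\<exists>c<max N M. odd_cert (L (max N M)) (K (max N M)) (half_above x (R N)) c)"
    by simp
  moreover have "mode (max N M) = Suc x" "R (max N M) = R N" "mode (Suc (max N M)) \<noteq> 0"
    using const[of "max N M"] no x by auto
  ultimately show False
    using refine_mode_Suc[of "max N M" x] by auto
qed

lemma next_mode_0: "\<exists>n\<ge>N. mode n = 0 \<and> visits n = visits N"
proof -
  obtain m where "mode (N + m) = 0" using ex_mode_0[of N] le_Suc_ex by blast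
  then show ?thesis
  proof (induction m arbitrary: N)
    case (Suc m)
    show ?case
    proof (cases "mode N")
      case 0
      then show ?thesis by blast
    next
      case x: (Suc x)
      have "visits (Suc N) = visits N"
        using refine_mode_Suc[OF x] by (auto simp: visits_def)
      then show ?thesis
        using Suc.IH[of "Suc N"] Suc.prems by (auto intro: Suc_leD)
    qed
  qed auto
qed

text \<open>The counter grows by one at each visit of mode 0 and is kept while waiting, so no later
  value is passed over.\<close>

lemma visit:
  assumes "visits N \<le> k"
  shows "\<exists>n\<ge>N. mode n = 0 \<and> visits n = k"
  using assms
proof (induction k rule: dec_induct)
  case base
  then show ?case by (rule next_mode_0)
next
  case (step k)
  then obtain n where n: "n \<ge> N" "mode n = 0" "visits n = k" by blast
  then show ?case
    using next_mode_0[of "Suc n"] refine_mode_0(2)[OF n(2)] by (auto intro: Suc_leD order_trans)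
qed

lemma cut_done:
  assumes "mode N = Suc x"
  shows "\<exists>n\<ge>N. \<not> proper_cut x (R n)"
proof -
  obtain m where "mode (N + m) = 0" using ex_mode_0[of N] le_Suc_ex by blast
  then show ?thesis
    using assms
  proof (induction m arbitrary: N)
    case (Suc m)
    have cut: "proper_cut x (R N)" using invariant[of N] Suc.prems(2) by blast
    show ?case
    proof (cases "Y (Suc N) = Y N")
      case True
      then have "mode (Suc N) = Suc x" using Suc.prems(2) by (simp add: mode_def)
      then show ?thesis
        using Suc.IH[of "Suc N"] Suc.prems(1) by (auto intro: Suc_leD)
    next
      case False
      then have "\<not> proper_cut x (R (Suc N))"
        using refine_mode_Suc[OF Suc.prems(2)] halves_subset(5)[OF cut] by blast
      then show ?thesis by (intro exI[of _ "Suc N"]) simp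
    qed
  qed simp
qed

text \<open>Without a zero on the cut in \<open>R N\<close>, a separation certificate would be
  available from some time on. At its next examination the cut would be adopted, and afterwards be a
  side of the rectangle, hence no longer proper.\<close>

lemma persistent_cut_meets:
  assumes cut: "\<And>n. proper_cut x (R n)"
  shows "\<exists>z\<in>rectangle (cut_line x (R N)). F z = 0"
proof (rule ccontr)
  assume "\<not> ?thesis"
  then have nz: "\<And>z. z \<in> rectangle (cut_line x (R N)) \<Longrightarrow> F z \<noteq> 0" by blast
  have le: "lower (pfst (cut_line x (R N))) \<le> upper (pfst (cut_line x (R N)))"
    "lower (psnd (cut_line x (R N))) \<le> upper (psnd (cut_line x (R N)))"
    using invariant[of N] by (auto simp: cut_line_def good_def interval_simps)
  obtain M where M: "\<And>n Q'. n \<ge> M \<Longrightarrow> lower (pfst (cut_line x (R N))) \<le> lower (pfst Q') \<and>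
      upper (pfst Q') \<le> upper (pfst (cut_line x (R N))) \<and>
      lower (psnd (cut_line x (R N))) \<le> lower (psnd Q') \<and>
      upper (psnd Q') \<le> upper (psnd (cut_line x (R N))) \<Longrightarrow>
      \<exists>c<n. separation_cert (L n) (K n) Q' c"
    using separation_cert_complete[OF le nz] by blast
  \<comment> \<open>Every counter value \<open>pair x y\<close> examines the cut \<open>x\<close>;
    taking the current counter for \<open>y\<close> gives a value that is not yet passed, as a pair
    is at least its second component.\<close>
  define k where "k = pair x (visits (max N M))"
  obtain n where n: "n \<ge> max N M" "mode n = 0" "visits n = k"
    using visit[of "max N M" k] le_prod_encode_2 unfolding k_def by blast
  have "\<exists>c<n. separation_cert (L n) (K n) (cut_line x (R n)) c"
    by (rule M) (use n(1) R_mono[of N n] in \<open>auto simp: cut_line_def interval_simps\<close>)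
  then have "mode (Suc n) = Suc x"
    using refine_mode_0(3)[OF n(2)] cut n(3) by (simp add: k_def)
  then show False using cut_done cut by blast
qed

section \<open>The limit intervals\<close>

definition "A = (SUP n. lower (pfst (R n)))"
definition "B = (INF n. upper (pfst (R n)))"
definition "C = (SUP n. lower (psnd (R n)))"
definition "D = (INF n. upper (psnd (R n)))"

lemma limits:
  "lower (pfst (R n)) \<le> A" "A \<le> B" "B \<le> upper (pfst (R n))"
  "lower (psnd (R n)) \<le> C" "C \<le> D" "D \<le> upper (psnd (R n))"
  "(\<Inter>n. {lower (pfst (R n))..upper (pfst (R n))}) = {A..B}"
  "(\<Inter>n. {lower (psnd (R n))..upper (psnd (R n))}) = {C..D}"
proof -
  have le: "lower (pfst (R n)) \<le> upper (pfst (R m))" "lower (psnd (R n)) \<le> upper (psnd (R m))" for n m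
    using R_mono[of n "max n m"] R_mono[of m "max n m"] invariant[of "max n m"]
    unfolding good_def by (auto; linarith)+
  have bdd: "bdd_above (range (\<lambda>n. lower (pfst (R n))))" "bdd_below (range (\<lambda>n. upper (pfst (R n))))"
    "bdd_above (range (\<lambda>n. lower (psnd (R n))))" "bdd_below (range (\<lambda>n. upper (psnd (R n))))"
    by ((rule bdd_aboveI2 bdd_belowI2, rule le)+)
  show 1: "lower (pfst (R n)) \<le> A" "lower (psnd (R n)) \<le> C" for n
    unfolding A_def C_def by (auto intro: cSUP_upper bdd)
  show 2: "B \<le> upper (pfst (R n))" "D \<le> upper (psnd (R n))" for n
    unfolding B_def D_def by (auto intro: cINF_lower bdd)
  show "A \<le> B" "C \<le> D"
    unfolding A_def B_def C_def D_def by (auto intro!: cSUP_least cINF_greatest le)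
  have "A \<le> s" if "\<And>n. lower (pfst (R n)) \<le> s" for s
    unfolding A_def using that by (auto intro: cSUP_least)
  moreover have "s \<le> B" if "\<And>n. s \<le> upper (pfst (R n))" for s
    unfolding B_def using that by (auto intro: cINF_greatest)
  ultimately show "(\<Inter>n. {lower (pfst (R n))..upper (pfst (R n))}) = {A..B}"
    using 1 2 by (auto intro: order_trans[OF 1(1)] order_trans[OF _ 2(1)])
  have "C \<le> s" if "\<And>n. lower (psnd (R n)) \<le> s" for s
    unfolding C_def using that by (auto intro: cSUP_least)
  moreover have "s \<le> D" if "\<And>n. s \<le> upper (psnd (R n))" for s
    unfolding D_def using that by (auto intro: cINF_greatest)
  ultimately show "(\<Inter>n. {lower (psnd (R n))..upper (psnd (R n))}) = {C..D}"
    using 1 2 by (auto intro: order_trans[OF 1(2)] order_trans[OF _ 2(2)])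
qed

text \<open>The sets \<open>Z \<inter> rectangle (R n)\<close> are compact, nonempty and
  nested.\<close>

lemma meets_limit:
  assumes "closed Z" "\<And>n. Z \<inter> rectangle (R n) \<noteq> {}"
  shows "Z \<inter> {A..B} \<times> {C..D} \<noteq> {}"
proof -
  have "\<Inter> (range (\<lambda>n. Z \<inter> rectangle (R n))) \<noteq> {}"
  proof (rule compact_nest)
    show "compact (Z \<inter> rectangle (R n))" for n
      unfolding rectangle_def by (intro closed_Int_compact assms compact_Times) auto
    show "Z \<inter> rectangle (R n) \<subseteq> Z \<inter> rectangle (R m)" if "m \<le> n" for m n
      using R_mono[OF that] by (auto simp: rectangle_def)
  qed (use assms in auto)
  then obtain z where "z \<in> Z" "\<And>n. z \<in> rectangle (R n)" by blast
  then have "fst z \<in> {A..B}" "snd z \<in> {C..D}"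
    unfolding limits(7,8)[symmetric] by (auto simp: rectangle_def mem_Times_iff)
  then show ?thesis
    using \<open>z \<in> Z\<close> by (auto simp: mem_Times_iff intro!: exI[of _ z])
qed

lemma closed_zeros: "closed {z. F z = 0}"
  using continuous_closed_preimage_constant[OF continuous_on_path_diff[OF continuous_f continuous_g, of UNIV]]
  by simp

lemma limit_zero: "\<exists>s\<in>{A..B}. \<exists>t\<in>{C..D}. f s = g t"
proof -
  have "{z. F z = 0} \<inter> rectangle (R n) \<noteq> {}" for n
  proof -
    have "\<exists>z\<in>rectangle (R n). F z = 0"
      unfolding rectangle_def
      by (rule odd_on_zero) (use invariant[of n] in \<open>auto simp: good_def intro: continuous_on_path_diff continuous_f continuous_g\<close>)
    then show ?thesis by blast
  qed
  from meets_limit[OF closed_zeros this] show ?thesis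
    by (auto simp: path_diff_eq_0_iff)
qed

text \<open>This cut is proper in every rectangle, so each of them contains a zero on the line at
  \<open>r\<close>, and by compactness so does the limit.\<close>

lemma rational_cut_first:
  assumes "A < rat_of_code r" "rat_of_code r < B"
  shows "f (rat_of_code r) \<in> g ` {C..D}"
proof -
  have cut: "proper_cut (pair 0 r) (R n)" for n
    using assms limits(1,3)[of n] by (simp add: proper_cut_def)
  have "({z. F z = 0} \<inter> {rat_of_code r} \<times> UNIV) \<inter> rectangle (R n) \<noteq> {}" for n
  proof -
    obtain z where "z \<in> rectangle (cut_line (pair 0 r) (R n))" "F z = 0"
      using persistent_cut_meets[OF cut] by blast
    then show ?thesis
      using cut[of n] by (auto simp: rectangle_def cut_line_def proper_cut_def interval_simps)
  qed
  moreover have "closed ({z. F z = 0} \<inter> {rat_of_code r} \<times> UNIV)"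
    by (intro closed_Int closed_zeros closed_Times) auto
  ultimately have "({z. F z = 0} \<inter> {rat_of_code r} \<times> UNIV) \<inter> {A..B} \<times> {C..D} \<noteq> {}"
    by (intro meets_limit)
  then show ?thesis by (auto simp: path_diff_eq_0_iff)
qed

lemma rational_cut_second:
  assumes "C < rat_of_code r" "rat_of_code r < D"
  shows "g (rat_of_code r) \<in> f ` {A..B}"
proof -
  have cut: "proper_cut (pair 1 r) (R n)" for n
    using assms limits(4,6)[of n] by (simp add: proper_cut_def)
  have "({z. F z = 0} \<inter> UNIV \<times> {rat_of_code r}) \<inter> rectangle (R n) \<noteq> {}" for n
  proof -
    obtain z where "z \<in> rectangle (cut_line (pair 1 r) (R n))" "F z = 0"
      using persistent_cut_meets[OF cut] by blast
    then show ?thesis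
      using cut[of n] by (auto simp: rectangle_def cut_line_def proper_cut_def interval_simps)
  qed
  moreover have "closed ({z. F z = 0} \<inter> UNIV \<times> {rat_of_code r})"
    by (intro closed_Int closed_zeros closed_Times) auto
  ultimately have "({z. F z = 0} \<inter> UNIV \<times> {rat_of_code r}) \<inter> {A..B} \<times> {C..D} \<noteq> {}"
    by (intro meets_limit)
  then show ?thesis by (force simp: path_diff_eq_0_iff image_iff)
qed

end

lemma image_subset_by_density:
  fixes h :: "real \<Rightarrow> 'a::metric_space"
  assumes h: "continuous_on UNIV h" and G: "closed G"
    and dense: "\<And>r. a < rat_of_code r \<Longrightarrow> rat_of_code r < b \<Longrightarrow> h (rat_of_code r) \<in> G"
    and meets: "h ` {a..b} \<inter> G \<noteq> {}"
  shows "h ` {a..b} \<subseteq> G"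
proof (cases "a < b")
  case True
  have "h s \<in> G" if s: "s \<in> {a..b}" for s
  proof (rule ccontr)
    assume "h s \<notin> G"
    moreover have "open (h -` (- G))"
      using open_vimage[OF _ h] G by blast
    ultimately obtain e where e: "e > 0" "ball s e \<subseteq> h -` (- G)"
      using open_contains_ball by (metis ComplI vimageI)
    obtain r where "max a (s - e) < rat_of_code r" "rat_of_code r < min b (s + e)"
      using code_between[of "max a (s - e)" "min b (s + e)"] True s e(1) by auto
    then show False
      using dense[of r] e(2) by (auto simp: subset_iff dist_real_def abs_less_iff)
  qed
  then show ?thesis by blast
next
  case False
  then have "{a..b} \<subseteq> {a}" by auto
  then show ?thesis using meets by auto
qed

context crossing_run
begin

theorem limit_intervals:
  "closed_interval {A..B}" "closed_interval {C..D}" "{A..B} \<subseteq> {0..1}" "{C..D} \<subseteq> {0..1}"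
  "\<phi> ` {A..B} = \<psi> ` {C..D}"
proof -
  show "closed_interval {A..B}" "closed_interval {C..D}"
    using limits(2,5) by (auto simp: closed_interval_def)
  have "closed (g ` {C..D})" "closed (f ` {A..B})"
    by (intro compact_imp_closed compact_continuous_image continuous_on_subset[OF continuous_f]
        continuous_on_subset[OF continuous_g]; simp)+
  then have "f ` {A..B} \<subseteq> g ` {C..D}" "g ` {C..D} \<subseteq> f ` {A..B}"
    by (intro image_subset_by_density[OF continuous_f] image_subset_by_density[OF continuous_g]
        rational_cut_first rational_cut_second; use limit_zero in force)+
  then have eq: "f ` {A..B} = g ` {C..D}" by blast
  \<comment> \<open>On the collars the abscissa is the parameter, and inside it is in
    \<open>[0, 1]\<close>. So \<open>s < 0\<close> or \<open>s > 1\<close> forces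
    \<open>t = s\<close>, where the ordinates are 0 and 1 in opposite order.\<close>
  have unit: "s \<in> {0..1} \<and> t \<in> {0..1}" if "f s = g t" for s t
  proof -
    have "fst (f s) = fst (g t)" "snd (f s) = snd (g t)" using that by simp_all
    moreover have "s \<le> 0 \<longrightarrow> fst (f s) = s \<and> snd (f s) = 0" "1 \<le> s \<longrightarrow> fst (f s) = s \<and> snd (f s) = 1"
      "t \<le> 0 \<longrightarrow> fst (g t) = t \<and> snd (g t) = 1" "1 \<le> t \<longrightarrow> fst (g t) = t \<and> snd (g t) = 0"
      by (simp_all add: outside)
    moreover have "0 \<le> s \<and> s \<le> 1 \<longrightarrow> 0 \<le> fst (f s) \<and> fst (f s) \<le> 1"
      "0 \<le> t \<and> t \<le> 1 \<longrightarrow> 0 \<le> fst (g t) \<and> fst (g t) \<le> 1"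
      using in_square(1)[of s] in_square(3)[of t] by auto
    ultimately show ?thesis
      unfolding atLeastAtMost_iff by linarith
  qed
  show sub: "{A..B} \<subseteq> {0..1}" "{C..D} \<subseteq> {0..1}"
    using eq unit by (metis imageE imageI subsetI)+
  have "f ` {A..B} = \<phi> ` {A..B}" "g ` {C..D} = \<psi> ` {C..D}"
    unfolding f_def g_def by (intro image_cong refl extend_eq; use sub in blast)+
  then show "\<phi> ` {A..B} = \<psi> ` {C..D}" using eq by simp
qed

end

section \<open>Coded sequences\<close>

text \<open>\<open>\<tau> k\<close> is the position at which the \<open>k\<close>-th block begins.\<close>

lemma encodes_iff_blocks:
  "encodes p s \<longleftrightarrow> (\<exists>\<tau>. \<tau> 0 = 0 \<and> (\<forall>k. \<tau> (Suc k) = \<tau> k + s k + 1 \<and>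
     (\<forall>i<s k. p (\<tau> k + i)) \<and> \<not> p (\<tau> k + s k)))"
proof -
  define w where "w n = concat (map (\<lambda>i. replicate (s i) True @ [False]) [0..<n])" for n
  define \<tau> where "\<tau> n = length (w n)" for n
  define block where "block n \<longleftrightarrow> (\<forall>i<s n. p (\<tau> n + i)) \<and> \<not> p (\<tau> n + s n)" for n
  have w_Suc: "w (Suc n) = w n @ replicate (s n) True @ [False]" for n
    by (simp add: w_def)
  have \<tau>_Suc: "\<tau> (Suc n) = \<tau> n + s n + 1" for n
    by (simp add: \<tau>_def w_Suc)
  have step: "map p [0..<\<tau> (Suc n)] = w (Suc n) \<longleftrightarrow> map p [0..<\<tau> n] = w n \<and> block n" for n
  proof -
    have "[0..<\<tau> (Suc n)] = [0..<\<tau> n] @ [\<tau> n..<\<tau> n + s n] @ [\<tau> n + s n]"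
      using upt_add_eq_append[of 0 "\<tau> n" "s n"] by (simp add: \<tau>_Suc)
    then have "map p [0..<\<tau> (Suc n)] =
        map p [0..<\<tau> n] @ map p [\<tau> n..<\<tau> n + s n] @ [p (\<tau> n + s n)]"
      by (simp only: map_append list.map)
    moreover have "length (map p [0..<\<tau> n]) = length (w n)"
      by (simp add: \<tau>_def)
    ultimately have "map p [0..<\<tau> (Suc n)] = w (Suc n) \<longleftrightarrow>
        map p [0..<\<tau> n] = w n \<and> map p [\<tau> n..<\<tau> n + s n] = replicate (s n) True \<and> \<not> p (\<tau> n + s n)"
      unfolding w_Suc by (simp only: append_eq_append_conv) simp
    moreover have "map p [\<tau> n..<\<tau> n + s n] = replicate (s n) True \<longleftrightarrow> (\<forall>i<s n. p (\<tau> n + i))"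
      by (auto simp: list_eq_iff_nth_eq)
    ultimately show ?thesis by (simp add: block_def)
  qed
  have "map p [0..<\<tau> n] = w n \<longleftrightarrow> (\<forall>k<n. block k)" for n
    by (induction n) (auto simp: step less_Suc_eq, simp_all add: w_def \<tau>_def)
  then have enc: "encodes p s \<longleftrightarrow> (\<forall>k. block k)"
    unfolding encodes_def Let_def w_def[symmetric] \<tau>_def[symmetric] by (metis lessI)
  show ?thesis
  proof
    assume "encodes p s"
    then show "\<exists>\<tau>. \<tau> 0 = 0 \<and> (\<forall>k. \<tau> (Suc k) = \<tau> k + s k + 1 \<and>
        (\<forall>i<s k. p (\<tau> k + i)) \<and> \<not> p (\<tau> k + s k))"
      using \<tau>_Suc enc by (intro exI[of _ \<tau>]) (auto simp: block_def \<tau>_def[of 0] w_def)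
  next
    assume "\<exists>\<tau>. \<tau> 0 = 0 \<and> (\<forall>k. \<tau> (Suc k) = \<tau> k + s k + 1 \<and>
        (\<forall>i<s k. p (\<tau> k + i)) \<and> \<not> p (\<tau> k + s k))"
    then obtain \<rho> where \<rho>: "\<rho> 0 = 0" "\<And>k. \<rho> (Suc k) = \<rho> k + s k + 1"
      "\<And>k. (\<forall>i<s k. p (\<rho> k + i)) \<and> \<not> p (\<rho> k + s k)" by blast
    have "\<rho> k = \<tau> k" for k
      by (induction k) (simp_all add: \<rho>(1,2) \<tau>_Suc, simp add: \<tau>_def w_def)
    then show "encodes p s"
      using \<rho>(3) enc by (simp add: block_def)
  qed
qed

text \<open>Writing a number in unary takes one step more than its value. The data that come up
  meanwhile are dropped, so a subsequence is written.\<close>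

lemma emitted_sequence:
  fixes v :: "nat \<Rightarrow> nat"
  assumes "v 0 = d 0" "\<And>n. v (Suc n) = emit (d (Suc n)) (v n)"
  shows "\<exists>\<tau>. strict_mono \<tau> \<and> encodes (\<lambda>n. v n \<noteq> 0) (\<lambda>k. d (\<tau> k))"
proof -
  define \<tau> where "\<tau> = rec_nat 0 (\<lambda>_ m. m + d m + 1)"
  have \<tau>: "\<tau> 0 = 0" "\<And>k. \<tau> (Suc k) = \<tau> k + d (\<tau> k) + 1"
    by (simp_all add: \<tau>_def)
  have block: "v (m + i) = d m - i" if "v m = d m" "i \<le> d m" for m i
    using that(2)
  proof (induction i)
    case (Suc i)
    then show ?case by (simp add: assms(2) emit_def)
  qed (simp add: that)
  have start: "v (\<tau> k) = d (\<tau> k)" for k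
  proof (induction k)
    case 0
    then show ?case using assms(1) \<tau>(1) by simp
  next
    case (Suc k)
    have "v (\<tau> k + d (\<tau> k)) = 0" using block[OF Suc] by simp
    then show ?case by (simp add: \<tau>(2) assms(2) emit_def)
  qed
  have "encodes (\<lambda>n. v n \<noteq> 0) (\<lambda>k. d (\<tau> k))"
    unfolding encodes_iff_blocks
    by (intro exI[of _ \<tau>]) (auto simp: \<tau> block[OF start])
  moreover have "strict_mono \<tau>"
    by (rule strict_mono_Suc_iff[THEN iffD2]) (simp add: \<tau>(2))
  ultimately show ?thesis by blast
qed

text \<open>At the end of a block, \<open>Suc\<close> of the pair of block length and list code is
  by definition of \<open>list_encode\<close> the code of the list with the length put in
  front.\<close>

lemma read_sequence:
  fixes a :: "nat \<Rightarrow> nat"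
  assumes enc: "encodes p s" and a: "a 0 = 0" "\<And>n. a (Suc n) = read_bit (of_bool (p n)) (a n)"
  shows "set (list_decode (psnd (a n))) \<subseteq> range s"
    and "\<exists>N. \<forall>n\<ge>N. s k \<in> set (list_decode (psnd (a n)))"
proof -
  obtain \<tau> where \<tau>: "\<tau> 0 = 0" "\<And>k. \<tau> (Suc k) = \<tau> k + s k + 1"
    "\<And>k i. i < s k \<Longrightarrow> p (\<tau> k + i)" "\<And>k. \<not> p (\<tau> k + s k)"
    using enc unfolding encodes_iff_blocks by blast
  have block: "a (\<tau> k + i) = pair i (psnd (a (\<tau> k)))" if "pfst (a (\<tau> k)) = 0" "i \<le> s k" for k i
    using that(2)
  proof (induction i)
    case 0
    then show ?case using that(1) by (metis add_0_right prod.collapse prod_decode_inverse)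
  next
    case (Suc i)
    then show ?case using \<tau>(3)[of i k] by (simp add: a(2) read_bit_def)
  qed
  have start: "pfst (a (\<tau> k)) = 0 \<and> list_decode (psnd (a (\<tau> k))) = rev (map s [0..<k])" for k
  proof (induction k)
    case 0
    then show ?case by (simp add: \<tau>(1) a(1) prod_decode_0)
  next
    case (Suc k)
    have "a (\<tau> (Suc k)) = pair 0 (Suc (pair (s k) (psnd (a (\<tau> k)))))"
      using block[of k "s k"] Suc \<tau>(4)[of k] by (simp add: \<tau>(2) a(2) read_bit_def)
    then show ?case using Suc by simp
  qed
  have "\<exists>k i. i \<le> s k \<and> n = \<tau> k + i" for n
  proof (induction n)
    case 0
    then show ?case using \<tau>(1) by (intro exI[of _ 0]) simp
  next
    case (Suc n)
    then obtain k i where "i \<le> s k" "n = \<tau> k + i" by blast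
    then show ?case
    proof (cases "i = s k")
      case True
      then show ?thesis using \<open>n = _\<close> by (intro exI[of _ "Suc k"] exI[of _ 0]) (simp add: \<tau>(2))
    next
      case False
      then show ?thesis using \<open>n = _\<close> \<open>i \<le> s k\<close> by (intro exI[of _ k] exI[of _ "Suc i"]) simp
    qed
  qed
  then show "set (list_decode (psnd (a n))) \<subseteq> range s" for n
    using block start by (metis (no_types) image_mono prod_encode_inverse set_map set_rev snd_conv subset_UNIV)
  have mono: "set (list_decode (psnd (a n))) \<subseteq> set (list_decode (psnd (a (Suc n))))" for n
    using prod_decode_inverse[of "a n"] by (cases "prod_decode (a n)") (auto simp: a(2) read_bit_def)
  have "s k \<in> set (list_decode (psnd (a n)))" if "n \<ge> \<tau> (Suc k)" for n
    using that
  proof (induction n rule: dec_induct)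
    case base
    then show ?case using start[of "Suc k"] by simp
  next
    case (step n)
    then show ?case using mono by blast
  qed
  then show "\<exists>N. \<forall>n\<ge>N. s k \<in> set (list_decode (psnd (a n)))" by blast
qed

text \<open>A cofinal subsequence of nested intervals has the same intersection. \<open>u\<close>
  gives the times at which intervals are sampled; it may lag by one, which is made up for by passing
  to the next block.\<close>

lemma outer_rep_emitted:
  fixes v I :: "nat \<Rightarrow> nat" and u :: "nat \<Rightarrow> nat"
  assumes v: "v 0 = I (u 0)" "\<And>n. v (Suc n) = emit (I (u (Suc n))) (v n)"
    and u: "mono u" "\<And>n. n \<le> Suc (u n)"
    and le: "\<And>n. lower (I n) \<le> upper (I n)"
    and mono: "\<And>n m. n \<le> m \<Longrightarrow> lower (I n) \<le> lower (I m)" "\<And>n m. n \<le> m \<Longrightarrow> upper (I m) \<le> upper (I n)"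
    and S: "closed_interval S" "S = (\<Inter>n. {lower (I n)..upper (I n)})"
  shows "outer_rep (\<lambda>n. v n \<noteq> 0) S"
proof -
  obtain \<tau> where \<tau>: "strict_mono \<tau>" "encodes (\<lambda>n. v n \<noteq> 0) (\<lambda>k. I (u (\<tau> k)))"
    using emitted_sequence[of v "\<lambda>n. I (u n)", OF v] by blast
  have "S = (\<Inter>k. {lower (I (u (\<tau> k)))..upper (I (u (\<tau> k)))})"
  proof
    show "S \<subseteq> (\<Inter>k. {lower (I (u (\<tau> k)))..upper (I (u (\<tau> k)))})"
      unfolding S(2) by blast
    have "{lower (I (u (\<tau> (Suc n))))..upper (I (u (\<tau> (Suc n))))} \<subseteq> {lower (I n)..upper (I n)}" for n
    proof -
      have "n \<le> u (\<tau> (Suc n))"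
        using u(2)[of "\<tau> (Suc n)"] strict_mono_imp_increasing[OF \<tau>(1), of "Suc n"] by simp
      then show ?thesis using mono[of n "u (\<tau> (Suc n))"] by auto
    qed
    then show "(\<Inter>k. {lower (I (u (\<tau> k)))..upper (I (u (\<tau> k)))}) \<subseteq> S"
      unfolding S(2) by blast
  qed
  moreover have "u (\<tau> n) \<le> u (\<tau> (Suc n))" for n
    using u(1) \<tau>(1) by (meson lessI less_imp_le monoD strict_monoD)
  ultimately show ?thesis
    unfolding outer_rep_def using S(1) \<tau>(2) le mono
    by (intro conjI exI[of _ "\<lambda>k. I (u (\<tau> k))"] allI) auto
qed

text \<open>Both emitters start loaded with the code of \<open>[-1, 2]\<close>, since a bit is
  written before any rectangle has been loaded.\<close>

definition start_code :: nat where
  "start_code = pair 0 (make_state 0 0 0 initial_state (pair (pair 1 0) (pair 4 0)) (pair (pair 1 0) (pair 4 0)))"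

theorem theorem2:
  "computable_operator (pair_rep path_rep path_rep) (pair_rep outer_rep outer_rep)
     crossing_paths intersection_op"
proof -
  let ?F = "\<lambda>p. Some (\<lambda>n. pfst (state_at update_code start_code p (Suc n)) \<noteq> 0)"
  have "\<exists>q y. ?F p = Some q \<and> pair_rep outer_rep outer_rep q y \<and> y \<in> intersection_op paths"
    if "paths \<in> crossing_paths" and name: "pair_rep path_rep path_rep p paths" for paths p
  proof -
    from that(1) obtain \<phi> \<psi> where paths: "paths = (\<phi>, \<psi>)" "(\<phi>, \<psi>) \<in> crossing_paths"
      by (cases paths) auto
    obtain s s' where s: "encodes (\<lambda>n. p (2 * n)) s" "range s = subbasic_codes \<phi>"
      and s': "encodes (\<lambda>n. p (2 * n + 1)) s'" "range s' = subbasic_codes \<psi>"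
      using name unfolding paths pair_rep_def path_rep_def by auto
    define I0 :: nat where "I0 = pair (pair 1 0) (pair 4 0)"
    define st where "st n = psnd (state_at update_code start_code p n)" for n
    define a where "a n = pfst (psnd (st n))" for n
    define b where "b n = pfst (psnd (psnd (st n)))" for n
    define Y where "Y n = pfst (psnd (psnd (psnd (st n))))" for n
    define v where "v n = pfst (psnd (psnd (psnd (psnd (st n)))))" for n
    define w where "w n = psnd (psnd (psnd (psnd (psnd (st n)))))" for n
    note comps = a_def b_def Y_def v_def w_def
    have init: "pfst (st 0) = 0" "a 0 = 0" "b 0 = 0" "Y 0 = initial_state" "v 0 = I0" "w 0 = I0"
      by (simp_all add: comps st_def start_code_def make_state_def I0_def)
    have rec: "state_at update_code start_code p (Suc n) =
        update (of_bool (p n)) (pfst (st n)) (a n) (b n) (Y n) (v n) (w n)" for n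
      by (simp add: update_code_def comps st_def)
    have time: "pfst (st n) = n" for n
      by (induction n) (simp_all add: init(1) st_def[of "Suc _"] rec update_def make_state_def del: state_at.simps)
    note rec = rec[unfolded time]
    have even: "a (Suc n) = read_bit (of_bool (p n)) (a n)" "b (Suc n) = b n"
        "v (Suc n) = emit (pfst (pfst (Y n))) (v n)" "w (Suc n) = w n"
        "pfst (state_at update_code start_code p (Suc n)) = v n" if "even n" for n
      using that by (simp_all add: comps[of "Suc n"] st_def[of "Suc n"] rec update_def make_state_def del: state_at.simps)
    have odd: "a (Suc n) = a n" "b (Suc n) = read_bit (of_bool (p n)) (b n)"
        "v (Suc n) = v n" "w (Suc n) = emit (psnd (pfst (Y n))) (w n)"
        "pfst (state_at update_code start_code p (Suc n)) = w n" if "odd n" for n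
      using that by (simp_all add: comps[of "Suc n"] st_def[of "Suc n"] rec update_def make_state_def del: state_at.simps)
    have Y_Suc: "Y (Suc n) = refine n (psnd (a n)) (psnd (b n)) (Y n)" for n
      by (simp add: Y_def[of "Suc n"] st_def[of "Suc n"] rec update_def make_state_def del: state_at.simps)
    \<comment> \<open>Each name occupies every second position, so the readers are viewed in the
      time of their own name.\<close>
    define a' where "a' m = a (2 * m)" for m
    define b' where "b' m = b (2 * m)" for m
    have a': "a' 0 = 0" "\<And>m. a' (Suc m) = read_bit (of_bool (p (2 * m))) (a' m)"
      by (simp_all add: a'_def init even odd)
    have b': "b' 0 = 0" "\<And>m. b' (Suc m) = read_bit (of_bool (p (2 * m + 1))) (b' m)"
      by (simp_all add: b'_def init even odd)
    have a_half: "a n = a' ((n + 1) div 2)" for n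
      by (cases "even n") (auto simp: a'_def odd elim!: evenE oddE)
    have b_half: "b n = b' (n div 2)" for n
      by (cases "even n") (auto simp: b'_def even elim!: evenE oddE)
    note ra = read_sequence[OF s(1) a'] and rb = read_sequence[OF s'(1) b']
    interpret crossing_run \<phi> \<psi> "\<lambda>n. psnd (a n)" "\<lambda>n. psnd (b n)" Y
    proof
      show "(\<phi>, \<psi>) \<in> crossing_paths" by (rule paths(2))
      show "set (list_decode (psnd (a n))) \<subseteq> subbasic_codes \<phi>" for n
        using ra(1) s(2) by (simp add: a_half)
      show "set (list_decode (psnd (b n))) \<subseteq> subbasic_codes \<psi>" for n
        using rb(1) s'(2) by (simp add: b_half)
      show "\<exists>N. \<forall>n\<ge>N. P \<in> set (list_decode (psnd (a n)))" if P: "P \<in> subbasic_codes \<phi>" for P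
      proof -
        obtain k where "P = s k" using P s(2) by blast
        then obtain N where "\<forall>n\<ge>N. P \<in> set (list_decode (psnd (a' n)))" using ra(2) by blast
        then have "\<forall>n\<ge>2 * N. P \<in> set (list_decode (psnd (a n)))"
          by (auto simp: a_half)
        then show ?thesis by blast
      qed
      show "\<exists>N. \<forall>n\<ge>N. P \<in> set (list_decode (psnd (b n)))" if P: "P \<in> subbasic_codes \<psi>" for P
      proof -
        obtain k where "P = s' k" using P s'(2) by blast
        then obtain N where "\<forall>n\<ge>N. P \<in> set (list_decode (psnd (b' n)))" using rb(2) by blast
        then have "\<forall>n\<ge>2 * N. P \<in> set (list_decode (psnd (b n)))"
          by (auto simp: b_half)
        then show ?thesis by blast
      qed
    qed (simp_all add: init Y_Suc)
    have R0: "pfst (R 0) = I0" "psnd (R 0) = I0"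
      by (simp_all add: R_def init initial_state_def I0_def)
    have le: "lower (pfst (R n)) \<le> upper (pfst (R n))" "lower (psnd (R n)) \<le> upper (psnd (R n))" for n
      using invariant[of n] by (auto simp: good_def)
    text \<open>
      \<open>v\<close> is reloaded at even and \<open>w\<close> at odd times; the first value written comes from
      \<open>R 0\<close>, which the truncated subtractions account for.
    \<close>
    have "outer_rep (\<lambda>m. v (2 * m) \<noteq> 0) {A..B}"
    proof (rule outer_rep_emitted[where I = "\<lambda>n. pfst (R n)" and u = "\<lambda>m. 2 * (m - 1)"])
      show "v (2 * Suc n) = emit (pfst (R (2 * (Suc n - 1)))) (v (2 * n))" for n
        by (simp add: even odd R_def)
    qed (use R_mono le limits(7) limit_intervals R0 init in \<open>auto intro!: monoI\<close>)
    moreover have "outer_rep (\<lambda>m. w (2 * m) \<noteq> 0) {C..D}"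
    proof (rule outer_rep_emitted[where I = "\<lambda>n. psnd (R n)" and u = "\<lambda>m. 2 * m - 1"])
      show "w (2 * Suc n) = emit (psnd (R (2 * Suc n - 1))) (w (2 * n))" for n
        by (simp add: even odd R_def)
    qed (use R_mono le limits(8) limit_intervals R0 init in \<open>auto intro!: monoI\<close>)
    \<comment> \<open>Position \<open>2 * m + 1\<close> is written from
      \<open>w (2 * m + 1)\<close>, and the even round before it leaves \<open>w\<close>
      alone.\<close>
    moreover have "w (2 * m + 1) = w (2 * m)" for m
      by (simp add: even)
    ultimately have "pair_rep outer_rep outer_rep
        (\<lambda>n. pfst (state_at update_code start_code p (Suc n)) \<noteq> 0) ({A..B}, {C..D})"
      by (simp add: pair_rep_def even odd del: state_at.simps)
    moreover have "({A..B}, {C..D}) \<in> intersection_op paths"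
      using limit_intervals by (simp add: paths intersection_op_def)
    ultimately show ?thesis
      by blast
  qed
  then show ?thesis
    unfolding computable_operator_def
    using computable_fun_primrec[OF primrec_update_code] by blast
qed

end
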